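(* Let $R$ be an infinite division ring. Then the homomorphism $K_1^\oplus(R)\to K_1(R_R)$ induced by the inclusion functor $\mathrm{Free}(R)\to\mathcal S(R_R)$ (sending the free module $R^n$ to the definable set $R^n$ and an $R$-linear isomorphism to itself, which is a definable bijection) is injective, i.e. it is a natural embedding of $K_1^\oplus(R)$ into $K_1(R_R)$.
   Context: $K_1^\oplus(R)$ denotes the algebraic $K_1$-group of $R$ (equivalently $GL(R)^{ab}$ with $GL(R)=\varinjlim_n GL_n(R)$). $\mathrm{Free}(R)$ is the groupoid of finitely generated free right $R$-modules and their isomorphisms. $R_R$ is regarded as a first-order structure in the language $L_R=\langle +,-,0,\{\cdot_r:r\in R\}\rangle$ ($\cdot_r$ = right multiplication by $r$); $\mathcal S(R_R)$ is the groupoid of subsets of finite powers of $R$ definable with parameters, with definable bijections (bijections with definable graph) as morphisms, symmetric monoidal under disjoint union; $K_1(R_R)$ is $\pi_1$ of the geometric realization of Quillen's $\mathcal S^{-1}\mathcal S$ construction on $(\mathcal S(R_R),\sqcup,\emptyset)$, equivalently $\varinjlim_E\mathrm{Aut}_{\mathcal S(R_R)}(E)^{ab}$.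
   Formalization: The inclusion functor does not turn ⊕ into ⊔, so no single map fits all R^n; proved for each n ≥ 1: the unique homomorphism with [A] ↦ [A on R^n] for A in GL_n(R) is injective. A acts by x ↦ xA on row vectors, as x ↦ Ax need not be definable if R is noncommutative. *)

theory Defs
  imports
    "Jordan_Normal_Form.Matrix"
    "HOL-Algebra.Bij"
    "HOL-Algebra.Generated_Groups"
    "HOL-Algebra.Free_Abelian_Groups"
begin

section \<open>Algebraic \<open>K\<^sub>1\<close>\<close>

definition GLn :: "nat \<Rightarrow> 'a::ring_1 mat monoid" where
  "GLn n = units_of (ring_mat TYPE('a) n ())"

text \<open>The direct limit \<open>GL(R)\<close> along \<open>A \<mapsto> diag(A, 1)\<close> is realised as the union of the images of
  the \<open>GL\<^sub>n(R)\<close> in the \<open>\<nat> \<times> \<nat>\<close> matrices that agree with the identity outside a finite corner.\<close>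

definition stab :: "'a::ring_1 mat \<Rightarrow> nat \<Rightarrow> nat \<Rightarrow> 'a" where
  "stab A = (\<lambda>i j. if i < dim_row A \<and> j < dim_col A then A $$ (i, j) else if i = j then 1 else 0)"

definition GL :: "(nat \<Rightarrow> nat \<Rightarrow> 'a::ring_1) monoid" where
  "GL = \<lparr>carrier = (\<Union>n. stab ` carrier (GLn n)),
         mult = (\<lambda>M N i j. \<Sum>k | M i k \<noteq> 0. M i k * N k j),
         one = (\<lambda>i j. if i = j then 1 else 0)\<rparr>"

definition K1_alg :: "(nat \<Rightarrow> nat \<Rightarrow> 'a::ring_1) set monoid" where
  "K1_alg = GL Mod derived GL (carrier GL)"

definition K1_alg_class :: "'a::ring_1 mat \<Rightarrow> (nat \<Rightarrow> nat \<Rightarrow> 'a) set" where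
  "K1_alg_class A = derived GL (carrier GL) #>\<^bsub>GL\<^esub> stab A"


section \<open>Definable sets of the right module \<open>R\<^sub>R\<close>\<close>

datatype 'a tm = Var nat | Zero | Add "'a tm" "'a tm" | Neg "'a tm" | Scal "'a tm" 'a

datatype 'a fm = FEq "'a tm" "'a tm" | FNot "'a fm" | FAnd "'a fm" "'a fm" | FEx nat "'a fm"

primrec val :: "(nat \<Rightarrow> 'a::ring_1) \<Rightarrow> 'a tm \<Rightarrow> 'a" where
  "val e (Var i) = e i"
| "val e Zero = 0"
| "val e (Add s t) = val e s + val e t"
| "val e (Neg t) = - val e t"
| "val e (Scal t r) = val e t * r"

primrec sat :: "(nat \<Rightarrow> 'a::ring_1) \<Rightarrow> 'a fm \<Rightarrow> bool" where
  "sat e (FEq s t) \<longleftrightarrow> val e s = val e t"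
| "sat e (FNot p) \<longleftrightarrow> \<not> sat e p"
| "sat e (FAnd p q) \<longleftrightarrow> sat e p \<and> sat e q"
| "sat e (FEx i p) \<longleftrightarrow> (\<exists>a. sat (e(i := a)) p)"

text \<open>The variables below \<open>n\<close> stand for the coordinates of a point of \<open>R\<^sup>n\<close>; the assignment \<open>e\<close>
  supplies parameters for the remaining free variables of the formula.\<close>

definition definable :: "'a::ring_1 vec set \<Rightarrow> bool" where
  "definable D \<longleftrightarrow> (\<exists>n p e. D = {v \<in> carrier_vec n. sat (\<lambda>i. if i < n then v $ i else e i) p})"

definition definable_map :: "'a::ring_1 vec set \<Rightarrow> 'a vec set \<Rightarrow> ('a vec \<Rightarrow> 'a vec) \<Rightarrow> bool" where
  "definable_map E F f \<longleftrightarrow> definable E \<and> definable F \<and> f \<in> E \<rightarrow>\<^sub>E F \<and> definable ((\<lambda>v. v @\<^sub>v f v) ` E)"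

definition Aut :: "'a::ring_1 vec set \<Rightarrow> ('a vec \<Rightarrow> 'a vec) monoid" where
  "Aut E = (BijGroup E)\<lparr>carrier := {f \<in> Bij E. definable_map E E f}\<rparr>"


section \<open>Model-theoretic \<open>K\<^sub>1\<close>\<close>

text \<open>The colimit of the groups \<open>Aut(E)\<^sup>a\<^sup>b\<close> is indexed by the translation category of
  \<open>(\<S>(R\<^sub>R), \<squnion>, \<emptyset>)\<close>, whose morphisms \<open>E \<rightarrow> G\<close> are the pairs of a definable set \<open>F\<close> and a
  definable bijection \<open>E \<squnion> F \<cong> G\<close>, up to isomorphism of \<open>F\<close>. Restriction to \<open>E\<close> identifies them
  with the definable injections \<open>h : E \<rightarrow> G\<close> (\<open>F\<close> being the complement of the image), and the
  automorphism \<open>f \<squnion> id\<^sub>F\<close> of \<open>G\<close> induced by \<open>f\<close> is the following one.\<close>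

definition push ::
  "'a vec set \<Rightarrow> 'a vec set \<Rightarrow> ('a vec \<Rightarrow> 'a vec) \<Rightarrow> ('a vec \<Rightarrow> 'a vec) \<Rightarrow> 'a vec \<Rightarrow> 'a vec" where
  "push E G h f = (\<lambda>y\<in>G. if y \<in> h ` E then h (f (inv_into E h y)) else y)"

text \<open>The colimit itself is presented as an abelian group by the generators \<open>(E, f)\<close> with
  \<open>f \<in> Aut(E)\<close>. The first family of relations turns each \<open>Aut(E)\<close> into \<open>Aut(E)\<^sup>a\<^sup>b\<close>, the second
  one imposes compatibility with the transition maps.\<close>

definition K1_gens :: "('a::ring_1 vec set \<times> ('a vec \<Rightarrow> 'a vec)) set" where
  "K1_gens = {(E, f). definable E \<and> f \<in> carrier (Aut E)}"

definition K1_rels :: "('a::ring_1 vec set \<times> ('a vec \<Rightarrow> 'a vec) \<Rightarrow>\<^sub>0 int) set" where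
  "K1_rels =
     {frag_of (E, g \<otimes>\<^bsub>Aut E\<^esub> f) - (frag_of (E, g) + frag_of (E, f)) | E f g.
        (E, f) \<in> K1_gens \<and> (E, g) \<in> K1_gens} \<union>
     {frag_of (G, push E G h f) - frag_of (E, f) | E G h f.
        (E, f) \<in> K1_gens \<and> definable_map E G h \<and> inj_on h E}"

abbreviation K1_rel_subgroup :: "('a::ring_1 vec set \<times> ('a vec \<Rightarrow> 'a vec) \<Rightarrow>\<^sub>0 int) set" where
  "K1_rel_subgroup \<equiv> generate (free_Abelian_group K1_gens) K1_rels"

definition K1_mod :: "('a::ring_1 vec set \<times> ('a vec \<Rightarrow> 'a vec) \<Rightarrow>\<^sub>0 int) set monoid" where
  "K1_mod = free_Abelian_group K1_gens Mod K1_rel_subgroup"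

definition K1_mod_class ::
  "'a::ring_1 vec set \<Rightarrow> ('a vec \<Rightarrow> 'a vec) \<Rightarrow> ('a vec set \<times> ('a vec \<Rightarrow> 'a vec) \<Rightarrow>\<^sub>0 int) set" where
  "K1_mod_class E f = K1_rel_subgroup #>\<^bsub>free_Abelian_group K1_gens\<^esub> frag_of (E, f)"


section \<open>The comparison homomorphism\<close>

text \<open>The language only contains right multiplications, so the linear bijection of \<open>R\<^sup>n\<close> attached
  to a matrix is \<open>x \<mapsto> xA\<close> on row vectors; for noncommutative \<open>R\<close>, \<open>x \<mapsto> Ax\<close> is in general not
  definable. The assignment reverses products, which is immaterial in the abelian group
  \<^const>\<open>K1_mod\<close>.\<close>

definition lin :: "'a::ring_1 mat \<Rightarrow> 'a vec \<Rightarrow> 'a vec" where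
  "lin A = (\<lambda>x\<in>carrier_vec (dim_row A).
     vec (dim_col A) (\<lambda>j. \<Sum>i<dim_row A. x $ i * A $$ (i, j)))"

text \<open>The homomorphism out of \<open>K\<^sub>1\<^sup>\<oplus>(R)\<close> induced by the inclusion functor on
  \<open>Aut(R\<^sup>n) = GL\<^sub>n(R)\<close>. The level \<open>n\<close> has to be fixed: the inclusion functor takes \<open>\<oplus>\<close> to \<open>\<times>\<close> and
  not to \<open>\<squnion>\<close>, and the classes of \<open>A\<close> on \<open>R\<^sup>n\<close> and of \<open>diag(A, 1)\<close> on \<open>R\<^sup>n\<^sup>+\<^sup>1\<close> differ in general.
  Extensionality only serves to make the function unique off the carrier.\<close>

definition induced_hom ::
  "nat \<Rightarrow> ((nat \<Rightarrow> nat \<Rightarrow> 'a::ring_1) set \<Rightarrow> ('a vec set \<times> ('a vec \<Rightarrow> 'a vec) \<Rightarrow>\<^sub>0 int) set) \<Rightarrow> bool"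
where
  "induced_hom n \<Phi> \<longleftrightarrow>
     \<Phi> \<in> hom K1_alg K1_mod \<and> \<Phi> \<in> extensional (carrier K1_alg) \<and>
     (\<forall>A \<in> carrier (GLn n). \<Phi> (K1_alg_class A) = K1_mod_class (carrier_vec n) (lin A))"

text \<open>The generators used in \<^const>\<open>induced_hom\<close> are legitimate: \<open>x \<mapsto> xA\<close> is a definable bijection.\<close>

lemma definable_carrier_vec: "definable (carrier_vec n :: 'a::ring_1 vec set)"
  unfolding definable_def by (intro exI[of _ n] exI[of _ "FEq Zero Zero"]) auto

lemma lin_mult:
  assumes "A \<in> carrier_mat n n" "B \<in> carrier_mat n n" "x \<in> carrier_vec n"
  shows "lin B (lin A x) = lin (A * B) x"
proof (rule eq_vecI)
  fix j assume "j < dim_vec (lin (A * B) x)"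
  then have j: "j < n" using assms by (auto simp: lin_def)
  have "lin B (lin A x) $ j = (\<Sum>k<n. (\<Sum>i<n. x $ i * A $$ (i, k)) * B $$ (k, j))"
    using assms j by (auto simp: lin_def)
  also have "\<dots> = (\<Sum>i<n. x $ i * (\<Sum>k<n. A $$ (i, k) * B $$ (k, j)))"
    by (simp add: sum_distrib_left sum_distrib_right mult.assoc) (rule sum.swap)
  also have "\<dots> = lin (A * B) x $ j"
    using assms j by (auto simp: lin_def scalar_prod_def lessThan_atLeast0 intro!: sum.cong)
  finally show "lin B (lin A x) $ j = lin (A * B) x $ j" .
qed (use assms in \<open>auto simp: lin_def\<close>)

lemma lin_one:
  assumes "x \<in> carrier_vec n"
  shows "lin (1\<^sub>m n) x = x"
proof (rule eq_vecI)
  fix j assume "j < dim_vec x"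
  then have j: "j < n" using assms by simp
  then have "lin (1\<^sub>m n) x $ j = (\<Sum>i<n. x $ i * (if i = j then 1 else 0))"
    using assms by (simp add: lin_def)
  also have "\<dots> = (\<Sum>i<n. if i = j then x $ i else 0)"
    by (rule sum.cong) auto
  also have "\<dots> = x $ j" using j by simp
  finally show "lin (1\<^sub>m n) x $ j = x $ j" .
qed (use assms in \<open>simp add: lin_def\<close>)

lemma definable_lin_graph:
  assumes "A \<in> carrier_mat n n"
  shows "definable ((\<lambda>v. v @\<^sub>v lin A v) ` carrier_vec n)"
proof -
  define t where "t j m = rec_nat Zero (\<lambda>i s. Add s (Scal (Var i) (A $$ (i, j)))) m" for j m
  define p where "p m = rec_nat (FEq Zero Zero) (\<lambda>j q. FAnd q (FEq (t j n) (Var (n + j)))) m" for m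
  have t: "val e (t j m) = (\<Sum>i<m. e i * A $$ (i, j))" for e j m
    by (induction m) (auto simp: t_def)
  have p: "sat e (p m) \<longleftrightarrow> (\<forall>j<m. (\<Sum>i<n. e i * A $$ (i, j)) = e (n + j))" for e m
  proof (induction m)
    case (Suc m)
    have "sat e (p (Suc m)) \<longleftrightarrow> sat e (p m) \<and> val e (t m n) = e (n + m)"
      by (simp add: p_def)
    then show ?case using Suc t by (auto simp: less_Suc_eq)
  qed (simp add: p_def)
  have "(\<lambda>v. v @\<^sub>v lin A v) ` carrier_vec n =
    {w \<in> carrier_vec (n + n). sat (\<lambda>i. if i < n + n then w $ i else 0) (p n)}" (is "?L = ?R")
  proof
    show "?L \<subseteq> ?R"
      using assms by (auto simp: p lin_def append_vec_def Let_def)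
    show "?R \<subseteq> ?L"
    proof
      fix w assume w: "w \<in> ?R"
      then have dim: "dim_vec w = n + n" by simp
      from w have eq: "(\<Sum>i<n. w $ i * A $$ (i, j)) = w $ (n + j)" if "j < n" for j
        using that by (auto simp: p)
      have "w = vec_first w n @\<^sub>v lin A (vec_first w n)"
      proof (rule eq_vecI)
        fix k assume "k < dim_vec (vec_first w n @\<^sub>v lin A (vec_first w n))"
        then have k: "k < n + n" using assms by (simp add: lin_def)
        show "w $ k = (vec_first w n @\<^sub>v lin A (vec_first w n)) $ k"
        proof (cases "k < n")
          case True
          then show ?thesis using k assms by (simp add: append_vec_def Let_def lin_def vec_first_def)
        next
          case False
          then show ?thesis
            using k assms eq[of "k - n"]
            by (simp add: append_vec_def Let_def lin_def vec_first_def)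
        qed
      qed (use assms dim in \<open>simp add: lin_def\<close>)
      then show "w \<in> ?L" by (metis image_eqI vec_first_carrier)
    qed
  qed
  then show ?thesis
    unfolding definable_def by (intro exI[of _ "n + n"] exI[of _ "p n"] exI[of _ "\<lambda>_. 0"])
qed

lemma lin_in_Aut:
  assumes "A \<in> carrier (GLn n)"
  shows "lin A \<in> carrier (Aut (carrier_vec n))"
proof -
  obtain B where A: "A \<in> carrier_mat n n" and B: "B \<in> carrier_mat n n"
    and AB: "A * B = 1\<^sub>m n" "B * A = 1\<^sub>m n"
    using assms by (auto simp: GLn_def units_of_def Units_def ring_mat_simps)
  have car: "lin C \<in> carrier_vec n \<rightarrow>\<^sub>E carrier_vec n" if "C \<in> carrier_mat n n" for C :: "'a mat"
    using that by (auto simp: lin_def)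
  have "bij_betw (lin A) (carrier_vec n) (carrier_vec n)"
    using car[OF A] car[OF B]
    by (intro bij_betw_byWitness[where f' = "lin B"])
      (auto simp: lin_mult[OF A B] lin_mult[OF B A] AB lin_one PiE_iff)
  then show ?thesis
    using car[OF A] definable_lin_graph[OF A] definable_carrier_vec
    by (auto simp: Aut_def Bij_def definable_map_def PiE_iff)
qed

end

theory Submission
  imports Defs
begin

text \<open>Quantifier elimination shows that a definable set is a Boolean combination of affine sets. As an affine set
  over an infinite division ring is never a finite union of proper affine subsets, the indicator function of a
  definable set is a unique integral combination of indicators of affine sets. Applied to the graph of a
  definable bijection \<open>f\<close>, this yields a combination \<open>\<Sum> c\<^sub>L L\<close> of graphs of affine isomorphisms. After a choice of
  reference coordinates on every affine set, each \<open>n\<close>-dimensional \<open>L\<close> has a determinant in \<open>K\<^sub>1\<^sup>\<oplus>(R)\<close>, and the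
  product of their powers with exponents \<open>c\<^sub>L\<close> is functorial in \<open>f\<close> and additive for disjoint unions. It therefore
  defines a homomorphism on \<open>K\<^sub>1(R\<^sub>R)\<close>, and this is a retraction of the comparison map at level \<open>n\<close>.

  That the comparison map is well defined at a fixed level \<open>n\<close> is injective stability for \<open>K\<^sub>1\<close>: every homomorphism
  from \<open>GL\<^sub>n(R)\<close> to an abelian group kills transvections, hence factors through the Dieudonne determinant, which is
  defined on all of \<open>GL(R)\<close>.\<close>

section \<open>Affine sets\<close>

text \<open>Only pieces \<open>L\<close> with coordinates from \<open>R^n\<close> count; those of
  other dimensions get the value one, so every level \<open>n\<close> has its own retraction.
  Uniqueness of the signed combination replaces common refinements of partitions, at a price: its
  members need not lie in the graph, so injectivity of the coordinate projections must be
  transferred from the graph to each member. The determinant of one \<open>L\<close> depends on the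
  reference coordinates of its source and target; along a composite the contributions of the middle
  set cancel, and as the values commute, conjugation does not change the value of an automorphism.
  Functoriality is read off the set of triples \<open>(x, f x, g (f x))\<close>: its one combination
  projects to those of all three graphs, and no pieces of \<open>f\<close> and \<open>g\<close> have
  to be matched. Scalars of affine combinations stand on the left, since a term of the right module
  is a sum of products \<open>x i * r\<close> and constants, which is affine for left scalars.
  Points are functions on an index type, so that pairs and triples of points are functions on sum
  types.\<close>

definition aff :: "'a::ring \<Rightarrow> ('i \<Rightarrow> 'a) \<Rightarrow> ('i \<Rightarrow> 'a) \<Rightarrow> ('i \<Rightarrow> 'a) \<Rightarrow> 'i \<Rightarrow> 'a" where
  "aff t x y z = (\<lambda>i. x i + t * (y i - z i))"

text \<open>Closure under \<open>x + t * (y - z)\<close> for three points says, over a ring with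
  one, that \<open>S\<close> is a translate of a left submodule. The empty set is excluded because
  its indicator is zero and would spoil linear independence.\<close>

definition affine_sets :: "('i \<Rightarrow> 'a::ring) set set" where
  "affine_sets = {S. S \<noteq> {} \<and> (\<forall>x\<in>S. \<forall>y\<in>S. \<forall>z\<in>S. \<forall>t. aff t x y z \<in> S)}"

definition affine_on :: "('i \<Rightarrow> 'a::ring) set \<Rightarrow> (('i \<Rightarrow> 'a) \<Rightarrow> 'j \<Rightarrow> 'a) \<Rightarrow> bool" where
  "affine_on S p \<longleftrightarrow> (\<forall>x\<in>S. \<forall>y\<in>S. \<forall>z\<in>S. \<forall>t. p (aff t x y z) = aff t (p x) (p y) (p z))"

lemma affine_setsD: "S \<in> affine_sets \<Longrightarrow> x \<in> S \<Longrightarrow> y \<in> S \<Longrightarrow> z \<in> S \<Longrightarrow> aff t x y z \<in> S"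
  by (simp add: affine_sets_def)

lemma affine_onD:
  "affine_on S p \<Longrightarrow> x \<in> S \<Longrightarrow> y \<in> S \<Longrightarrow> z \<in> S \<Longrightarrow> p (aff t x y z) = aff t (p x) (p y) (p z)"
  by (simp add: affine_on_def)

lemma affine_on_subset: "affine_on S p \<Longrightarrow> T \<subseteq> S \<Longrightarrow> affine_on T p"
  by (auto simp: affine_on_def)

lemma affine_on_comp: "affine_on S p \<Longrightarrow> affine_on (p ` S) q \<Longrightarrow> affine_on S (\<lambda>x. q (p x))"
  by (auto simp: affine_on_def)

lemma affine_on_reindex: "affine_on S (\<lambda>x. x \<circ> \<rho>)"
  by (auto simp: affine_on_def aff_def)

lemma affine_sets_image:
  assumes "S \<in> affine_sets" "affine_on S p"
  shows "p ` S \<in> affine_sets"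
  unfolding affine_sets_def
proof (intro CollectI conjI ballI allI)
  show "p ` S \<noteq> {}" using assms by (auto simp: affine_sets_def)
next
  fix x y z t assume "x \<in> p ` S" "y \<in> p ` S" "z \<in> p ` S"
  then show "aff t x y z \<in> p ` S"
    by (auto simp flip: affine_onD[OF assms(2)] intro: affine_setsD[OF assms(1)])
qed

lemma affine_sets_vimage:
  assumes "S \<in> affine_sets" "affine_on UNIV p"
  shows "p -` S = {} \<or> p -` S \<in> affine_sets"
  using affine_setsD[OF assms(1)] affine_onD[OF assms(2)] by (auto simp: affine_sets_def)

lemma affine_sets_Int:
  assumes "S \<in> affine_sets" "T \<in> affine_sets"
  shows "S \<inter> T = {} \<or> S \<inter> T \<in> affine_sets"
  using affine_setsD[OF assms(1)] affine_setsD[OF assms(2)] by (auto simp: affine_sets_def)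

lemma affine_on_inv_into:
  assumes S: "S \<in> affine_sets" and p: "affine_on S p" and inj: "inj_on p S"
  shows "affine_on (p ` S) (inv_into S p)"
  unfolding affine_on_def
proof safe
  fix x y z t assume "x \<in> S" "y \<in> S" "z \<in> S"
  then show "inv_into S p (aff t (p x) (p y) (p z)) =
      aff t (inv_into S p (p x)) (inv_into S p (p y)) (inv_into S p (p z))"
    by (simp add: inj affine_setsD[OF S] flip: affine_onD[OF p])
qed

text \<open>Two points with different parameters generate the whole line, including its point
  \<open>u\<close> at parameter zero.\<close>

lemma aff_line_unique:
  fixes u :: "'i \<Rightarrow> 'a::division_ring"
  assumes "Q \<in> affine_sets" "u \<notin> Q" "aff s u x y \<in> Q" "aff t u x y \<in> Q"
  shows "s = t"
proof (rule ccontr)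
  assume "s \<noteq> t"
  let ?a = "aff s u x y" and ?b = "aff t u x y"
  \<comment> \<open>\<open>?a - ?b\<close> is \<open>(s - t) * (x - y)\<close> in each coordinate;
    the scalar turns it into \<open>- s * (x - y)\<close>, which leads from \<open>?a\<close> back
    to \<open>u\<close>.\<close>
  have "aff (- s * inverse (s - t)) ?a ?a ?b = u"
  proof
    fix i
    have "?a i - ?b i = (s - t) * (x i - y i)" by (simp add: aff_def algebra_simps)
    then have "aff (- s * inverse (s - t)) ?a ?a ?b i
        = ?a i - s * (inverse (s - t) * (s - t)) * (x i - y i)"
      by (simp add: aff_def[of _ ?a] mult.assoc)
    then show "aff (- s * inverse (s - t)) ?a ?a ?b i = u i"
      using \<open>s \<noteq> t\<close> by (simp add: aff_def)
  qed
  then show False using assms affine_setsD by metis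
qed


section \<open>Generic points of affine sets over an infinite division ring\<close>

locale infinite_division_ring =
  fixes scalars :: "'a::division_ring itself"
  assumes infinite_scalars: "infinite (UNIV :: 'a set)"
begin

text \<open>Every condition excludes at most one scalar, so together with \<open>A\<close> only
  finitely many are lost.\<close>

lemma exists_scalar_avoiding:
  fixes P :: "'b \<Rightarrow> 'a \<Rightarrow> bool"
  assumes "finite F" "finite A" "\<And>Q s t. Q \<in> F \<Longrightarrow> P Q s \<Longrightarrow> P Q t \<Longrightarrow> s = t"
  obtains t where "t \<notin> A" "\<And>Q. Q \<in> F \<Longrightarrow> \<not> P Q t"
proof -
  have "finite {t. P Q t}" if "Q \<in> F" for Q
  proof (cases "\<exists>s. P Q s")
    case True
    then obtain s where "P Q s" ..
    then have "{t. P Q t} \<subseteq> {s}" using assms(3) that by blast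
    then show ?thesis by (rule finite_subset) simp
  qed simp
  then have "finite (A \<union> (\<Union>Q\<in>F. {t. P Q t}))" using assms by blast
  then obtain t where "t \<notin> A \<union> (\<Union>Q\<in>F. {t. P Q t})"
    using infinite_scalars ex_new_if_finite by blast
  then show thesis using that by blast
qed

text \<open>On the line through a point of \<open>S\<close> that avoids the old sets and a point of
  \<open>S\<close> that avoids the new one, each set of the family excludes at most one
  parameter.\<close>

lemma affine_set_generic_point:
  fixes S :: "('i \<Rightarrow> 'a) set"
  assumes "finite F" "F \<subseteq> affine_sets" "S \<in> affine_sets" "\<And>Q. Q \<in> F \<Longrightarrow> \<not> S \<subseteq> Q"
  shows "\<exists>x\<in>S. \<forall>Q\<in>F. x \<notin> Q"
  using assms
proof (induction F rule: finite_induct)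
  case empty
  then show ?case by (auto simp: affine_sets_def)
next
  case (insert Q F)
  then obtain x where x: "x \<in> S" "\<forall>Q\<in>F. x \<notin> Q" by blast
  obtain y where y: "y \<in> S" "y \<notin> Q" using insert.prems by blast
  \<comment> \<open>Since \<open>x\<close> may lie in \<open>Q\<close>, the line has to be based at
    \<open>y\<close> for this set.\<close>
  have swap: "aff t x y x = aff (1 - t) y x y" for t
    by (auto simp: aff_def algebra_simps)
  have "s = t" if "Q' \<in> insert Q F" "aff s x y x \<in> Q'" "aff t x y x \<in> Q'" "x \<notin> Q' \<or> Q' = Q" for Q' s t
  proof (cases "Q' = Q")
    case True
    then have "1 - s = 1 - t"
      using that y insert.prems aff_line_unique[of Q y] by (auto simp: swap)
    then show ?thesis by simp
  next
    case False
    then show ?thesis using that insert.prems aff_line_unique[of Q' x] by auto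
  qed
  then have "s = t" if "Q' \<in> insert Q F" "aff s x y x \<in> Q'" "aff t x y x \<in> Q'" for Q' s t
    using that x(2) by blast
  then obtain t where "\<And>Q'. Q' \<in> insert Q F \<Longrightarrow> aff t x y x \<notin> Q'"
    using exists_scalar_avoiding[of "insert Q F" "{}" "\<lambda>Q' t. aff t x y x \<in> Q'"] insert.hyps(1)
    by (metis finite.emptyI finite_insert)
  then show ?case by (intro bexI[of _ "aff t x y x"] ballI affine_setsD[OF insert.prems(2) x(1) y(1) x(1)])
qed

end


section \<open>Chains of affine sets\<close>

text \<open>The combination of indicator functions with coefficients \<open>c\<close>, evaluated at
  \<open>x\<close>. Passing through the free abelian group on one generator reduces additivity in
  \<open>c\<close> to that of \<open>frag_extend\<close>.\<close>

definition chain_fun :: "('b set \<Rightarrow>\<^sub>0 int) \<Rightarrow> 'b \<Rightarrow> int" where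
  "chain_fun c x = Poly_Mapping.lookup (frag_extend (\<lambda>S. if x \<in> S then frag_of () else 0) c) ()"

lemma chain_fun_simps [simp]:
  "chain_fun 0 x = 0"
  "chain_fun (frag_of S) x = of_bool (x \<in> S)"
  "chain_fun (c + d) x = chain_fun c x + chain_fun d x"
  "chain_fun (c - d) x = chain_fun c x - chain_fun d x"
  by (auto simp: chain_fun_def frag_extend_add frag_extend_diff lookup_add lookup_minus)

lemma chain_fun_eq_sum:
  "chain_fun c x = (\<Sum>S\<in>Poly_Mapping.keys c. Poly_Mapping.lookup c S * of_bool (x \<in> S))"
  unfolding chain_fun_def frag_extend_def lookup_sum by (rule sum.cong) auto

definition chain_of :: "('i \<Rightarrow> 'a::ring) set \<Rightarrow> (('i \<Rightarrow> 'a) set \<Rightarrow>\<^sub>0 int) \<Rightarrow> bool" where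
  "chain_of T c \<longleftrightarrow> Poly_Mapping.keys c \<subseteq> affine_sets \<and> (\<forall>x. chain_fun c x = of_bool (x \<in> T))"

lemma chain_of_affine: "S \<in> affine_sets \<Longrightarrow> chain_of S (frag_of S)"
  by (simp add: chain_of_def)

lemma chain_of_empty: "chain_of {} 0"
  by (simp add: chain_of_def)

lemma chain_of_Diff:
  assumes "chain_of A c" "chain_of B d" "B \<subseteq> A"
  shows "chain_of (A - B) (c - d)"
  using assms keys_diff[of c d] by (auto simp: chain_of_def)

lemma chain_of_Un:
  assumes "chain_of A c" "chain_of B d" "A \<inter> B = {}"
  shows "chain_of (A \<union> B) (c + d)"
  using assms keys_add[of c d] by (auto simp: chain_of_def)

text \<open>Indicators pull back term by term; a member with empty preimage is replaced by 0, as the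
  empty set is not affine.\<close>

lemma chain_of_vimage:
  fixes p :: "('i \<Rightarrow> 'a::ring) \<Rightarrow> 'j \<Rightarrow> 'a"
  assumes "chain_of A c" "affine_on UNIV p"
  shows "\<exists>d. chain_of (p -` A) d"
proof -
  have "\<exists>d. Poly_Mapping.keys d \<subseteq> affine_sets \<and> (\<forall>x. chain_fun d x = chain_fun c (p x))"
    if "Poly_Mapping.keys c \<subseteq> affine_sets" for c :: "('j \<Rightarrow> 'a) set \<Rightarrow>\<^sub>0 int"
    using that
  proof (induction c rule: frag_induction)
    case zero
    show ?case by (rule exI[of _ 0]) simp
  next
    case (one S)
    from affine_sets_vimage[OF this assms(2)] show ?case
    proof
      assume "p -` S = {}"
      then have "p x \<notin> S" for x by auto
      then show ?thesis by (intro exI[of _ 0]) simp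
    qed (auto intro!: exI[of _ "frag_of (p -` S)"])
  next
    case (diff a b)
    then obtain a' b' where
      "Poly_Mapping.keys a' \<subseteq> affine_sets" "\<forall>x. chain_fun a' x = chain_fun a (p x)"
      "Poly_Mapping.keys b' \<subseteq> affine_sets" "\<forall>x. chain_fun b' x = chain_fun b (p x)" by blast
    then show ?case using keys_diff[of a' b'] by (intro exI[of _ "a' - b'"]) auto
  qed
  from this[of c] obtain d where
    "Poly_Mapping.keys d \<subseteq> affine_sets" "\<forall>x. chain_fun d x = chain_fun c (p x)"
    using assms(1) by (auto simp: chain_of_def)
  then show ?thesis using assms(1) by (intro exI[of _ d]) (simp add: chain_of_def)
qed

text \<open>The product of the two indicators is bilinear in the chains, and on two affine sets it
  is the indicator of their intersection.\<close>

lemma chain_of_Int: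
  fixes A :: "('i \<Rightarrow> 'a::ring) set"
  assumes "chain_of A c" "chain_of B d"
  shows "\<exists>e. chain_of (A \<inter> B) e"
proof -
  let ?ok = "\<lambda>f. \<exists>e. Poly_Mapping.keys e \<subseteq> affine_sets \<and> (\<forall>x. chain_fun e x = (f x :: int))"
  have ok_diff: "?ok (\<lambda>x. f x - g x)" if "?ok f" "?ok g" for f g :: "('i \<Rightarrow> 'a) \<Rightarrow> int"
  proof -
    from that obtain e e' where "Poly_Mapping.keys e \<subseteq> affine_sets" "\<forall>x. chain_fun e x = f x"
      "Poly_Mapping.keys e' \<subseteq> affine_sets" "\<forall>x. chain_fun e' x = g x" by blast
    then show ?thesis using keys_diff[of e e'] by (intro exI[of _ "e - e'"]) auto
  qed
  have zero: "?ok (\<lambda>x. 0)" by (rule exI[of _ 0]) simp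
  have "?ok (\<lambda>x. chain_fun c x * chain_fun d x)"
    if "Poly_Mapping.keys c \<subseteq> affine_sets" "Poly_Mapping.keys d \<subseteq> affine_sets"
    for c d :: "('i \<Rightarrow> 'a) set \<Rightarrow>\<^sub>0 int"
    using that(1)
  proof (induction c rule: frag_induction)
    case (one S)
    show ?case using that(2)
    proof (induction d rule: frag_induction)
      case (one T)
      from affine_sets_Int[OF \<open>S \<in> affine_sets\<close> this] show ?case
      proof
        assume "S \<inter> T = {}"
        then have "x \<in> S \<Longrightarrow> x \<notin> T" for x by auto
        then show ?thesis by (intro exI[of _ 0]) auto
      next
        assume "S \<inter> T \<in> affine_sets"
        then show ?thesis by (intro exI[of _ "frag_of (S \<inter> T)"]) auto
      qed
    next
      case (diff a b)
      from ok_diff[OF this] show ?case by (simp only: chain_fun_simps right_diff_distrib)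
    qed (use zero in simp)
  next
    case (diff a b)
    from ok_diff[OF this] show ?case by (simp only: chain_fun_simps left_diff_distrib)
  qed (use zero in simp)
  from this[of c d] obtain e where
    "Poly_Mapping.keys e \<subseteq> affine_sets" "\<forall>x. chain_fun e x = chain_fun c x * chain_fun d x"
    using assms by (auto simp: chain_of_def)
  then show ?thesis using assms by (intro exI[of _ e]) (simp add: chain_of_def)
qed


section \<open>Uniqueness of chains and their images under injective affine maps\<close>

context infinite_division_ring
begin

text \<open>A maximal member has points outside all the others, by
  \<open>affine_set_generic_point\<close>, and at such a point the chain takes the coefficient of
  that member as its value.\<close>

lemma chain_maximal_key:
  fixes c :: "('i \<Rightarrow> 'a) set \<Rightarrow>\<^sub>0 int"
  assumes "S \<in> Poly_Mapping.keys c"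
  shows "\<exists>M\<in>Poly_Mapping.keys c. S \<subseteq> M \<and> (\<forall>Q\<in>Poly_Mapping.keys c - {M}. \<not> M \<subseteq> Q)"
proof -
  obtain M where "M \<in> Poly_Mapping.keys c" "S \<subseteq> M" "\<forall>Q\<in>Poly_Mapping.keys c. M \<subseteq> Q \<longrightarrow> M = Q"
    using finite_has_maximal2[OF finite_keys assms] by blast
  then show ?thesis by (intro bexI[of _ M]) auto
qed

lemma chain_fun_generic:
  fixes c :: "('i \<Rightarrow> 'a) set \<Rightarrow>\<^sub>0 int"
  assumes "M \<in> Poly_Mapping.keys c" "x \<in> M" "\<forall>Q \<in> Poly_Mapping.keys c - {M}. x \<notin> Q"
  shows "chain_fun c x = Poly_Mapping.lookup c M"
proof -
  have "chain_fun c x = (\<Sum>S\<in>{M}. Poly_Mapping.lookup c S * of_bool (x \<in> S))"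
    unfolding chain_fun_eq_sum using assms by (intro sum.mono_neutral_right) auto
  then show ?thesis using assms by simp
qed

text \<open>Linear independence of indicators: at a generic point of a maximal member only the
  coefficient of this member survives.\<close>

lemma chain_fun_eq_0:
  fixes c :: "('i \<Rightarrow> 'a) set \<Rightarrow>\<^sub>0 int"
  assumes "Poly_Mapping.keys c \<subseteq> affine_sets" "\<And>x. chain_fun c x = 0"
  shows "c = 0"
proof (rule ccontr)
  assume "c \<noteq> 0"
  then have "Poly_Mapping.keys c \<noteq> {}" by (simp add: keys_eq_empty)
  then obtain S where "S \<in> Poly_Mapping.keys c" by blast
  from chain_maximal_key[OF this] obtain M
    where M: "M \<in> Poly_Mapping.keys c" "\<forall>Q \<in> Poly_Mapping.keys c - {M}. \<not> M \<subseteq> Q"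
    by (elim bexE conjE)
  have "\<exists>x\<in>M. \<forall>Q \<in> Poly_Mapping.keys c - {M}. x \<notin> Q"
    by (rule affine_set_generic_point) (use M assms(1) in \<open>simp_all add: subset_iff\<close>)
  then obtain x where "x \<in> M" "\<forall>Q \<in> Poly_Mapping.keys c - {M}. x \<notin> Q"
    by (elim bexE)
  with chain_fun_generic[OF M(1)] assms(2) have "Poly_Mapping.lookup c M = 0" by simp
  with M(1) show False by (simp add: in_keys_iff)
qed

lemma chain_of_unique:
  fixes T :: "('i \<Rightarrow> 'a) set"
  assumes "chain_of T c" "chain_of T d"
  shows "c = d"
proof -
  have "c - d = 0"
    using assms keys_diff[of c d] by (intro chain_fun_eq_0) (auto simp: chain_of_def)
  then show ?thesis by simp
qed

text \<open>A maximal member of the chain of \<open>T\<close> lies in \<open>T\<close> generically; if \<open>p\<close> identified two of its points,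
  it would identify two generic points on a line in the corresponding direction.\<close>

lemma chain_of_inj_on:
  fixes p :: "('i \<Rightarrow> 'a) \<Rightarrow> 'j \<Rightarrow> 'a"
  assumes c: "chain_of T c" and p: "affine_on UNIV p" and inj: "inj_on p T"
    and S: "S \<in> Poly_Mapping.keys c"
  shows "inj_on p S"
proof -
  from chain_maximal_key[OF S] obtain M where M: "M \<in> Poly_Mapping.keys c" "S \<subseteq> M"
    "\<forall>Q \<in> Poly_Mapping.keys c - {M}. \<not> M \<subseteq> Q"
    by (elim bexE conjE)
  let ?F = "Poly_Mapping.keys c - {M}"
  have aff: "Poly_Mapping.keys c \<subseteq> affine_sets" using c by (simp add: chain_of_def)
  have "\<exists>u\<in>M. \<forall>Q \<in> ?F. u \<notin> Q"
    by (rule affine_set_generic_point) (use M aff in \<open>simp_all add: subset_iff\<close>)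
  then obtain u where u: "u \<in> M" "\<forall>Q \<in> ?F. u \<notin> Q"
    by (elim bexE)
  \<comment> \<open>The value of the chain at such a point is the nonzero coefficient of
    \<open>M\<close>, whereas off \<open>T\<close> the chain vanishes.\<close>
  have in_T: "x \<in> T" if "x \<in> M" "\<forall>Q \<in> ?F. x \<notin> Q" for x
    using chain_fun_generic[OF M(1) that] c M(1)
    by (cases "x \<in> T") (auto simp: chain_of_def in_keys_iff)
  have "x = y" if xy: "x \<in> M" "y \<in> M" "p x = p y" for x y
  proof -
    obtain t where t: "t \<notin> {0}" "\<And>Q. Q \<in> ?F \<Longrightarrow> aff t u x y \<notin> Q"
    proof (rule exists_scalar_avoiding[of ?F "{0}" "\<lambda>Q t. aff t u x y \<in> Q"])
      show "s = t" if "Q \<in> ?F" "aff s u x y \<in> Q" "aff t u x y \<in> Q" for Q s t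
        using aff_line_unique[OF _ _ that(2,3)] that(1) u(2) aff by blast
    qed simp_all
    have "aff t u x y \<in> M" using aff M(1) u(1) xy affine_setsD by blast
    then have "aff t u x y \<in> T" "u \<in> T" using in_T t u by auto
    moreover have "p (aff t u x y) = p u"
      using affine_onD[OF p, of u x y t] xy by (auto simp: aff_def)
    ultimately have "aff t u x y = u" using inj by (auto dest: inj_onD)
    then have "t * (x i - y i) = 0" for i by (auto simp: aff_def fun_eq_iff)
    then show "x = y" using t(1) by auto
  qed
  then show ?thesis using M(2) by (auto simp: inj_on_def)
qed

text \<open>The value of the image chain at \<open>y\<close> is the sum of the values of
  \<open>c\<close> over the fibre of \<open>y\<close>: by \<open>chain_of_inj_on\<close> each member
  whose image contains \<open>y\<close> has exactly one point there.\<close>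

lemma chain_of_image:
  fixes p :: "('i \<Rightarrow> 'a) \<Rightarrow> 'j \<Rightarrow> 'a"
  assumes c: "chain_of T c" and p: "affine_on UNIV p" and inj: "inj_on p T"
  shows "chain_of (p ` T) (frag_extend (\<lambda>S. frag_of (p ` S)) c)"
proof -
  let ?K = "Poly_Mapping.keys c" and ?l = "Poly_Mapping.lookup c"
  have aff: "?K \<subseteq> affine_sets" using c by (simp add: chain_of_def)
  have "Poly_Mapping.keys (frag_extend (\<lambda>S. frag_of (p ` S)) c) \<subseteq> (\<Union>S\<in>?K. {p ` S})"
    using keys_frag_extend[of "\<lambda>S. frag_of (p ` S)" c] by simp
  also have "\<dots> \<subseteq> affine_sets"
    using aff affine_sets_image affine_on_subset[OF p subset_UNIV] by blast
  finally have keys: "Poly_Mapping.keys (frag_extend (\<lambda>S. frag_of (p ` S)) c) \<subseteq> affine_sets" .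
  have "chain_fun (frag_extend (\<lambda>S. frag_of (p ` S)) c) y = of_bool (y \<in> p ` T)" for y
  proof -
    \<comment> \<open>\<open>Z\<close> may contain points outside \<open>T\<close>; there the
      members cancel.\<close>
    define Z where "Z = (\<Union>S\<in>?K. {x \<in> S. p x = y})"
    have sub: "\<exists>w. {x \<in> S. p x = y} \<subseteq> {w}" if "S \<in> ?K" for S
    proof (cases "\<exists>w\<in>S. p w = y")
      case True
      then obtain w where "w \<in> S" "p w = y" by blast
      then show ?thesis using chain_of_inj_on[OF c p inj that] by (intro exI[of _ w]) (auto dest: inj_onD)
    qed blast
    have fin: "finite Z"
      unfolding Z_def
    proof (rule finite_UN_I[OF finite_keys])
      fix S assume "S \<in> ?K"
      with sub obtain w where "{x \<in> S. p x = y} \<subseteq> {w}" by blast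
      then show "finite {x \<in> S. p x = y}" by (rule finite_subset) simp
    qed
    have "chain_fun (frag_extend (\<lambda>S. frag_of (p ` S)) c) y = (\<Sum>S\<in>?K. ?l S * of_bool (y \<in> p ` S))"
      unfolding chain_fun_def frag_extend_def[of "\<lambda>S. frag_of (p ` S)"]
      unfolding frag_extend_sum[OF finite_keys] lookup_sum
      by (rule sum.cong) (simp_all add: frag_extend_cmul)
    also have "\<dots> = (\<Sum>S\<in>?K. \<Sum>x\<in>Z. ?l S * of_bool (x \<in> S))"
    proof (rule sum.cong[OF refl])
      fix S assume S: "S \<in> ?K"
      have "(\<Sum>x\<in>Z. of_bool (x \<in> S)) = int (card (Z \<inter> S))"
        using fin by (simp add: of_bool_def sum.If_cases Int_def)
      also have "Z \<inter> S = {x \<in> S. p x = y}" using S by (auto simp: Z_def)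
      also have "int (card {x \<in> S. p x = y}) = of_bool (y \<in> p ` S)"
      proof (cases "y \<in> p ` S")
        case True
        then obtain x where "x \<in> S" "p x = y" by auto
        then have "{x \<in> S. p x = y} = {x}" using chain_of_inj_on[OF c p inj S] by (auto dest: inj_onD)
        then show ?thesis using True by simp
      next
        case False
        then have "{x \<in> S. p x = y} = {}" by auto
        then show ?thesis using False by (simp only: card.empty) simp
      qed
      finally show "?l S * of_bool (y \<in> p ` S) = (\<Sum>x\<in>Z. ?l S * of_bool (x \<in> S))"
        by (simp flip: sum_distrib_left)
    qed
    also have "\<dots> = (\<Sum>x\<in>Z. chain_fun c x)"
      unfolding chain_fun_eq_sum by (rule sum.swap)
    also have "\<dots> = (\<Sum>x\<in>Z. of_bool (x \<in> T))" using c by (simp add: chain_of_def)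
    also have "\<dots> = int (card (Z \<inter> T))" using fin by (simp add: of_bool_def sum.If_cases Int_def)
    also have "Z \<inter> T = {x \<in> T. p x = y}"
    proof -
      have "\<exists>S\<in>?K. x \<in> S" if "x \<in> T" for x
      proof (rule ccontr)
        assume "\<not> ?thesis"
        then have "chain_fun c x = 0" unfolding chain_fun_eq_sum by simp
        then show False using c that by (simp add: chain_of_def)
      qed
      then show ?thesis by (auto simp: Z_def)
    qed
    also have "int (card {x \<in> T. p x = y}) = of_bool (y \<in> p ` T)"
    proof (cases "y \<in> p ` T")
      case True
      then obtain x where "x \<in> T" "p x = y" by auto
      then have "{x \<in> T. p x = y} = {x}" using inj by (auto dest: inj_onD)
      then show ?thesis using True by simp
    next
      case False
      then have "{x \<in> T. p x = y} = {}" by auto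
      then show ?thesis using False by (simp only: card.empty) simp
    qed
    finally show ?thesis .
  qed
  with keys show ?thesis by (simp add: chain_of_def)
qed

end


section \<open>Quantifier elimination\<close>

text \<open>Scalars stand on the right as in the language, and constants absorb the parameters.
  Hence these maps are compatible with \<open>aff\<close>, whose scalars stand on the left.\<close>

inductive affine_form :: "(('i \<Rightarrow> 'a::ring_1) \<Rightarrow> 'a) \<Rightarrow> bool" where
  coord: "affine_form (\<lambda>e. e i)"
| const: "affine_form (\<lambda>e. c)"
| add: "affine_form a \<Longrightarrow> affine_form b \<Longrightarrow> affine_form (\<lambda>e. a e + b e)"
| scal: "affine_form a \<Longrightarrow> affine_form (\<lambda>e. a e * r)"

inductive qf :: "('i \<Rightarrow> 'a::ring_1) set \<Rightarrow> bool" where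
  atom: "affine_form a \<Longrightarrow> qf {e. a e = 0}"
| Compl: "qf A \<Longrightarrow> qf (- A)"
| Int: "qf A \<Longrightarrow> qf B \<Longrightarrow> qf (A \<inter> B)"

lemma affine_form_diff:
  assumes "affine_form a" "affine_form b"
  shows "affine_form (\<lambda>e. a e - b e)"
  using affine_form.add[OF assms(1) affine_form.scal[OF assms(2), of "-1"]] by simp

lemma affine_form_if:
  "affine_form a \<Longrightarrow> affine_form b \<Longrightarrow> affine_form (\<lambda>e. if P then a e else b e)"
  by (cases P) simp_all

lemma affine_form_case_sum:
  "(\<And>j. affine_form (\<lambda>e. a e j)) \<Longrightarrow> (\<And>j. affine_form (\<lambda>e. b e j)) \<Longrightarrow>
    affine_form (\<lambda>e. case_sum (a e) (b e) i)"
  by (cases i) simp_all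

lemmas affine_form_intros = affine_form.intros affine_form_if affine_form_case_sum

lemma affine_form_val: "affine_form (\<lambda>e. val e t)"
proof (induction t)
  case (Neg t)
  then show ?case using affine_form.scal[of _ "-1"] by simp
qed (simp_all add: affine_form.intros)

lemma affine_form_subst:
  assumes "affine_form a" "\<And>i. affine_form (\<lambda>e. s e i)"
  shows "affine_form (\<lambda>e. a (s e))"
  using assms(1)
proof (induction a rule: affine_form.induct)
  case (coord i)
  show ?case by (rule assms(2))
next
  case (const c)
  show ?case by (rule affine_form.const)
next
  case (add a b)
  then show ?case by (intro affine_form.add)
next
  case (scal a r)
  then show ?case by (intro affine_form.scal)
qed

lemma affine_form_update:
  assumes "affine_form a"
  shows "\<exists>r. \<forall>e x. a (e(i := x)) = x * r + a (e(i := 0))"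
  using assms
proof (induction a rule: affine_form.induct)
  case (coord j)
  show ?case by (rule exI[of _ "if i = j then 1 else 0"]) auto
next
  case (const c)
  show ?case by (rule exI[of _ 0]) auto
next
  case (add a b)
  then obtain r s where "\<And>e x. a (e(i := x)) = x * r + a (e(i := 0))"
    "\<And>e x. b (e(i := x)) = x * s + b (e(i := 0))" by blast
  then show ?case by (intro exI[of _ "r + s"] allI) (metis (no_types, lifting) add.assoc add.left_commute distrib_left)
next
  case (scal a q)
  then obtain r where "\<And>e x. a (e(i := x)) = x * r + a (e(i := 0))" by blast
  then show ?case by (intro exI[of _ "r * q"] allI) (metis distrib_right mult.assoc)
qed

lemma affine_form_aff:
  assumes "affine_form a"
  shows "a (aff t x y z) = a x + t * (a y - a z)"
  using assms
proof (induction a rule: affine_form.induct)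
  case (coord i)
  show ?case by (simp add: aff_def)
next
  case (scal a r)
  then show ?case by (simp add: distrib_right left_diff_distrib mult.assoc)
qed (simp_all add: algebra_simps)

lemma qf_Un: "qf A \<Longrightarrow> qf B \<Longrightarrow> qf (A \<union> B)"
  using qf.Compl[OF qf.Int[OF qf.Compl qf.Compl], of A B] by simp

lemma qf_Diff: "qf A \<Longrightarrow> qf B \<Longrightarrow> qf (A - B)"
  using qf.Int[OF _ qf.Compl, of A B] by (simp add: Diff_eq)

lemma qf_UNIV: "qf UNIV"
  using qf.atom[OF affine_form.const, of 0] by simp

lemma qf_empty: "qf {}"
  using qf.Compl[OF qf_UNIV] by simp

lemma qf_eq:
  assumes "affine_form a" "affine_form b"
  shows "qf {e. a e = b e}"
  using qf.atom[OF affine_form_diff[OF assms]] by simp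

lemma qf_UN: "finite F \<Longrightarrow> (\<And>u. u \<in> F \<Longrightarrow> qf (A u)) \<Longrightarrow> qf (\<Union>u\<in>F. A u)"
  by (induction F rule: finite_induct) (auto intro: qf_Un qf_empty)

lemma qf_INT: "finite F \<Longrightarrow> (\<And>u. u \<in> F \<Longrightarrow> qf (A u)) \<Longrightarrow> qf (\<Inter>u\<in>F. A u)"
  by (induction F rule: finite_induct) (auto intro: qf.Int qf_UNIV)

lemma qf_vimage:
  assumes "qf A" "\<And>i. affine_form (\<lambda>e. s e i)"
  shows "qf (s -` A)"
  using assms(1)
proof (induction A rule: qf.induct)
  case (atom a)
  show ?case using qf.atom[OF affine_form_subst[OF atom assms(2)]] by (simp add: vimage_def)
qed (simp_all add: vimage_Compl vimage_Int qf.intros)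

text \<open>An atomic set is empty or affine; complements are subtracted from the whole space,
  intersections come from products of indicators.\<close>

lemma qf_chain:
  fixes A :: "('i \<Rightarrow> 'a::ring_1) set"
  assumes "qf A"
  shows "\<exists>c. chain_of A c"
  using assms
proof (induction A rule: qf.induct)
  case (atom a)
  show ?case
  proof (cases "{e. a e = 0} = {}")
    case True
    then show ?thesis using chain_of_empty by metis
  next
    case False
    then have "{e. a e = 0} \<in> affine_sets"
      by (auto simp: affine_sets_def affine_form_aff[OF atom])
    then show ?thesis using chain_of_affine by metis
  qed
next
  case (Compl A)
  then obtain c where c: "chain_of A c" by metis
  have "chain_of (UNIV :: ('i \<Rightarrow> 'a) set) (frag_of UNIV)"
    by (rule chain_of_affine) (simp add: affine_sets_def)
  from chain_of_Diff[OF this c] show ?case by (metis Compl_eq_Diff_UNIV subset_UNIV)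
next
  case (Int A B)
  then show ?case using chain_of_Int by metis
qed


text \<open>As a function of the single variable \<open>i\<close>, membership is constant up to
  finitely many exceptional values, and these are affine forms in \<open>e\<close>, uniformly. An
  atom \<open>x * r + a = 0\<close> has no exceptional value if \<open>r = 0\<close>, and only its
  root otherwise.\<close>

lemma qf_generic_value:
  fixes A :: "('i \<Rightarrow> 'a::division_ring) set"
  assumes "qf A"
  shows "\<exists>U B. finite U \<and> (\<forall>u\<in>U. affine_form u) \<and> qf B \<and>
    (\<forall>e x. (\<forall>u\<in>U. x \<noteq> u e) \<longrightarrow> (e(i := x) \<in> A \<longleftrightarrow> e \<in> B))"
  using assms
proof (induction A rule: qf.induct)
  case (atom a)
  have a0: "affine_form (\<lambda>e. a (e(i := 0)))"
    by (rule affine_form_subst[OF atom]) (auto simp: fun_upd_def intro: affine_form_intros)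
  from affine_form_update[OF atom, of i]
  obtain r where "\<forall>e x. a (e(i := x)) = x * r + a (e(i := 0))" by (elim exE)
  then have r: "a (e(i := x)) = x * r + a (e(i := 0))" for e x by blast
  show ?case
  proof (cases "r = 0")
    case True
    then have "a (e(i := x)) = 0 \<longleftrightarrow> a (e(i := 0)) = 0" for e x using r[of e x] by simp
    then have "e(i := x) \<in> {e. a e = 0} \<longleftrightarrow> e \<in> {e. a (e(i := 0)) = 0}" for e x
      by (simp only: mem_Collect_eq)
    moreover have "qf {e. a (e(i := 0)) = 0}" by (intro qf.atom a0)
    ultimately have "finite {} \<and> (\<forall>u\<in>{}. affine_form u) \<and> qf {e. a (e(i := 0)) = 0} \<and> (\<forall>e x. (\<forall>u\<in>{}. x \<noteq> u e) \<longrightarrow>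
        (e(i := x) \<in> {e. a e = 0} \<longleftrightarrow> e \<in> {e. a (e(i := 0)) = 0}))"
      by (intro conjI allI impI) simp_all
    then show ?thesis by (intro exI)
  next
    case False
    have root: "x = a (e(i := 0)) * (- inverse r)" if "a (e(i := x)) = 0" for e x
    proof -
      have "x * r = - a (e(i := 0))" using that r[of e x] by (simp add: eq_neg_iff_add_eq_0)
      then have "x * r * inverse r = - a (e(i := 0)) * inverse r" by simp
      then show ?thesis using False by (simp add: mult.assoc)
    qed
    define u where "u = (\<lambda>e. a (e(i := 0)) * (- inverse r))"
    have "\<not> a (e(i := x)) = 0" if "x \<noteq> u e" for e x using root[of e x] that by (auto simp only: u_def)
    then have "e(i := x) \<in> {e. a e = 0} \<longleftrightarrow> e \<in> {}" if "\<forall>v\<in>{u}. x \<noteq> v e" for e x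
      using that by (simp only: mem_Collect_eq ball_simps empty_iff) blast
    moreover have "\<forall>v\<in>{u}. affine_form v" using affine_form.scal[OF a0, of "- inverse r"]
      by (simp add: u_def)
    ultimately have "finite {u} \<and> (\<forall>v\<in>{u}. affine_form v) \<and> qf {} \<and> (\<forall>e x. (\<forall>v\<in>{u}. x \<noteq> v e) \<longrightarrow>
        (e(i := x) \<in> {e. a e = 0} \<longleftrightarrow> e \<in> {}))"
      by (intro conjI allI impI qf_empty) (simp_all only: finite.intros)
    then show ?thesis by (intro exI)
  qed
next
  case (Compl A)
  from Compl.IH obtain U B where "finite U" "\<forall>u\<in>U. affine_form u" "qf B"
    "\<forall>e x. (\<forall>u\<in>U. x \<noteq> u e) \<longrightarrow> (e(i := x) \<in> A \<longleftrightarrow> e \<in> B)" by (elim exE conjE)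
  then have "finite U \<and> (\<forall>u\<in>U. affine_form u) \<and> qf (- B) \<and>
    (\<forall>e x. (\<forall>u\<in>U. x \<noteq> u e) \<longrightarrow> (e(i := x) \<in> - A \<longleftrightarrow> e \<in> - B))"
    by (simp only: Compl_iff qf.Compl) simp
  then show ?case by (intro exI)
next
  case (Int A A')
  from Int.IH(1) obtain U B where "finite U" "\<forall>u\<in>U. affine_form u" "qf B"
    "\<forall>e x. (\<forall>u\<in>U. x \<noteq> u e) \<longrightarrow> (e(i := x) \<in> A \<longleftrightarrow> e \<in> B)" by (elim exE conjE)
  moreover from Int.IH(2) obtain U' B' where "finite U'" "\<forall>u\<in>U'. affine_form u" "qf B'"
    "\<forall>e x. (\<forall>u\<in>U'. x \<noteq> u e) \<longrightarrow> (e(i := x) \<in> A' \<longleftrightarrow> e \<in> B')" by (elim exE conjE)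
  ultimately have "finite (U \<union> U') \<and> (\<forall>u\<in>U \<union> U'. affine_form u) \<and> qf (B \<inter> B') \<and>
    (\<forall>e x. (\<forall>u\<in>U \<union> U'. x \<noteq> u e) \<longrightarrow> (e(i := x) \<in> A \<inter> A' \<longleftrightarrow> e \<in> B \<inter> B'))"
    by (simp only: Int_iff qf.Int ball_Un finite_Un) simp
  then show ?case by (intro exI)
qed

context infinite_division_ring
begin

text \<open>A witness is either an exceptional value, which is an affine form and can be
  substituted, or a generic one, which is available because \<open>R\<close> is infinite.\<close>

lemma qf_ex:
  fixes A :: "('i \<Rightarrow> 'a) set"
  assumes "qf A"
  shows "qf {e. \<exists>x. e(i := x) \<in> A}"
proof -
  from qf_generic_value[OF assms, of i]
  obtain U B where UB: "finite U" "\<forall>u\<in>U. affine_form u" "qf B"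
    "\<forall>e x. (\<forall>u\<in>U. x \<noteq> u e) \<longrightarrow> (e(i := x) \<in> A \<longleftrightarrow> e \<in> B)"
    by (elim exE conjE)
  have "{e. \<exists>x. e(i := x) \<in> A} = B \<union> (\<Union>u\<in>U. (\<lambda>e. e(i := u e)) -` A)" (is "?L = ?R")
  proof (rule Set.set_eqI)
    fix e
    have "\<exists>x. \<forall>u\<in>U. x \<noteq> u e"
      using ex_new_if_finite[OF infinite_scalars finite_imageI[OF UB(1), of "\<lambda>u. u e"]] by (metis image_eqI)
    then have "e \<in> ?L" if "e \<in> B" using that UB(4) by (metis mem_Collect_eq)
    moreover have "e \<in> ?L" if "u \<in> U" "e(i := u e) \<in> A" for u using that by (metis mem_Collect_eq)
    moreover have "e \<in> ?R" if "e(i := x) \<in> A" for x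
    proof (cases "\<forall>u\<in>U. x \<noteq> u e")
      case True
      then show ?thesis using UB(4) that by simp
    next
      case False
      then show ?thesis using that by auto
    qed
    ultimately show "e \<in> ?L \<longleftrightarrow> e \<in> ?R" by auto
  qed
  moreover have "qf ((\<lambda>e. e(i := u e)) -` A)" if "u \<in> U" for u
    by (rule qf_vimage[OF assms]) (use that UB(2) in \<open>auto simp: fun_upd_def intro: affine_form_intros\<close>)
  ultimately show ?thesis using UB by (simp add: qf_Un qf_UN)
qed

text \<open>Serves the composition of relations, where all coordinates of the middle vector are
  quantified at once.\<close>

lemma qf_ex_finite:
  fixes A :: "('i \<Rightarrow> 'a) set"
  assumes "finite I" "qf A"
  shows "qf {e. \<exists>f. (\<lambda>i. if i \<in> I then f i else e i) \<in> A}"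
  using assms
proof (induction I arbitrary: A rule: finite_induct)
  case (insert j I)
  have "{e. \<exists>f. (\<lambda>i. if i \<in> insert j I then f i else e i) \<in> A} =
        {e. \<exists>f. (\<lambda>i. if i \<in> I then f i else e i) \<in> {e. \<exists>x. e(j := x) \<in> A}}" (is "?L = ?R")
  proof (intro Set.set_eqI iffI)
    fix e assume "e \<in> ?L"
    then obtain f where "(\<lambda>i. if i \<in> insert j I then f i else e i) \<in> A" by blast
    moreover have "(\<lambda>i. if i \<in> insert j I then f i else e i) = (\<lambda>i. if i \<in> I then f i else e i)(j := f j)"
      by auto
    ultimately show "e \<in> ?R" by auto
  next
    fix e assume "e \<in> ?R"
    then obtain f x where "(\<lambda>i. if i \<in> I then f i else e i)(j := x) \<in> A" by blast
    moreover have "(\<lambda>i. if i \<in> I then f i else e i)(j := x)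
        = (\<lambda>i. if i \<in> insert j I then (f(j := x)) i else e i)" by auto
    ultimately have "(\<lambda>i. if i \<in> insert j I then (f(j := x)) i else e i) \<in> A" by (simp only:)
    then show "e \<in> ?L" by blast
  qed
  then show ?case using insert.IH[OF qf_ex[OF insert.prems]] by simp
qed simp

lemma qf_sat: "qf {e :: nat \<Rightarrow> 'a. sat e p}"
proof (induction p)
  case (FEq s t)
  show ?case using qf_eq[OF affine_form_val affine_form_val] by simp
next
  case (FNot p)
  from qf.Compl[OF this] show ?case by (simp add: Compl_eq)
next
  case (FAnd p q)
  from qf.Int[OF this] show ?case by (simp add: Int_def)
next
  case (FEx i p)
  from qf_ex[OF this] show ?case by simp
qed

end


section \<open>Definable sets and relations\<close>

text \<open>Padding by zeros puts all dimensions into one function space. The dimension is lost in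
  this way and has to be carried along separately.\<close>

definition vec_fun :: "'a::zero vec \<Rightarrow> nat \<Rightarrow> 'a" where
  "vec_fun v = (\<lambda>i. if i < dim_vec v then v $ i else 0)"

lemma vec_fun_inj: "dim_vec v = dim_vec w \<Longrightarrow> vec_fun v = vec_fun w \<Longrightarrow> v = w"
  by (intro eq_vecI) (auto simp: vec_fun_def fun_eq_iff split: if_splits)

lemma affine_form_term:
  fixes a :: "(nat \<Rightarrow> 'a::ring_1) \<Rightarrow> 'a"
  assumes "affine_form a"
  shows "\<exists>t. \<forall>v \<in> carrier_vec n. val (\<lambda>i. if i < n then v $ i else 1) t = a (vec_fun v)"
  using assms
proof (induction a rule: affine_form.induct)
  case (coord i)
  show ?case by (rule exI[of _ "if i < n then Var i else Zero"]) (auto simp: vec_fun_def)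
next
  case (const c)
  \<comment> \<open>Variable \<open>n\<close> is not a coordinate, so it has the value 1.\<close>
  show ?case by (rule exI[of _ "Scal (Var n) c"]) simp
next
  case (add a b)
  then obtain s t where
    "\<forall>v \<in> carrier_vec n. val (\<lambda>i. if i < n then v $ i else 1) s = a (vec_fun v)"
    "\<forall>v \<in> carrier_vec n. val (\<lambda>i. if i < n then v $ i else 1) t = b (vec_fun v)" by metis
  then show ?case by (intro exI[of _ "Add s t"]) simp
next
  case (scal a r)
  then obtain s where
    "\<forall>v \<in> carrier_vec n. val (\<lambda>i. if i < n then v $ i else 1) s = a (vec_fun v)" by metis
  then show ?case by (intro exI[of _ "Scal s r"]) simp
qed

text \<open>Since every constant \<open>c\<close> is \<open>1 * c\<close>, the only parameter needed is \<open>1\<close>; this makes it possible to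
  combine formulas without renaming their parameters.\<close>

lemma qf_formula:
  fixes A :: "(nat \<Rightarrow> 'a::ring_1) set"
  assumes "qf A"
  shows "\<exists>p. \<forall>v \<in> carrier_vec n. sat (\<lambda>i. if i < n then v $ i else 1) p \<longleftrightarrow> vec_fun v \<in> A"
  using assms
proof (induction A rule: qf.induct)
  case (atom a)
  from affine_form_term[OF this, of n]
  obtain t where "\<forall>v \<in> carrier_vec n. val (\<lambda>i. if i < n then v $ i else 1) t = a (vec_fun v)"
    by (elim exE)
  then show ?case by (intro exI[of _ "FEq t Zero"]) simp
next
  case (Compl A)
  from Compl.IH obtain p where
    "\<forall>v \<in> carrier_vec n. sat (\<lambda>i. if i < n then v $ i else 1) p \<longleftrightarrow> vec_fun v \<in> A"
    by (elim exE)
  then show ?case by (intro exI[of _ "FNot p"]) (simp only: sat.simps Compl_iff, simp)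
next
  case (Int A B)
  from Int.IH obtain p q where
    "\<forall>v \<in> carrier_vec n. sat (\<lambda>i. if i < n then v $ i else 1) p \<longleftrightarrow> vec_fun v \<in> A"
    "\<forall>v \<in> carrier_vec n. sat (\<lambda>i. if i < n then v $ i else 1) q \<longleftrightarrow> vec_fun v \<in> B"
    by (elim exE)
  then show ?case by (intro exI[of _ "FAnd p q"]) simp
qed

text \<open>The two blocks of coordinates are indexed by a sum type, which turns the operations on
  relations into reindexings without shifted variables. Formulas for concatenated vectors are
  produced only in \<open>definable_rel_imp_definable\<close>.\<close>

definition definable_rel :: "nat \<Rightarrow> nat \<Rightarrow> ('a::ring_1 vec \<times> 'a vec) set \<Rightarrow> bool" where
  "definable_rel n m Q \<longleftrightarrow> (\<exists>A. qf A \<and>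
     Q = {(x, y). x \<in> carrier_vec n \<and> y \<in> carrier_vec m \<and> case_sum (vec_fun x) (vec_fun y) \<in> A})"

lemma definable_relI:
  assumes "qf A" "Q \<subseteq> carrier_vec n \<times> carrier_vec m"
    "\<And>x y. x \<in> carrier_vec n \<Longrightarrow> y \<in> carrier_vec m \<Longrightarrow> (x, y) \<in> Q \<longleftrightarrow> case_sum (vec_fun x) (vec_fun y) \<in> A"
  shows "definable_rel n m Q"
  unfolding definable_rel_def using assms by (intro exI[of _ A]) auto

lemma definable_relE:
  assumes "definable_rel n m Q"
  obtains A where "qf A" "Q \<subseteq> carrier_vec n \<times> carrier_vec m"
    "\<And>x y. x \<in> carrier_vec n \<Longrightarrow> y \<in> carrier_vec m \<Longrightarrow> (x, y) \<in> Q \<longleftrightarrow> case_sum (vec_fun x) (vec_fun y) \<in> A"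
proof -
  obtain A where "qf A"
    "Q = {(x, y). x \<in> carrier_vec n \<and> y \<in> carrier_vec m \<and> case_sum (vec_fun x) (vec_fun y) \<in> A}"
    using assms unfolding definable_rel_def by (elim exE conjE)
  then show thesis by (intro that[of A]) auto
qed

lemma definable_rel_Un: "definable_rel n m P \<Longrightarrow> definable_rel n m Q \<Longrightarrow> definable_rel n m (P \<union> Q)"
  by (elim definable_relE, rule definable_relI, erule (1) qf_Un) auto

lemma definable_rel_Diff: "definable_rel n m P \<Longrightarrow> definable_rel n m Q \<Longrightarrow> definable_rel n m (P - Q)"
  by (elim definable_relE, rule definable_relI, erule (1) qf_Diff) auto

lemma definable_rel_converse:
  assumes "definable_rel n m Q"
  shows "definable_rel m n (Q\<inverse>)"
  using assms
proof (rule definable_relE)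
  fix A :: "(nat + nat \<Rightarrow> 'a) set"
  assume A: "qf A" "Q \<subseteq> carrier_vec n \<times> carrier_vec m"
    "\<And>x y. x \<in> carrier_vec n \<Longrightarrow> y \<in> carrier_vec m \<Longrightarrow> (x, y) \<in> Q \<longleftrightarrow> case_sum (vec_fun x) (vec_fun y) \<in> A"
  show ?thesis
  proof (rule definable_relI)
    show "qf ((\<lambda>e. case_sum (\<lambda>j. e (Inr j)) (\<lambda>j. e (Inl j))) -` A)"
      by (rule qf_vimage[OF A(1)]) (intro affine_form_intros)
  qed (use A in auto)
qed

lemma vec_fun_append:
  assumes "x \<in> carrier_vec n" "y \<in> carrier_vec m"
  shows "vec_fun (x @\<^sub>v y) = (\<lambda>i. if i < n then vec_fun x i else if i < n + m then vec_fun y (i - n) else 0)"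
  using assms by (intro ext) (auto simp: vec_fun_def)

lemma case_sum_vec_fun:
  assumes "x \<in> carrier_vec n" "y \<in> carrier_vec m"
  shows "case_sum (vec_fun x) (vec_fun y) = case_sum (\<lambda>i. if i < n then vec_fun (x @\<^sub>v y) i else 0)
    (\<lambda>i. if i < m then vec_fun (x @\<^sub>v y) (n + i) else 0)"
  using assms by (intro ext) (auto simp: vec_fun_def split: sum.split)

lemma definable_rel_imp_definable:
  fixes Q :: "('a::ring_1 vec \<times> 'a vec) set"
  assumes "definable_rel n m Q"
  shows "definable ((\<lambda>(x, y). x @\<^sub>v y) ` Q)"
  using assms
proof (rule definable_relE)
  fix A :: "(nat + nat \<Rightarrow> 'a) set"
  assume A: "qf A" "Q \<subseteq> carrier_vec n \<times> carrier_vec m"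
    "\<And>x y. x \<in> carrier_vec n \<Longrightarrow> y \<in> carrier_vec m \<Longrightarrow> (x, y) \<in> Q \<longleftrightarrow> case_sum (vec_fun x) (vec_fun y) \<in> A"
  define s where
    "s e = case_sum (\<lambda>i. if i < n then e i else 0) (\<lambda>i. if i < m then e (n + i) else 0)" for e :: "nat \<Rightarrow> 'a"
  have "qf (s -` A)"
    unfolding s_def by (rule qf_vimage[OF A(1)]) (intro affine_form_intros)
  from qf_formula[OF this, of "n + m"] obtain p where p:
    "\<forall>w \<in> carrier_vec (n + m). sat (\<lambda>i. if i < n + m then w $ i else 1) p \<longleftrightarrow> vec_fun w \<in> s -` A"
    by (elim exE)
  have s: "s (vec_fun (x @\<^sub>v y)) = case_sum (vec_fun x) (vec_fun y)"
    if "x \<in> carrier_vec n" "y \<in> carrier_vec m" for x y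
    using case_sum_vec_fun[OF that] by (simp add: s_def)
  have "(\<lambda>(x, y). x @\<^sub>v y) ` Q = {w \<in> carrier_vec (n + m). vec_fun w \<in> s -` A}"
  proof (intro Set.set_eqI iffI)
    fix w assume "w \<in> (\<lambda>(x, y). x @\<^sub>v y) ` Q"
    then obtain x y where xy: "(x, y) \<in> Q" "w = x @\<^sub>v y" by auto
    then have c: "x \<in> carrier_vec n" "y \<in> carrier_vec m" using A(2) by auto
    then show "w \<in> {w \<in> carrier_vec (n + m). vec_fun w \<in> s -` A}"
      using A(3)[OF c] xy s[OF c] by simp
  next
    fix w assume "w \<in> {w \<in> carrier_vec (n + m). vec_fun w \<in> s -` A}"
    then have w: "w \<in> carrier_vec (n + m)" "vec_fun w \<in> s -` A" by auto
    have c: "vec_first w n \<in> carrier_vec n" "vec_last w m \<in> carrier_vec m" by auto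
    have eq: "vec_first w n @\<^sub>v vec_last w m = w" using w(1) by simp
    have "(vec_first w n, vec_last w m) \<in> Q" using A(3)[OF c] s[OF c] w(2) by (simp add: eq)
    then show "w \<in> (\<lambda>(x, y). x @\<^sub>v y) ` Q" using eq by force
  qed
  also have "\<dots> = {w \<in> carrier_vec (n + m). sat (\<lambda>i. if i < n + m then w $ i else 1) p}"
    using p by (intro Collect_cong) auto
  finally show ?thesis unfolding definable_def by (intro exI[of _ "n + m"] exI[of _ p] exI[of _ "\<lambda>_. 1"])
qed

lemma (in infinite_division_ring) definable_qf:
  fixes D :: "'a vec set"
  assumes "definable D"
  shows "\<exists>n A. qf A \<and> D = {v \<in> carrier_vec n. vec_fun v \<in> A}"
proof -
  from assms obtain n p e where D: "D = {v \<in> carrier_vec n. sat (\<lambda>i. if i < n then v $ i else e i) p}"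
    unfolding definable_def by (elim exE)
  let ?s = "\<lambda>f i. if i < n then f i else e i"
  have "qf (?s -` {e. sat e p})" by (rule qf_vimage[OF qf_sat]) (intro affine_form_intros)
  moreover have "?s (vec_fun v) = (\<lambda>i. if i < n then v $ i else e i)" if "v \<in> carrier_vec n" for v
    using that by (auto simp: vec_fun_def)
  then have "D = {v \<in> carrier_vec n. vec_fun v \<in> ?s -` {e. sat e p}}"
    using D by (auto simp del: if_image_distrib)
  ultimately show ?thesis by (intro exI conjI)
qed

lemma (in infinite_division_ring) definable_rel_append:
  fixes Q :: "('a vec \<times> 'a vec) set"
  assumes "definable ((\<lambda>(x, y). x @\<^sub>v y) ` Q)" "Q \<subseteq> carrier_vec n \<times> carrier_vec m"
  shows "definable_rel n m Q"
proof (cases "Q = {}")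
  \<comment> \<open>An empty definable set does not determine its dimension; a point of
    \<open>Q\<close> will force the dimension \<open>n + m\<close>.\<close>
  case True
  then show ?thesis by (intro definable_relI[OF qf_empty]) auto
next
  case False
  from definable_qf[OF assms(1)]
  obtain k A where A: "qf A" "(\<lambda>(x, y). x @\<^sub>v y) ` Q = {v \<in> carrier_vec k. vec_fun v \<in> A}"
    by (elim exE conjE)
  from False obtain x y where xy: "(x, y) \<in> Q" by auto
  then have "x @\<^sub>v y \<in> carrier_vec k" using A(2) by force
  moreover have "x \<in> carrier_vec n" "y \<in> carrier_vec m" using xy assms(2) by auto
  ultimately have k: "k = n + m" by (metis append_carrier_vec carrier_vecD)
  define s where "s e = (\<lambda>i. if i < n then e (Inl i) else if i < n + m then e (Inr (i - n)) else 0)"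
    for e :: "nat + nat \<Rightarrow> 'a"
  show ?thesis
  proof (rule definable_relI[OF _ assms(2)])
    show "qf (s -` A)" unfolding s_def by (rule qf_vimage[OF A(1)]) (intro affine_form_intros)
  next
    fix x y :: "'a vec" assume c: "x \<in> carrier_vec n" "y \<in> carrier_vec m"
    have "(x, y) \<in> Q \<longleftrightarrow> x @\<^sub>v y \<in> (\<lambda>(x, y). x @\<^sub>v y) ` Q"
    proof
      assume "x @\<^sub>v y \<in> (\<lambda>(x, y). x @\<^sub>v y) ` Q"
      then obtain x' y' where Q: "(x', y') \<in> Q" and eq: "x' @\<^sub>v y' = x @\<^sub>v y" by auto
      have "x' \<in> carrier_vec n" using Q assms(2) by auto
      with eq c(1) show "(x, y) \<in> Q" using Q append_vec_eq[of x' n x y' y] by auto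
    qed force
    also have "\<dots> \<longleftrightarrow> vec_fun (x @\<^sub>v y) \<in> A" using A(2) c k by auto
    also have "vec_fun (x @\<^sub>v y) = s (case_sum (vec_fun x) (vec_fun y))"
      unfolding vec_fun_append[OF c] by (simp add: s_def cong: if_cong)
    finally show "(x, y) \<in> Q \<longleftrightarrow> case_sum (vec_fun x) (vec_fun y) \<in> s -` A" by simp
  qed
qed

text \<open>The coordinates of the middle vector are removed by quantifier elimination.\<close>

lemma (in infinite_division_ring) definable_rel_relcomp:
  fixes P Q :: "('a vec \<times> 'a vec) set"
  assumes "definable_rel n m P" "definable_rel m k Q"
  shows "definable_rel n k (P O Q)"
  using assms(1)
proof (rule definable_relE)
  fix A :: "(nat + nat \<Rightarrow> 'a) set"
  assume A: "qf A" "P \<subseteq> carrier_vec n \<times> carrier_vec m"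
    "\<And>x y. x \<in> carrier_vec n \<Longrightarrow> y \<in> carrier_vec m \<Longrightarrow> (x, y) \<in> P \<longleftrightarrow> case_sum (vec_fun x) (vec_fun y) \<in> A"
  show ?thesis using assms(2)
  proof (rule definable_relE)
    fix B :: "(nat + nat \<Rightarrow> 'a) set"
    assume B: "qf B" "Q \<subseteq> carrier_vec m \<times> carrier_vec k"
      "\<And>x y. x \<in> carrier_vec m \<Longrightarrow> y \<in> carrier_vec k \<Longrightarrow> (x, y) \<in> Q \<longleftrightarrow> case_sum (vec_fun x) (vec_fun y) \<in> B"
    \<comment> \<open>Middle coordinates from \<open>m\<close> on are set to zero, as
      \<open>vec_fun\<close> does, so that only the finitely many indices in \<open>I\<close> have
      to be quantified.\<close>
    define mid where "mid t = (\<lambda>i. if i < m then t (Inr (Inl i)) else 0)"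
      for t :: "nat + (nat + nat) \<Rightarrow> 'a"
    define I where "I = (\<lambda>i. Inr (Inl i) :: nat + (nat + nat)) ` {..<m}"
    define T where "T = (\<lambda>t. case_sum (\<lambda>i. t (Inl i)) (mid t)) -` A \<inter>
      (\<lambda>t. case_sum (mid t) (\<lambda>i. t (Inr (Inr i)))) -` B"
    define s where "s e = case_sum (\<lambda>i. e (Inl i)) (case_sum (\<lambda>i :: nat. 0) (\<lambda>i. e (Inr i)))"
      for e :: "nat + nat \<Rightarrow> 'a"
    have "qf T"
      unfolding T_def mid_def
      by (intro qf.Int qf_vimage[OF A(1)] qf_vimage[OF B(1)] affine_form_intros)
    moreover have "finite I" by (simp add: I_def)
    ultimately have qf: "qf (s -` {t. \<exists>f. (\<lambda>i. if i \<in> I then f i else t i) \<in> T})"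
      unfolding s_def by (intro qf_vimage[OF qf_ex_finite] affine_form_intros)
    show ?thesis
    proof (rule definable_relI[OF qf])
      show "P O Q \<subseteq> carrier_vec n \<times> carrier_vec k" using A(2) B(2) by auto
    next
      fix x z :: "'a vec" assume xz: "x \<in> carrier_vec n" "z \<in> carrier_vec k"
      let ?t = "\<lambda>f i. if i \<in> I then f i else s (case_sum (vec_fun x) (vec_fun z)) i"
      have t: "?t f \<in> T \<longleftrightarrow> (x, vec m (\<lambda>i. f (Inr (Inl i)))) \<in> P \<and> (vec m (\<lambda>i. f (Inr (Inl i))), z) \<in> Q"
        (is "_ \<longleftrightarrow> (x, ?y) \<in> P \<and> _") for f
      proof -
        have y: "?y \<in> carrier_vec m" by simp
        have "mid (?t f) = vec_fun ?y" by (auto simp: mid_def I_def vec_fun_def)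
        moreover have "(\<lambda>i. ?t f (Inl i)) = vec_fun x" "(\<lambda>i. ?t f (Inr (Inr i))) = vec_fun z"
          by (auto simp: I_def s_def)
        ultimately show ?thesis
          unfolding T_def Int_iff vimage_eq by (simp only: A(3)[OF xz(1) y] B(3)[OF y xz(2)])
      qed
      have "(x, z) \<in> P O Q \<longleftrightarrow> (\<exists>f. ?t f \<in> T)"
      proof
        assume "(x, z) \<in> P O Q"
        then obtain y where y: "(x, y) \<in> P" "(y, z) \<in> Q" by auto
        then have "y \<in> carrier_vec m" using A(2) by auto
        then have "vec m (\<lambda>i. y $ i) = y" by (intro eq_vecI) auto
        then show "\<exists>f. ?t f \<in> T"
          using y unfolding t
          by (intro exI[of _ "\<lambda>i. case i of Inl _ \<Rightarrow> 0 | Inr j \<Rightarrow> case j of Inl k \<Rightarrow> y $ k | Inr _ \<Rightarrow> 0"]) simp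
      qed (auto simp: t)
      then show "(x, z) \<in> P O Q \<longleftrightarrow>
          case_sum (vec_fun x) (vec_fun z) \<in> s -` {t. \<exists>f. (\<lambda>i. if i \<in> I then f i else t i) \<in> T}"
        by simp
    qed
  qed
qed

lemma (in infinite_division_ring) definable_rel_Id_on:
  fixes D :: "'a vec set"
  assumes "definable D" "D \<subseteq> carrier_vec n"
  shows "definable_rel n n (Id_on D)"
proof (cases "D = {}")
  case True
  then show ?thesis by (intro definable_relI[OF qf_empty]) auto
next
  case False
  from definable_qf[OF assms(1)] obtain k A where A: "qf A" "D = {v \<in> carrier_vec k. vec_fun v \<in> A}"
    by (elim exE conjE)
  from False obtain v where "v \<in> D" by blast
  then have k: "k = n" using A(2) assms(2) by (metis (no_types, lifting) carrier_vecD mem_Collect_eq subsetD)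
  have qf: "qf ((\<lambda>e i. e (Inl i)) -` A \<inter> (\<Inter>i<n. {e. e (Inl i) = e (Inr i)}))"
    by (intro qf.Int qf_vimage[OF A(1)] qf_INT qf_eq affine_form_intros) simp
  show ?thesis
  proof (rule definable_relI[OF qf])
    fix x y :: "'a vec" assume xy: "x \<in> carrier_vec n" "y \<in> carrier_vec n"
    have "x = y" if "\<forall>i<n. vec_fun x i = vec_fun y i"
      using xy that by (intro eq_vecI) (auto simp: vec_fun_def)
    then show "(x, y) \<in> Id_on D \<longleftrightarrow>
      case_sum (vec_fun x) (vec_fun y) \<in> (\<lambda>e i. e (Inl i)) -` A \<inter> (\<Inter>i<n. {e. e (Inl i) = e (Inr i)})"
      using xy A(2) k by auto
  qed (use assms(2) in auto)
qed

section \<open>Chains of definable graphs\<close>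

definition rel_points :: "('a::zero vec \<times> 'a vec) set \<Rightarrow> (nat + nat \<Rightarrow> 'a) set" where
  "rel_points Q = (\<lambda>(x, y). case_sum (vec_fun x) (vec_fun y)) ` Q"

lemma definable_rel_chain:
  fixes Q :: "('a::ring_1 vec \<times> 'a vec) set"
  assumes "definable_rel n m Q"
  shows "\<exists>c. chain_of (rel_points Q) c"
  using assms
proof (rule definable_relE)
  fix A :: "(nat + nat \<Rightarrow> 'a) set"
  assume A: "qf A" "Q \<subseteq> carrier_vec n \<times> carrier_vec m"
    "\<And>x y. x \<in> carrier_vec n \<Longrightarrow> y \<in> carrier_vec m \<Longrightarrow> (x, y) \<in> Q \<longleftrightarrow> case_sum (vec_fun x) (vec_fun y) \<in> A"
  \<comment> \<open>The padded coordinates vanish on \<open>rel_points Q\<close>. These infinitely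
    many equations are beyond \<open>qf\<close>, but \<open>L\<close> is affine, and a chain is all
    that is needed.\<close>
  define L :: "(nat + nat \<Rightarrow> 'a) set" where
    "L = {e. (\<forall>i\<ge>n. e (Inl i) = 0) \<and> (\<forall>i\<ge>m. e (Inr i) = 0)}"
  have "(\<lambda>_. 0) \<in> L" by (simp add: L_def)
  then have "L \<in> affine_sets" by (auto simp: affine_sets_def aff_def L_def)
  from qf_chain[OF A(1)] obtain c where "chain_of A c" by (elim exE)
  then have "\<exists>c. chain_of (A \<inter> L) c"
    by (rule chain_of_Int[OF _ chain_of_affine[OF \<open>L \<in> affine_sets\<close>]])
  moreover have "rel_points Q = A \<inter> L"
  proof (intro Set.set_eqI iffI)
    fix e assume "e \<in> rel_points Q"
    then obtain x y where xy: "(x, y) \<in> Q" "e = case_sum (vec_fun x) (vec_fun y)"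
      by (auto simp: rel_points_def)
    then have "x \<in> carrier_vec n" "y \<in> carrier_vec m" using A(2) by auto
    then show "e \<in> A \<inter> L" using A(3) xy by (auto simp: L_def vec_fun_def)
  next
    fix e assume "e \<in> A \<inter> L"
    then have e: "e \<in> A" "e \<in> L" by auto
    let ?x = "vec n (\<lambda>i. e (Inl i))" and ?y = "vec m (\<lambda>i. e (Inr i))"
    have eq: "case_sum (vec_fun ?x) (vec_fun ?y) = e"
      using e(2) by (auto simp: L_def vec_fun_def fun_eq_iff split: sum.split)
    then have "(?x, ?y) \<in> Q" using A(3)[of ?x ?y] e(1) by simp
    then show "e \<in> rel_points Q" using eq by (force simp: rel_points_def)
  qed
  ultimately show ?thesis by simp
qed


section \<open>Row operations and bases\<close>

text \<open>Entry \<open>j\<close> of the row vector \<open>l\<close> times the matrix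
  \<open>v\<close>. Matrices are functions, so that all sizes share one type.\<close>

definition comb :: "nat \<Rightarrow> (nat \<Rightarrow> 'a::ring_1) \<Rightarrow> (nat \<Rightarrow> nat \<Rightarrow> 'a) \<Rightarrow> nat \<Rightarrow> 'a" where
  "comb n l v j = (\<Sum>r<n. l r * v r j)"

text \<open>Invertibility of the \<open>n\<close> by \<open>n\<close> corner, in a form on which row
  operations act directly.\<close>

definition row_basis :: "nat \<Rightarrow> (nat \<Rightarrow> nat \<Rightarrow> 'a::ring_1) \<Rightarrow> bool" where
  "row_basis n v \<longleftrightarrow> (\<forall>w. \<exists>l. \<forall>j<n. comb n l v j = w j) \<and>
     (\<forall>l. (\<forall>j<n. comb n l v j = 0) \<longrightarrow> (\<forall>i<n. l i = 0))"

definition row_add :: "nat \<Rightarrow> nat \<Rightarrow> 'a::ring_1 \<Rightarrow> (nat \<Rightarrow> nat \<Rightarrow> 'a) \<Rightarrow> nat \<Rightarrow> nat \<Rightarrow> 'a" where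
  "row_add i k t v = v(i := \<lambda>j. v i j + t * v k j)"

definition row_scale :: "nat \<Rightarrow> 'a::ring_1 \<Rightarrow> (nat \<Rightarrow> nat \<Rightarrow> 'a) \<Rightarrow> nat \<Rightarrow> nat \<Rightarrow> 'a" where
  "row_scale i t v = v(i := \<lambda>j. t * v i j)"

lemma row_basis_span:
  assumes "row_basis n v"
  shows "\<exists>l. \<forall>j<n. comb n l v j = w j"
  using assms unfolding row_basis_def by (elim conjE allE)

lemma row_basis_indep:
  assumes "row_basis n v" "\<And>j. j < n \<Longrightarrow> comb n l v j = 0" "i < n"
  shows "l i = 0"
  using assms unfolding row_basis_def by blast

lemma row_basisI:
  assumes "\<And>w. \<exists>l. \<forall>j<n. comb n l v j = w j"
    "\<And>l i. (\<And>j. j < n \<Longrightarrow> comb n l v j = 0) \<Longrightarrow> i < n \<Longrightarrow> l i = 0"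
  shows "row_basis n v"
  using assms unfolding row_basis_def by blast

lemma comb_cong: "(\<And>r. r < n \<Longrightarrow> l r = l' r) \<Longrightarrow> (\<And>r. r < n \<Longrightarrow> v r j = v' r j) \<Longrightarrow> comb n l v j = comb n l' v' j"
  by (simp add: comb_def)

lemma comb_diff: "comb n (\<lambda>r. l r - l' r) v j = comb n l v j - comb n l' v j"
  by (simp add: comb_def left_diff_distrib sum_subtractf)

lemma comb_mult: "comb n (\<lambda>r. c * l r) v j = c * comb n l v j"
  by (simp add: comb_def sum_distrib_left mult.assoc)

lemma comb_remove: "k < n \<Longrightarrow> comb n l v j = l k * v k j + (\<Sum>r\<in>{..<n} - {k}. l r * v r j)"
  unfolding comb_def by (intro sum.remove) auto

lemma row_basis_cong:
  assumes "\<And>i j. i < n \<Longrightarrow> j < n \<Longrightarrow> v i j = w i j"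
  shows "row_basis n v \<longleftrightarrow> row_basis n w"
proof -
  have "comb n l v j = comb n l w j" if "j < n" for l j
    using assms that by (intro comb_cong) auto
  then show ?thesis by (simp add: row_basis_def)
qed

text \<open>The new row \<open>i\<close> brings in the surplus \<open>l i * t\<close> of row
  \<open>k\<close>, which is taken off the coefficient of row \<open>k\<close>.\<close>

lemma comb_row_add:
  assumes "i < n" "k < n" "i \<noteq> k"
  shows "comb n (l(k := l k - l i * t)) (row_add i k t v) j = comb n l v j"
proof -
  have 1: "comb n l v j = l i * v i j + (l k * v k j + (\<Sum>r\<in>{..<n} - {i} - {k}. l r * v r j))" for l v
    unfolding comb_def using assms by (subst sum.remove[of _ i], simp, simp, subst sum.remove[of _ k]) auto
  have "(\<Sum>r\<in>{..<n} - {i} - {k}. (l(k := l k - l i * t)) r * row_add i k t v r j)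
      = (\<Sum>r\<in>{..<n} - {i} - {k}. l r * v r j)"
    by (rule sum.cong) (auto simp: row_add_def)
  then show ?thesis
    unfolding 1 using assms by (simp add: row_add_def algebra_simps)
qed

lemma comb_row_scale:
  assumes "i < n" "t \<noteq> (0::'a::division_ring)"
  shows "comb n (l(i := l i * inverse t)) (row_scale i t v) j = comb n l v j"
proof -
  have "(\<Sum>r\<in>{..<n} - {i}. (l(i := l i * inverse t)) r * row_scale i t v r j)
      = (\<Sum>r\<in>{..<n} - {i}. l r * v r j)"
    by (rule sum.cong) (auto simp: row_scale_def)
  moreover have "l i * inverse t * (t * v i j) = l i * v i j"
    using assms(2) by (metis left_inverse mult.assoc mult_1)
  ultimately show ?thesis
    using assms unfolding comb_remove[OF assms(1)] by (simp add: row_scale_def)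
qed

lemma row_basis_row_add:
  assumes "row_basis n v" "i < n" "k < n" "i \<noteq> k"
  shows "row_basis n (row_add i k t v)"
proof (rule row_basisI)
  fix w
  from row_basis_span[OF assms(1), of w] obtain l where "\<forall>j<n. comb n l v j = w j" by (elim exE)
  then have "\<forall>j<n. comb n (l(k := l k - l i * t)) (row_add i k t v) j = w j"
    by (simp only: comb_row_add[OF assms(2-4)])
  then show "\<exists>l. \<forall>j<n. comb n l (row_add i k t v) j = w j" by (intro exI)
next
  fix l r assume l: "\<And>j. j < n \<Longrightarrow> comb n l (row_add i k t v) j = 0" and r: "r < n"
  define l' where "l' = l(k := l k + l i * t)"
  have "l = l'(k := l' k - l' i * t)" using assms(4) by (auto simp: l'_def)
  then have "comb n l' v j = 0" if "j < n" for j
    using l[OF that] comb_row_add[OF assms(2-4), of l' t v j] by simp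
  then have l': "l' s = 0" if "s < n" for s using row_basis_indep[OF assms(1)] that by blast
  have "l i = 0" using l'[of i] assms by (simp add: l'_def)
  then show "l r = 0" using l'[OF r] by (auto simp: l'_def split: if_splits)
qed

lemma row_basis_row_scale:
  assumes "row_basis n v" "i < n" "t \<noteq> (0::'a::division_ring)"
  shows "row_basis n (row_scale i t v)"
proof (rule row_basisI)
  fix w
  from row_basis_span[OF assms(1), of w] obtain l where "\<forall>j<n. comb n l v j = w j" by (elim exE)
  then have "\<forall>j<n. comb n (l(i := l i * inverse t)) (row_scale i t v) j = w j"
    by (simp only: comb_row_scale[OF assms(2,3)])
  then show "\<exists>l. \<forall>j<n. comb n l (row_scale i t v) j = w j" by (intro exI)
next
  fix l r assume l: "\<And>j. j < n \<Longrightarrow> comb n l (row_scale i t v) j = 0" and r: "r < n"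
  define l' where "l' = l(i := l i * t)"
  have "l = l'(i := l' i * inverse t)" using assms(3) by (auto simp: l'_def mult.assoc)
  then have "comb n l' v j = 0" if "j < n" for j
    using l[OF that] comb_row_scale[OF assms(2,3), of l' v j] by simp
  then have "l' s = 0" if "s < n" for s using row_basis_indep[OF assms(1)] that by blast
  from this[OF r] show "l r = 0" using assms(3) by (auto simp: l'_def split: if_splits)
qed

text \<open>The coefficients \<open>l\<close> are the last row of the inverse matrix. A nonzero
  \<open>l k\<close> allows row \<open>k\<close> to be exchanged for the last coordinate
  vector.\<close>

definition pivot :: "nat \<Rightarrow> (nat \<Rightarrow> nat \<Rightarrow> 'a::ring_1) \<Rightarrow> (nat \<Rightarrow> 'a) \<Rightarrow> nat \<Rightarrow> bool" where
  "pivot n v l k \<longleftrightarrow> (\<forall>j\<le>n. comb (Suc n) l v j = (if j = n then 1 else 0)) \<and> k \<le> n \<and> l k \<noteq> 0"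

lemma pivot_exists:
  assumes "row_basis (Suc n) v"
  shows "\<exists>l k. pivot n v l k"
proof -
  from row_basis_span[OF assms, of "\<lambda>j. if j = n then 1 else 0"]
  obtain l where l: "\<forall>j<Suc n. comb (Suc n) l v j = (if j = n then 1 else 0)" by (elim exE)
  have "\<exists>k\<le>n. l k \<noteq> 0"
  proof (rule ccontr)
    assume "\<not> ?thesis"
    then have "comb (Suc n) l v n = 0" by (simp add: comb_def)
    then show False using l by simp
  qed
  then obtain k where "k \<le> n" "l k \<noteq> 0" by (elim exE conjE)
  then have "pivot n v l k" using l by (simp add: pivot_def)
  then show ?thesis by (intro exI)
qed

lemma pivot_change: "pivot n v l k \<Longrightarrow> k' \<le> n \<Longrightarrow> l k' \<noteq> 0 \<Longrightarrow> pivot n v l k'"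
  by (simp add: pivot_def)

lemma pivot_unique:
  assumes "row_basis (Suc n) v" "pivot n v l k" "pivot n v l' k'" "i \<le> n"
  shows "l i = l' i"
proof -
  have "l i - l' i = 0"
    by (rule row_basis_indep[OF assms(1)]) (use assms in \<open>auto simp: comb_diff pivot_def\<close>)
  then show ?thesis by simp
qed

text \<open>Deleting row \<open>k\<close> keeps row \<open>n\<close> by storing it in slot
  \<open>k\<close>, and its coefficient moves along.\<close>

lemma comb_replace:
  assumes "k \<le> n"
  shows "comb n (l(k := l n)) (v(k := v n)) j = comb (Suc n) l v j - l k * v k j"
proof (cases "k = n")
  case False
  then have k: "k < n" using assms by simp
  have "(\<Sum>r\<in>{..<n} - {k}. (l(k := l n)) r * (v(k := v n)) r j) = (\<Sum>r\<in>{..<n} - {k}. l r * v r j)"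
    by (rule sum.cong) auto
  moreover have "comb (Suc n) l v j = comb n l v j + l n * v n j" by (simp add: comb_def)
  ultimately show ?thesis unfolding comb_remove[OF k] by simp
qed (simp add: comb_def)

text \<open>By exchange, the rows other than \<open>k\<close> and the last coordinate vector form a
  basis; modulo that vector, i.e. without the last column, these rows are a basis of
  \<open>R^n\<close>.\<close>

lemma row_basis_minor:
  fixes v :: "nat \<Rightarrow> nat \<Rightarrow> 'a::division_ring"
  assumes v: "row_basis (Suc n) v" and p: "pivot n v l k"
  shows "row_basis n (v(k := v n))"
proof (rule row_basisI)
  fix w :: "nat \<Rightarrow> 'a"
  from row_basis_span[OF v, of w] obtain m where m: "\<forall>j<Suc n. comb (Suc n) m v j = w j"
    by (elim exE)
  \<comment> \<open>Subtracting a multiple of \<open>l\<close> alters the combination in column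
    \<open>n\<close> only, and this multiple makes the coefficient of row \<open>k\<close>
    zero.\<close>
  define m' where "m' = (\<lambda>r. m r - m k * inverse (l k) * l r)"
  have "m' k = 0" using p by (simp add: m'_def pivot_def mult.assoc)
  moreover have "comb (Suc n) m' v j = w j" if "j < n" for j
    using m that p unfolding m'_def comb_diff comb_mult by (simp add: pivot_def)
  moreover have "k \<le> n" using p by (simp add: pivot_def)
  ultimately have "\<forall>j<n. comb n (m'(k := m' n)) (v(k := v n)) j = w j"
    by (simp add: comb_replace)
  then show "\<exists>l. \<forall>j<n. comb n l (v(k := v n)) j = w j" by blast
next
  fix m i assume m: "\<And>j. j < n \<Longrightarrow> comb n m (v(k := v n)) j = 0" and i: "i < n"
  have k: "k \<le> n" using p by (simp add: pivot_def)
  \<comment> \<open>The coefficients sent back to the original rows, with 0 at the deleted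
    one.\<close>
  define m1 where "m1 = (\<lambda>r. if r = k then 0 else if r = n then m k else m r)"
  have eq: "comb n m (v(k := v n)) j = comb (Suc n) m1 v j" for j
  proof -
    have "comb n m (v(k := v n)) j = comb n (m1(k := m1 n)) (v(k := v n)) j"
      by (rule comb_cong) (auto simp: m1_def)
    then show ?thesis unfolding comb_replace[OF k] by (simp add: m1_def)
  qed
  \<comment> \<open>Only column \<open>n\<close> of the combination can be nonzero, so it is
    \<open>c\<close> times the last coordinate vector and \<open>m1\<close> is \<open>c\<close>
    times \<open>l\<close>; the zero at \<open>k\<close> then forces \<open>c = 0\<close>.\<close>
  define c where "c = comb (Suc n) m1 v n"
  have "m1 r - c * l r = 0" if "r < Suc n" for r
  proof (rule row_basis_indep[OF v _ that])
    fix j assume "j < Suc n"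
    then show "comb (Suc n) (\<lambda>r. m1 r - c * l r) v j = 0"
      using m[of j] p unfolding comb_diff comb_mult by (cases "j = n") (auto simp: c_def pivot_def eq)
  qed
  then have m1: "m1 r = c * l r" if "r \<le> n" for r using that by simp
  from m1[of k] have "c = 0" using p by (auto simp: m1_def pivot_def)
  then have "m1 r = 0" if "r \<le> n" for r using m1[OF that] by simp
  from this[of i] this[of n] show "m i = 0" using i k by (auto simp: m1_def split: if_splits)
qed


section \<open>The Dieudonne determinant\<close>

text \<open>Artin's recursion, with values in \<open>R\<close>: the last coordinate vector is a combination of the rows with
  coefficients \<open>l\<close>, and the row of a nonzero coefficient is exchanged with the last one and deleted. Only the
  image of the value in an abelian quotient of \<open>R\<^sup>*\<close> is independent of the choices.\<close>

primrec ddet :: "nat \<Rightarrow> (nat \<Rightarrow> nat \<Rightarrow> 'a::division_ring) \<Rightarrow> 'a" where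
  "ddet 0 v = 1"
| "ddet (Suc n) v = (let (l, k) = (SOME (l, k). pivot n v l k) in
     (if k = n then 1 else - 1) * inverse (l k) * ddet n (v(k := v n)))"

text \<open>The choice inside \<open>ddet\<close> sees \<open>v\<close> only through
  \<open>pivot n v\<close>, which depends on the corner alone, so equal corners lead to the very
  same choice.\<close>

lemma ddet_cong:
  assumes "\<And>i j. i < n \<Longrightarrow> j < n \<Longrightarrow> v i j = w i j"
  shows "ddet n v = ddet n w"
  using assms
proof (induction n arbitrary: v w)
  case (Suc n)
  have "comb (Suc n) l v j = comb (Suc n) l w j" if "j \<le> n" for l j
    using Suc.prems that by (intro comb_cong) auto
  then have "pivot n v = pivot n w" by (auto simp: pivot_def fun_eq_iff)
  moreover have "ddet n (v(k := v n)) = ddet n (w(k := w n))" for k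
    by (rule Suc.IH) (use Suc.prems in auto)
  ultimately show ?case by simp
qed simp

lemma ddet_Suc:
  assumes "row_basis (Suc n) v"
  obtains l k where "pivot n v l k"
    "ddet (Suc n) v = (if k = n then 1 else - 1) * inverse (l k) * ddet n (v(k := v n))"
proof -
  obtain l k where lk: "(SOME (l, k). pivot n v l k) = (l, k)" by (metis surj_pair)
  from pivot_exists[OF assms] have "\<exists>x. case x of (l, k) \<Rightarrow> pivot n v l k" by auto
  from someI_ex[OF this] have "pivot n v l k" by (simp add: lk)
  then show thesis using lk that by simp
qed

declare ddet.simps(2) [simp del]

lemma ddet_nonzero: "row_basis n v \<Longrightarrow> ddet n v \<noteq> 0"
proof (induction n arbitrary: v)
  case (Suc n)
  from Suc.prems show ?case
  proof (rule ddet_Suc)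
    fix l k assume p: "pivot n v l k"
      and det: "ddet (Suc n) v = (if k = n then 1 else - 1) * inverse (l k) * ddet n (v(k := v n))"
    have "l k \<noteq> 0" using p by (simp add: pivot_def)
    moreover have "ddet n (v(k := v n)) \<noteq> 0" using Suc.IH[OF row_basis_minor[OF Suc.prems p]] .
    ultimately show ?thesis unfolding det by simp
  qed
qed simp

text \<open>The determinant identities hold only after a homomorphism \<open>\<chi>\<close> from the
  nonzero scalars to a commutative group. It is left arbitrary because later it is obtained from a
  given homomorphism on matrices by restriction to the diagonal ones \<open>sdiag d\<close>.\<close>

locale abelian_character = comm_group G for G (structure) +
  fixes \<chi> :: "'a::division_ring \<Rightarrow> 'b"
  assumes chi_closed [simp]: "x \<noteq> 0 \<Longrightarrow> \<chi> x \<in> carrier G"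
    and chi_mult: "x \<noteq> 0 \<Longrightarrow> y \<noteq> 0 \<Longrightarrow> \<chi> (x * y) = \<chi> x \<otimes> \<chi> y"
begin

lemma chi_one [simp]: "\<chi> 1 = \<one>"
  using chi_mult[of 1 1] by simp

abbreviation sgn_elt :: 'b where "sgn_elt \<equiv> \<chi> (- 1)"

lemma sgn_elt_closed [simp]: "sgn_elt \<in> carrier G" by simp

lemma sgn_elt_sq [simp]: "sgn_elt \<otimes> sgn_elt = \<one>"
  using chi_mult[of "-1" "-1"] by simp

lemma sgn_elt_cancel [simp]: "x \<in> carrier G \<Longrightarrow> sgn_elt \<otimes> (sgn_elt \<otimes> x) = x"
  by (simp flip: m_assoc)

lemma chi_minus: "x \<noteq> 0 \<Longrightarrow> \<chi> (- x) = sgn_elt \<otimes> \<chi> x"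
  using chi_mult[of "-1" x] by simp

abbreviation D :: "nat \<Rightarrow> (nat \<Rightarrow> nat \<Rightarrow> 'a) \<Rightarrow> 'b" where "D n v \<equiv> \<chi> (ddet n v)"

lemma D_closed [simp]: "row_basis n v \<Longrightarrow> D n v \<in> carrier G"
  by (simp add: ddet_nonzero)

text \<open>The rules for size \<open>n\<close>, bundled as induction hypothesis for size
  \<open>Suc n\<close>: that the pivot does not matter there is a statement about row operations on
  minors.\<close>

definition row_invariant :: "nat \<Rightarrow> bool" where
  "row_invariant n \<longleftrightarrow> (\<forall>v i k t. row_basis n v \<longrightarrow> i < n \<longrightarrow> k < n \<longrightarrow> i \<noteq> k \<longrightarrow> D n (row_add i k t v) = D n v) \<and>
     (\<forall>v i t. row_basis n v \<longrightarrow> i < n \<longrightarrow> t \<noteq> 0 \<longrightarrow> D n (row_scale i t v) = \<chi> t \<otimes> D n v)"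

lemma D_row_add_if: "row_invariant n \<Longrightarrow> row_basis n v \<Longrightarrow> i < n \<Longrightarrow> k < n \<Longrightarrow> i \<noteq> k \<Longrightarrow> D n (row_add i k t v) = D n v"
  by (simp add: row_invariant_def)

lemma D_row_scale_if: "row_invariant n \<Longrightarrow> row_basis n v \<Longrightarrow> i < n \<Longrightarrow> t \<noteq> 0 \<Longrightarrow> D n (row_scale i t v) = \<chi> t \<otimes> D n v"
  by (simp add: row_invariant_def)

text \<open>Row \<open>k\<close> is scaled by its own coefficient and then receives the multiples of
  the other rows one at a time.\<close>

lemma D_row_comb:
  assumes inv: "row_invariant n" and v: "row_basis n v" and k: "k < n"
    and u: "\<And>j. j < n \<Longrightarrow> u j = comb n l v j" and lk: "l k \<noteq> 0"
  shows "row_basis n (v(k := u)) \<and> D n (v(k := u)) = \<chi> (l k) \<otimes> D n v"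
proof -
  define w where "w m = v(k := \<lambda>j. l k * v k j + (\<Sum>r\<in>{..<m} - {k}. l r * v r j))" for m
  have "row_basis n (w m) \<and> D n (w m) = \<chi> (l k) \<otimes> D n v" if "m \<le> n" for m
    using that
  proof (induction m)
    case 0
    have "w 0 = row_scale k (l k) v" by (simp add: w_def row_scale_def)
    then show ?case using row_basis_row_scale[OF v k lk] D_row_scale_if[OF inv v k lk] by simp
  next
    case (Suc m)
    show ?case
    proof (cases "m = k")
      case True
      then have "{..<Suc m} - {k} = {..<m} - {k}" by auto
      then have "w (Suc m) = w m" by (simp add: w_def)
      then show ?thesis using Suc by simp
    next
      case False
      then have "{..<Suc m} - {k} = insert m ({..<m} - {k})" by auto
      then have "w (Suc m) = row_add k m (l m) (w m)"
        using False by (simp add: w_def row_add_def add.assoc add.commute[of "l m * _"])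
      then show ?thesis
        using Suc False k row_basis_row_add[of n "w m" k m] D_row_add_if[OF inv, of "w m" k m] by simp
    qed
  qed
  from this[of n] have w: "row_basis n (w n)" "D n (w n) = \<chi> (l k) \<otimes> D n v" by auto
  have "(v(k := u)) i j = w n i j" if "j < n" for i j
    using u[OF that] comb_remove[OF k, of l v j] by (simp add: w_def)
  then show ?thesis using w row_basis_cong[of n "v(k := u)" "w n"] ddet_cong[of n "v(k := u)" "w n"] by simp
qed

lemma D_row_replace:
  assumes inv: "row_invariant n" and v: "row_basis n v" and k: "k < n"
    and u: "\<And>j. j < n \<Longrightarrow> c * u j = comb n l v j" and c: "c \<noteq> 0" and lk: "l k \<noteq> 0"
  shows "row_basis n (v(k := u)) \<and> \<chi> c \<otimes> D n (v(k := u)) = \<chi> (l k) \<otimes> D n v"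
proof -
  have "u j = comb n (\<lambda>r. inverse c * l r) v j" if "j < n" for j
    using u[OF that] c unfolding comb_mult by (metis left_inverse mult.assoc mult_1)
  from D_row_comb[OF inv v k this] c lk
  have *: "row_basis n (v(k := u))" "D n (v(k := u)) = \<chi> (inverse c * l k) \<otimes> D n v" by auto
  have "\<chi> c \<otimes> \<chi> (inverse c * l k) = \<chi> (l k)"
    using chi_mult[of c "inverse c * l k"] c lk by (simp flip: mult.assoc)
  then show ?thesis using * v c lk by (simp flip: m_assoc)
qed

text \<open>A swap is three row additions followed by the scaling of one row by -1.\<close>

lemma D_row_swap:
  assumes inv: "row_invariant n" and v: "row_basis n v" and ik: "i < n" "k < n" "i \<noteq> k"
  shows "D n (v(i := v k, k := v i)) = sgn_elt \<otimes> D n v"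
proof -
  define v1 where "v1 = row_add i k 1 v"
  define v2 where "v2 = row_add k i (-1) v1"
  define v3 where "v3 = row_add i k 1 v2"
  have b: "row_basis n v1" "row_basis n v2" "row_basis n v3"
    unfolding v1_def v2_def v3_def using v ik by (auto intro!: row_basis_row_add)
  have "D n v3 = D n v"
    using D_row_add_if[OF inv, of v i k 1] D_row_add_if[OF inv, of v1 k i "-1"]
      D_row_add_if[OF inv, of v2 i k 1] v b ik by (simp add: v1_def v2_def v3_def)
  moreover have "v(i := v k, k := v i) = row_scale k (-1) v3"
    using ik by (auto simp: v1_def v2_def v3_def row_add_def row_scale_def fun_eq_iff)
  ultimately show ?thesis using D_row_scale_if[OF inv b(3) ik(2), of "-1"] by simp
qed

definition pivot_sign :: "nat \<Rightarrow> nat \<Rightarrow> 'b" where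
  "pivot_sign n k = (if k = n then \<one> else sgn_elt)"

lemma pivot_sign_closed [simp]: "pivot_sign n k \<in> carrier G"
  by (simp add: pivot_sign_def)

text \<open>Off the last column, \<open>l\<close> is a linear relation between the rows. Solving it
  for a deleted row links the two minors by a row replacement that brings in \<open>l k\<close> and
  \<open>l k'\<close>. \<open>F\<close> stands for the determinant of \<open>v\<close>, known so far
  through one pivot only.\<close>

lemma D_pivot_indep:
  assumes inv: "row_invariant n" and v: "row_basis (Suc n) v" and p: "pivot n v l k" and p': "pivot n v l k'"
    and F: "F \<in> carrier G" "\<chi> (l k) \<otimes> F = pivot_sign n k \<otimes> D n (v(k := v n))"
  shows "\<chi> (l k') \<otimes> F = pivot_sign n k' \<otimes> D n (v(k' := v n))"
proof (cases "k = k'")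
  case False
  define a where "a = \<chi> (l k)"
  define b where "b = \<chi> (l k')"
  define w where "w = v(k := v n)"
  define w' where "w' = v(k' := v n)"
  have l: "l k \<noteq> 0" "l k' \<noteq> 0" and kn: "k \<le> n" "k' \<le> n" using p p' by (auto simp: pivot_def)
  have w: "row_basis n w" "row_basis n w'"
    unfolding w_def w'_def using row_basis_minor[OF v] p p' by auto
  have car: "a \<in> carrier G" "b \<in> carrier G" "D n w \<in> carrier G" "D n w' \<in> carrier G"
    using l w by (auto simp: a_def b_def)
  \<comment> \<open>In the minor for \<open>k\<close>, row \<open>n\<close> and its coefficient
    occupy slot \<open>k\<close>.\<close>
  have rel: "- l k * v k j = comb n (l(k := l n)) (v(k := v n)) j" if "j < n" for j
    using p that comb_replace[OF kn(1), of l v j] by (simp add: pivot_def)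
  have chi: "\<chi> (- l k) = sgn_elt \<otimes> a" "\<chi> (- l k') = sgn_elt \<otimes> b"
    by (simp_all only: a_def b_def chi_minus[OF l(1)] chi_minus[OF l(2)])
  have key: "a \<otimes> (pivot_sign n k' \<otimes> D n w') = b \<otimes> (pivot_sign n k \<otimes> D n w)"
  proof (cases "k' = n")
    case True
    then have k: "k < n" using False kn by simp
    have "w' = v" using True by (simp add: w'_def)
    have "- l n * v n j = comb n l v j" if "j < n" for j
    proof -
      have "comb (Suc n) l v j = 0" using p that by (simp add: pivot_def)
      then show ?thesis by (simp add: comb_def neg_eq_iff_add_eq_0 add.commute)
    qed
    from D_row_replace[OF inv w(2)[unfolded \<open>w' = v\<close>] k this]
    have "sgn_elt \<otimes> b \<otimes> D n w = a \<otimes> D n w'"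
      using l chi True by (simp add: w_def a_def \<open>w' = v\<close>)
    then show ?thesis using car True False by (simp add: pivot_sign_def m_ac)
  next
    case k'n: False
    then have k': "k' < n" using kn by simp
    have "row_basis n (w(k' := v k)) \<and> \<chi> (- l k) \<otimes> D n (w(k' := v k)) = \<chi> ((l(k := l n)) k') \<otimes> D n w"
      using D_row_replace[OF inv w(1) k', of "- l k" "v k" "l(k := l n)"] rel l False by (simp add: w_def)
    then have r: "row_basis n (w(k' := v k))" "sgn_elt \<otimes> a \<otimes> D n (w(k' := v k)) = b \<otimes> D n w"
      using False chi by (auto simp: b_def)
    show ?thesis
    proof (cases "k = n")
      case True
      then have "w(k' := v k) = w'" by (simp add: w_def w'_def)
      then show ?thesis using r car True k'n by (simp add: pivot_sign_def m_ac)
    next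
      case kn': False
      then have k: "k < n" using kn by simp
      \<comment> \<open>\<open>w(k' := v k)\<close> has the rows of \<open>w'\<close>, with
        \<open>v n\<close> and \<open>v k\<close> in exchanged slots.\<close>
      have "(w(k' := v k))(k := (w(k' := v k)) k', k' := (w(k' := v k)) k) = w'"
        using False by (auto simp: w_def w'_def)
      with D_row_swap[OF inv r(1) k k' False] have "D n w' = sgn_elt \<otimes> D n (w(k' := v k))" by simp
      moreover have X: "D n (w(k' := v k)) \<in> carrier G" using r(1) by simp
      moreover have "b \<otimes> (sgn_elt \<otimes> D n w) = sgn_elt \<otimes> (sgn_elt \<otimes> a \<otimes> D n (w(k' := v k)))"
        using r(2) car by (simp add: m_lcomm)
      then have "b \<otimes> (sgn_elt \<otimes> D n w) = a \<otimes> D n (w(k' := v k))" using car X by (simp add: m_assoc)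
      ultimately show ?thesis using car kn' k'n by (simp add: pivot_sign_def)
    qed
  qed
  have "a \<otimes> (b \<otimes> F) = b \<otimes> (a \<otimes> F)" using car F by (simp add: m_ac)
  also have "\<dots> = a \<otimes> (pivot_sign n k' \<otimes> D n w')" using F(2) key by (simp add: a_def w_def)
  finally show ?thesis using car F(1) by (simp add: b_def w'_def)
qed (use F in simp)

text \<open>The recursion of \<open>ddet\<close>, freed from the particular pivot that it
  selects.\<close>

lemma D_pivot:
  assumes inv: "row_invariant n" and v: "row_basis (Suc n) v" and p: "pivot n v l k"
  shows "\<chi> (l k) \<otimes> D (Suc n) v = pivot_sign n k \<otimes> D n (v(k := v n))"
  using v
proof (rule ddet_Suc)
  fix l' k' assume p': "pivot n v l' k'"
    and det: "ddet (Suc n) v = (if k' = n then 1 else - 1) * inverse (l' k') * ddet n (v(k' := v n))"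
  have ll': "l i = l' i" if "i \<le> n" for i using pivot_unique[OF v p p' that] .
  have l': "l' k' \<noteq> 0" "k' \<le> n" using p' by (auto simp: pivot_def)
  have b: "row_basis n (v(k' := v n))" using row_basis_minor[OF v p'] .
  have "\<chi> (l' k') \<otimes> (\<chi> (inverse (l' k')) \<otimes> x) = x" if "x \<in> carrier G" for x
    using chi_mult[of "l' k'" "inverse (l' k')"] l' that by (simp flip: m_assoc)
  moreover have "D (Suc n) v = pivot_sign n k' \<otimes> (\<chi> (inverse (l' k')) \<otimes> D n (v(k' := v n)))"
  proof -
    let ?y = "inverse (l' k') * ddet n (v(k' := v n))"
    have y: "?y \<noteq> 0" "\<chi> ?y = \<chi> (inverse (l' k')) \<otimes> D n (v(k' := v n))"
      using l' ddet_nonzero[OF b] by (simp_all add: chi_mult)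
    have "\<chi> ((if k' = n then 1 else - 1) * ?y) = pivot_sign n k' \<otimes> \<chi> ?y"
      using chi_mult[OF _ y(1), of "-1"] chi_mult[OF _ y(1), of 1] by (auto simp: pivot_sign_def)
    then show ?thesis unfolding det by (simp only: y(2) mult.assoc)
  qed
  ultimately have "\<chi> (l' k') \<otimes> D (Suc n) v = pivot_sign n k' \<otimes> D n (v(k' := v n))"
    using l' b by (simp add: m_lcomm)
  moreover have "pivot n v l k'" using p l' ll' by (auto intro: pivot_change)
  ultimately show ?thesis
    using D_pivot_indep[OF inv v _ p, of k' "D (Suc n) v"] v ll' l' by simp
qed

text \<open>A pivot is selected whose coefficient survives the operation, and for which the minor
  either stays the same or undergoes a row addition itself.\<close>

lemma D_Suc_row_add:
  assumes inv: "row_invariant n" and v: "row_basis (Suc n) v" and ik: "i < Suc n" "k < Suc n" "i \<noteq> k"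
  shows "D (Suc n) (row_add i k t v) = D (Suc n) v"
proof -
  define v' where "v' = row_add i k t v"
  have v': "row_basis (Suc n) v'" unfolding v'_def using row_basis_row_add[OF v ik] .
  obtain l p where p: "pivot n v l p" using pivot_exists[OF v] by blast
  define l' where "l' = l(k := l k - l i * t)"
  have comb': "comb (Suc n) l' v' j = comb (Suc n) l v j" for j
    unfolding l'_def v'_def by (rule comb_row_add[OF ik])
  have same: "D (Suc n) v' = D (Suc n) v"
    if q: "q \<le> n" "l q \<noteq> 0" "l' q = l q" and eq: "D n (v'(q := v' n)) = D n (v(q := v n))" for q
  proof -
    have pv: "pivot n v l q" "pivot n v' l' q" using p q by (auto simp: pivot_def comb')
    have "\<chi> (l q) \<otimes> D (Suc n) v' = \<chi> (l q) \<otimes> D (Suc n) v"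
      using D_pivot[OF inv v pv(1)] D_pivot[OF inv v' pv(2)] q eq by simp
    then show ?thesis using q v v' by simp
  qed
  have "D (Suc n) v' = D (Suc n) v"
  proof (cases "l i = 0")
    case False
    \<comment> \<open>The only row that changes is the deleted one.\<close>
    have "D n (v'(i := v' n)) = D n (v(i := v n))"
      by (rule arg_cong[of _ _ \<chi>], rule ddet_cong) (auto simp: v'_def row_add_def)
    then show ?thesis using same[of i] False ik by (simp add: l'_def)
  next
    case li: True
    then have l': "l' = l" by (simp add: l'_def)
    show ?thesis
    proof (cases "\<exists>q\<le>n. q \<noteq> k \<and> l q \<noteq> 0")
      case True
      then obtain q where q: "q \<le> n" "q \<noteq> k" "l q \<noteq> 0" by blast
      then have qi: "q \<noteq> i" using li by auto
      \<comment> \<open>In the minor, row \<open>n\<close> sits in slot \<open>q\<close>, so an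
        index equal to \<open>n\<close> becomes \<open>q\<close>.\<close>
      define i' where "i' = (if i = n then q else i)"
      define k' where "k' = (if k = n then q else k)"
      have "ddet n (v'(q := v' n)) = ddet n (row_add i' k' t (v(q := v n)))"
        by (rule ddet_cong) (use q qi ik in \<open>auto simp: v'_def row_add_def i'_def k'_def\<close>)
      moreover have "row_basis n (v(q := v n))"
        using row_basis_minor[OF v pivot_change[OF p q(1,3)]] .
      moreover have "i' < n" "k' < n" "i' \<noteq> k'" using q qi ik by (auto simp: i'_def k'_def)
      ultimately have "D n (v'(q := v' n)) = D n (v(q := v n))"
        using D_row_add_if[OF inv] by simp
      then show ?thesis using same[of q] q l' by simp
    next
      case False
      then have lk: "l k \<noteq> 0" using p by (auto simp: pivot_def)
      \<comment> \<open>Row \<open>k\<close> is the only one in the relation, so it vanishes off the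
        last column, and adding a multiple of it is invisible in the minor.\<close>
      have "v k j = 0" if "j < n" for j
      proof -
        have "comb (Suc n) l v j = l k * v k j + (\<Sum>r\<in>{..<Suc n} - {k}. l r * v r j)"
          by (rule comb_remove[OF ik(2)])
        also have "(\<Sum>r\<in>{..<Suc n} - {k}. l r * v r j) = 0"
          by (rule sum.neutral) (use False in \<open>auto simp: less_Suc_eq_le\<close>)
        finally show ?thesis using p that lk by (auto simp: pivot_def)
      qed
      then have "D n (v'(k := v' n)) = D n (v(k := v n))"
        by (intro arg_cong[of _ _ \<chi>] ddet_cong) (use ik in \<open>auto simp: v'_def row_add_def\<close>)
      then show ?thesis using same[of k] lk l' ik by simp
    qed
  qed
  then show ?thesis by (simp add: v'_def)
qed

text \<open>Either the scaled row is the pivot row and its coefficient absorbs \<open>t\<close>, or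
  the scaling happens in the minor.\<close>

lemma D_Suc_row_scale:
  assumes inv: "row_invariant n" and v: "row_basis (Suc n) v" and i: "i < Suc n" and t: "t \<noteq> 0"
  shows "D (Suc n) (row_scale i t v) = \<chi> t \<otimes> D (Suc n) v"
proof -
  define v' where "v' = row_scale i t v"
  have v': "row_basis (Suc n) v'" unfolding v'_def using row_basis_row_scale[OF v i t] .
  obtain l q where q: "pivot n v l q" using pivot_exists[OF v] by blast
  define l' where "l' = l(i := l i * inverse t)"
  have "comb (Suc n) l' v' j = comb (Suc n) l v j" for j
    unfolding l'_def v'_def by (rule comb_row_scale[OF i t])
  then have q': "pivot n v' l' q" using q t by (auto simp: pivot_def l'_def)
  note e = D_pivot[OF inv v q] D_pivot[OF inv v' q']
  have lq: "l q \<noteq> 0" "q \<le> n" using q by (auto simp: pivot_def)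
  have b: "row_basis n (v(q := v n))" using row_basis_minor[OF v q] .
  have "D (Suc n) v' = \<chi> t \<otimes> D (Suc n) v"
  proof (cases "q = i")
    case True
    have "D n (v'(q := v' n)) = D n (v(q := v n))"
      by (rule arg_cong[of _ _ \<chi>], rule ddet_cong) (auto simp: v'_def row_scale_def True)
    then have "\<chi> (l q) \<otimes> D (Suc n) v = \<chi> (l' q) \<otimes> D (Suc n) v'" using e by simp
    also have "\<chi> (l' q) = \<chi> (l q) \<otimes> \<chi> (inverse t)" using True lq t by (simp add: l'_def chi_mult)
    finally have "D (Suc n) v = \<chi> (inverse t) \<otimes> D (Suc n) v'" using lq t v v' by (simp add: m_assoc)
    then show ?thesis using t v' chi_mult[of t "inverse t"] by (simp flip: m_assoc)
  next
    case False
    define i' where "i' = (if i = n then q else i)"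
    have "ddet n (v'(q := v' n)) = ddet n (row_scale i' t (v(q := v n)))"
      by (rule ddet_cong) (use False in \<open>auto simp: v'_def row_scale_def i'_def\<close>)
    moreover have "i' < n" using lq False i by (auto simp: i'_def)
    ultimately have "D n (v'(q := v' n)) = \<chi> t \<otimes> D n (v(q := v n))"
      using D_row_scale_if[OF inv b _ t] by simp
    then have "\<chi> (l q) \<otimes> D (Suc n) v' = \<chi> (l q) \<otimes> (\<chi> t \<otimes> D (Suc n) v)"
      using e False lq t v v' b by (simp add: l'_def m_lcomm)
    then show ?thesis using lq t v v' by simp
  qed
  then show ?thesis by (simp add: v'_def)
qed

lemma row_invariant: "row_invariant n"
proof (induction n)
  case (Suc n)
  then show ?case
    using D_Suc_row_add[OF Suc] D_Suc_row_scale[OF Suc] unfolding row_invariant_def[of "Suc n"] by blast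
qed (simp add: row_invariant_def)

lemmas D_row_add = D_row_add_if[OF row_invariant]
lemmas D_row_scale = D_row_scale_if[OF row_invariant]

text \<open>Such a last row is itself a pivot, with coefficient 1. This gives stability under adding
  a diagonal entry 1.\<close>

lemma D_Suc_unit_row:
  assumes "row_basis (Suc n) v" "\<And>j. j \<le> n \<Longrightarrow> v n j = (if j = n then 1 else 0)"
  shows "D (Suc n) v = D n v"
proof -
  let ?l = "\<lambda>r. if r = n then 1 else 0 :: 'a"
  have "comb (Suc n) ?l v j = v n j" for j by (simp add: comb_def)
  then have p: "pivot n v ?l n" using assms(2) by (simp add: pivot_def)
  from D_pivot[OF row_invariant assms(1) p] row_basis_minor[OF assms(1) p] assms(1) show ?thesis
    by (simp add: pivot_sign_def)
qed

end


section \<open>The stable general linear group\<close>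

text \<open>The image of \<open>GLn n\<close> in the stable group, described by row bases instead of
  matrices; \<open>GLs_eq\<close> shows the agreement.\<close>

definition GLs :: "nat \<Rightarrow> (nat \<Rightarrow> nat \<Rightarrow> 'a::ring_1) set" where
  "GLs n = {v. row_basis n v \<and> (\<forall>i j. n \<le> i \<or> n \<le> j \<longrightarrow> v i j = (if i = j then 1 else 0))}"

definition idm :: "nat \<Rightarrow> nat \<Rightarrow> 'a::ring_1" where
  "idm = (\<lambda>i j. if i = j then 1 else 0)"

definition sdiag :: "'a::ring_1 \<Rightarrow> nat \<Rightarrow> nat \<Rightarrow> 'a" where
  "sdiag d = row_scale 0 d idm"

lemma GLs_outside: "v \<in> GLs n \<Longrightarrow> n \<le> i \<or> n \<le> j \<Longrightarrow> v i j = (if i = j then 1 else 0)"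
  unfolding GLs_def by blast

lemma GLs_row_basis: "v \<in> GLs n \<Longrightarrow> row_basis n v"
  by (simp add: GLs_def)

lemma comb_comb: "comb n (comb n l v) w j = comb n l (\<lambda>r. comb n (v r) w) j"
  unfolding comb_def sum_distrib_left sum_distrib_right mult.assoc by (rule sum.swap)

lemma comb_unit:
  assumes "i < n"
  shows "comb n (idm i) v j = v i j"
proof -
  have "comb n (idm i) v j = (\<Sum>r<n. if r = i then v r j else 0)"
    unfolding comb_def idm_def by (rule sum.cong) auto
  then show ?thesis using assms by simp
qed

lemma comb_idm:
  assumes "j < n"
  shows "comb n l idm j = l j"
proof -
  have "comb n l idm j = (\<Sum>r<n. if r = j then l r else 0)"
    unfolding comb_def idm_def by (rule sum.cong) auto
  then show ?thesis using assms by simp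
qed

lemma row_basis_iff_inverse:
  fixes v :: "nat \<Rightarrow> nat \<Rightarrow> 'a::ring_1"
  shows "row_basis n v \<longleftrightarrow>
    (\<exists>w. (\<forall>i<n. \<forall>j<n. comb n (w i) v j = idm i j) \<and> (\<forall>i<n. \<forall>j<n. comb n (v i) w j = idm i j))"
proof
  assume v: "row_basis n v"
  have "\<forall>i. \<exists>l. \<forall>j<n. comb n l v j = idm i j" using row_basis_span[OF v] by (intro allI)
  from choice[OF this] obtain w where w: "\<forall>i. \<forall>j<n. comb n (w i) v j = idm i j" by (elim exE)
  have "comb n (v i) w j = idm i j" if "i < n" "j < n" for i j
  proof -
    \<comment> \<open>Spanning has given a left inverse \<open>w\<close>. From
      \<open>(v w) v = v (w v) = v\<close> and the independence of the rows of \<open>v\<close> it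
      is a right inverse too.\<close>
    have "comb n (v i) w j - idm i j = 0"
    proof (rule row_basis_indep[OF v _ \<open>j < n\<close>])
      fix k assume k: "k < n"
      have "comb n (comb n (v i) w) v k = comb n (v i) idm k"
        unfolding comb_comb using w k by (intro comb_cong) auto
      then show "comb n (\<lambda>j. comb n (v i) w j - idm i j) v k = 0"
        unfolding comb_diff using that k by (simp add: comb_unit comb_idm)
    qed
    then show ?thesis by simp
  qed
  then have "(\<forall>i<n. \<forall>j<n. comb n (w i) v j = idm i j) \<and> (\<forall>i<n. \<forall>j<n. comb n (v i) w j = idm i j)"
    using w by simp
  then show "\<exists>w. (\<forall>i<n. \<forall>j<n. comb n (w i) v j = idm i j) \<and> (\<forall>i<n. \<forall>j<n. comb n (v i) w j = idm i j)"
    by (intro exI)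
next
  assume "\<exists>w. (\<forall>i<n. \<forall>j<n. comb n (w i) v j = idm i j) \<and> (\<forall>i<n. \<forall>j<n. comb n (v i) w j = idm i j)"
  then obtain w where w: "\<forall>i<n. \<forall>j<n. comb n (w i) v j = idm i j" "\<forall>i<n. \<forall>j<n. comb n (v i) w j = idm i j"
    by (elim exE conjE)
  show "row_basis n v"
  proof (rule row_basisI)
    fix x :: "nat \<Rightarrow> 'a"
    have "comb n (comb n x w) v j = x j" if "j < n" for j
    proof -
      have "comb n (comb n x w) v j = comb n x idm j"
        unfolding comb_comb using w that by (intro comb_cong) auto
      then show ?thesis using that by (simp add: comb_idm)
    qed
    then have "\<forall>j<n. comb n (comb n x w) v j = x j" by simp
    then show "\<exists>l. \<forall>j<n. comb n l v j = x j" by (intro exI)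
  next
    fix l i assume l: "\<And>j. j < n \<Longrightarrow> comb n l v j = 0" and i: "i < n"
    have "comb n (comb n l v) w i = comb n l idm i"
      unfolding comb_comb using w i by (intro comb_cong) auto
    moreover have "comb n (comb n l v) w i = 0" unfolding comb_def[of n "comb n l v"] using l by simp
    ultimately show "l i = 0" using i by (simp add: comb_idm)
  qed
qed

section \<open>Translation between matrices and stable matrices, and the group structure of
  \<open>GL\<close>\<close>

definition corner :: "nat \<Rightarrow> (nat \<Rightarrow> nat \<Rightarrow> 'a) \<Rightarrow> 'a mat" where
  "corner n v = mat n n (\<lambda>(i, j). v i j)"

lemma corner_carrier [simp]: "corner n v \<in> carrier_mat n n"
  by (simp add: corner_def)

lemma corner_index [simp]: "i < n \<Longrightarrow> j < n \<Longrightarrow> corner n v $$ (i, j) = v i j"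
  by (simp add: corner_def)

lemma corner_stab: "A \<in> carrier_mat n n \<Longrightarrow> corner n (stab A) = A"
  by (intro eq_matI) (auto simp: stab_def corner_def)

lemma corner_eqI: "(\<And>i j. i < n \<Longrightarrow> j < n \<Longrightarrow> v i j = w i j) \<Longrightarrow> corner n v = corner n w"
  by (intro eq_matI) (auto simp: corner_def)

lemma corner_mult: "corner n v * corner n w = corner n (\<lambda>i. comb n (v i) w)"
  by (intro eq_matI) (auto simp: corner_def scalar_prod_def comb_def lessThan_atLeast0)

lemma corner_idm: "corner n idm = 1\<^sub>m n"
  by (intro eq_matI) (auto simp: corner_def idm_def)

lemma corner_eqD: "corner n v = corner n w \<Longrightarrow> i < n \<Longrightarrow> j < n \<Longrightarrow> v i j = w i j"
  by (metis corner_index)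

lemma corner_in_GLn: "corner n v \<in> carrier (GLn n) \<longleftrightarrow> row_basis n v"
proof
  assume "corner n v \<in> carrier (GLn n)"
  then obtain B where B: "B \<in> carrier_mat n n" "corner n v * B = 1\<^sub>m n" "B * corner n v = 1\<^sub>m n"
    by (auto simp: GLn_def units_of_def Units_def ring_mat_simps)
  define w where "w = stab B"
  have "B = corner n w" using B(1) by (simp add: w_def corner_stab)
  with B have "corner n (\<lambda>i. comb n (w i) v) = corner n idm" "corner n (\<lambda>i. comb n (v i) w) = corner n idm"
    by (simp_all add: corner_mult corner_idm)
  then have "(\<forall>i<n. \<forall>j<n. comb n (w i) v j = idm i j) \<and> (\<forall>i<n. \<forall>j<n. comb n (v i) w j = idm i j)"
    by (auto dest: corner_eqD)
  then show "row_basis n v" unfolding row_basis_iff_inverse by (intro exI)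
next
  assume "row_basis n v"
  then obtain w where "\<forall>i<n. \<forall>j<n. comb n (w i) v j = idm i j" "\<forall>i<n. \<forall>j<n. comb n (v i) w j = idm i j"
    unfolding row_basis_iff_inverse by (elim exE conjE)
  then have "corner n w * corner n v = 1\<^sub>m n" "corner n v * corner n w = 1\<^sub>m n"
    unfolding corner_mult corner_idm[symmetric] by (auto intro: corner_eqI)
  then show "corner n v \<in> carrier (GLn n)"
    by (auto simp: GLn_def units_of_def Units_def ring_mat_simps intro!: bexI[of _ "corner n w"])
qed

lemma GLn_carrier_mat: "A \<in> carrier (GLn n) \<Longrightarrow> A \<in> carrier_mat n n"
  by (auto simp: GLn_def units_of_def Units_def ring_mat_simps)

lemma stab_corner: "v \<in> GLs n \<Longrightarrow> stab (corner n v) = v"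
  by (auto simp: stab_def fun_eq_iff GLs_outside corner_def)

lemma stab_in_GLs:
  assumes "A \<in> carrier (GLn n)"
  shows "stab A \<in> GLs n"
proof -
  have A: "A \<in> carrier_mat n n" by (rule GLn_carrier_mat[OF assms])
  have "row_basis n (stab A)" using assms by (simp add: corner_stab[OF A] flip: corner_in_GLn)
  then show ?thesis using A by (auto simp: GLs_def stab_def)
qed

lemma corner_GLs: "v \<in> GLs n \<Longrightarrow> corner n v \<in> carrier (GLn n)"
  by (simp add: corner_in_GLn GLs_row_basis)

lemma GLs_eq: "GLs n = stab ` carrier (GLn n)"
proof
  show "GLs n \<subseteq> stab ` carrier (GLn n)"
    using stab_corner corner_GLs by (metis image_eqI subsetI)
qed (auto intro: stab_in_GLs)

lemma carrier_GL: "carrier GL = (\<Union>n. GLs n)"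
  by (simp add: GL_def GLs_eq)

lemma one_GL: "\<one>\<^bsub>GL\<^esub> = idm"
  by (simp add: GL_def idm_def)

lemma GL_mult:
  assumes "v \<in> GLs n"
  shows "v \<otimes>\<^bsub>GL\<^esub> w = (\<lambda>i. if i < n then comb n (v i) w else w i)"
proof (intro ext)
  fix i j
  show "(v \<otimes>\<^bsub>GL\<^esub> w) i j = (if i < n then comb n (v i) w else w i) j"
  proof (cases "i < n")
    case True
    have "{k. v i k \<noteq> 0} \<subseteq> {..<n}"
      using GLs_outside[OF assms] True by (auto simp: not_less) (metis not_less)
    then have "(\<Sum>k | v i k \<noteq> 0. v i k * w k j) = (\<Sum>k<n. v i k * w k j)"
      by (intro sum.mono_neutral_left) auto
    then show ?thesis using True by (simp add: GL_def comb_def)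
  next
    case False
    then have "v i k = (if i = k then 1 else 0)" for k using GLs_outside[OF assms] by simp
    then show ?thesis using False by (simp add: GL_def)
  qed
qed

lemma row_basis_idm: "row_basis n idm"
  unfolding row_basis_iff_inverse by (rule exI[of _ idm]) (simp add: comb_unit)

lemma idm_GLs: "idm \<in> GLs n"
  by (simp add: GLs_def row_basis_idm) (simp add: idm_def)

lemma GLs_mult_closed:
  assumes "v \<in> GLs n" "w \<in> GLs n"
  shows "v \<otimes>\<^bsub>GL\<^esub> w \<in> GLs n"
proof -
  interpret semiring "ring_mat TYPE('a) n ()" by (rule semiring_mat)
  interpret group "GLn n :: 'a mat monoid" unfolding GLn_def by (rule units_group)
  have "corner n v * corner n w \<in> carrier (GLn n)"
    using m_closed[OF corner_GLs[OF assms(1)] corner_GLs[OF assms(2)]]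
    by (simp add: GLn_def units_of_def ring_mat_simps)
  then have "row_basis n (\<lambda>i. comb n (v i) w)" by (simp add: corner_mult corner_in_GLn)
  then have "row_basis n (v \<otimes>\<^bsub>GL\<^esub> w)"
    using row_basis_cong[of n "\<lambda>i. comb n (v i) w" "v \<otimes>\<^bsub>GL\<^esub> w"] by (simp add: GL_mult[OF assms(1)])
  moreover have "comb n (v i) w j = 0" if "i < n" "n \<le> j" for i j
    using GLs_outside[OF assms(2)] that by (simp add: comb_def)
  ultimately show ?thesis
    using GLs_outside[OF assms(2)] by (auto simp: GLs_def GL_mult[OF assms(1)])
qed

lemma GLs_inverse:
  assumes "v \<in> GLs n"
  shows "\<exists>w\<in>GLs n. w \<otimes>\<^bsub>GL\<^esub> v = idm \<and> v \<otimes>\<^bsub>GL\<^esub> w = idm"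
proof -
  obtain w where w: "\<forall>i<n. \<forall>j<n. comb n (w i) v j = idm i j" "\<forall>i<n. \<forall>j<n. comb n (v i) w j = idm i j"
    using GLs_row_basis[OF assms] unfolding row_basis_iff_inverse by (elim exE conjE)
  define w' where "w' = (\<lambda>i j. if i < n \<and> j < n then w i j else idm i j)"
  have eq: "comb n (w' i) v j = comb n (w i) v j" "comb n (v i) w' j = comb n (v i) w j"
    if "i < n" "j < n" for i j
    using that by (auto simp: w'_def intro!: comb_cong)
  have "(\<forall>i<n. \<forall>j<n. comb n (v i) w' j = idm i j) \<and> (\<forall>i<n. \<forall>j<n. comb n (w' i) v j = idm i j)"
    using w eq by simp
  then have "row_basis n w'" unfolding row_basis_iff_inverse by (intro exI)
  then have w': "w' \<in> GLs n" by (auto simp: GLs_def w'_def idm_def)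
  have idm: "x \<otimes>\<^bsub>GL\<^esub> y = idm"
    if x: "x \<in> GLs n" and y: "y \<in> GLs n" and xy: "\<And>i j. i < n \<Longrightarrow> j < n \<Longrightarrow> comb n (x i) y j = idm i j"
    for x y :: "nat \<Rightarrow> nat \<Rightarrow> 'a"
  proof (intro ext)
    fix i j
    have "comb n (x i) y j = 0" if "n \<le> j"
      using GLs_outside[OF y] that by (simp add: comb_def)
    then show "(x \<otimes>\<^bsub>GL\<^esub> y) i j = idm i j"
      unfolding GL_mult[OF x] using xy GLs_outside[OF y, of i j]
      by (cases "i < n"; cases "j < n") (auto simp: idm_def)
  qed
  show ?thesis
    by (intro bexI[OF _ w'] conjI idm w' assms) (use w eq in auto)
qed

text \<open>The inverse in \<open>GLs n\<close> also inverts the larger corner, whose additional row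
  is a coordinate vector.\<close>

lemma GLs_Suc: "GLs n \<subseteq> GLs (Suc n)"
proof
  fix v :: "nat \<Rightarrow> nat \<Rightarrow> 'a" assume v: "v \<in> GLs n"
  obtain w where w: "w \<in> GLs n" "w \<otimes>\<^bsub>GL\<^esub> v = idm" "v \<otimes>\<^bsub>GL\<^esub> w = idm"
    using GLs_inverse[OF v] by (elim bexE conjE)
  have step: "comb (Suc n) (x i) y j = (x \<otimes>\<^bsub>GL\<^esub> y) i j" if "x \<in> GLs n" "i < Suc n" for x y :: "nat \<Rightarrow> nat \<Rightarrow> 'a" and i j
  proof (cases "i = n")
    case True
    then have "x i = idm n" using GLs_outside[OF that(1)] by (auto simp: idm_def fun_eq_iff)
    then show ?thesis using comb_unit[of n "Suc n" y j] True by (simp add: GL_mult[OF that(1)])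
  next
    case False
    then have "i < n" using that by simp
    then show ?thesis using GLs_outside[OF that(1), of i n] by (simp add: comb_def GL_mult[OF that(1)])
  qed
  have "(\<forall>i<Suc n. \<forall>j<Suc n. comb (Suc n) (w i) v j = idm i j) \<and> (\<forall>i<Suc n. \<forall>j<Suc n. comb (Suc n) (v i) w j = idm i j)"
    using step[OF w(1)] step[OF v] w(2,3) by simp
  then have "row_basis (Suc n) v" unfolding row_basis_iff_inverse by (intro exI)
  then show "v \<in> GLs (Suc n)" using GLs_outside[OF v] by (simp add: GLs_def)
qed

lemma GLs_mono: "n \<le> m \<Longrightarrow> GLs n \<subseteq> GLs m"
  by (rule lift_Suc_mono_le[of GLs, OF GLs_Suc])

lemma GLs_common: "v \<in> GLs n \<Longrightarrow> w \<in> GLs m \<Longrightarrow> v \<in> GLs (max 1 (max n m)) \<and> w \<in> GLs (max 1 (max n m))"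
  by (intro conjI; erule subsetD[OF GLs_mono, rotated]; simp)

lemma GL_assoc:
  assumes "u \<in> GLs n" "v \<in> GLs n"
  shows "u \<otimes>\<^bsub>GL\<^esub> v \<otimes>\<^bsub>GL\<^esub> w = u \<otimes>\<^bsub>GL\<^esub> (v \<otimes>\<^bsub>GL\<^esub> w)"
proof (intro ext)
  fix i j
  have "comb n (comb n (u i) v) w j = comb n (u i) (\<lambda>r. comb n (v r) w) j" by (rule comb_comb)
  also have "\<dots> = comb n (u i) (v \<otimes>\<^bsub>GL\<^esub> w) j" by (intro comb_cong) (auto simp: GL_mult[OF assms(2)])
  finally have *: "comb n (comb n (u i) v) w j = comb n (u i) (v \<otimes>\<^bsub>GL\<^esub> w) j" .
  have "(u \<otimes>\<^bsub>GL\<^esub> v \<otimes>\<^bsub>GL\<^esub> w) i j = (if i < n then comb n ((u \<otimes>\<^bsub>GL\<^esub> v) i) w else w i) j"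
    by (simp only: GL_mult[OF GLs_mult_closed[OF assms], of w])
  also have "\<dots> = (if i < n then comb n (u i) (v \<otimes>\<^bsub>GL\<^esub> w) j else (v \<otimes>\<^bsub>GL\<^esub> w) i j)"
    using * by (simp add: GL_mult[OF assms(1), of v] GL_mult[OF assms(2)])
  also have "\<dots> = (u \<otimes>\<^bsub>GL\<^esub> (v \<otimes>\<^bsub>GL\<^esub> w)) i j"
    by (simp add: GL_mult[OF assms(1)])
  finally show "(u \<otimes>\<^bsub>GL\<^esub> v \<otimes>\<^bsub>GL\<^esub> w) i j = (u \<otimes>\<^bsub>GL\<^esub> (v \<otimes>\<^bsub>GL\<^esub> w)) i j" .
qed

lemma group_GL: "group GL"
proof (rule groupI)
  fix x y :: "nat \<Rightarrow> nat \<Rightarrow> 'a" assume "x \<in> carrier GL" "y \<in> carrier GL"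
  then obtain n m where "x \<in> GLs n" "y \<in> GLs m" by (auto simp: carrier_GL)
  from GLs_common[OF this] show "x \<otimes>\<^bsub>GL\<^esub> y \<in> carrier GL"
    using GLs_mult_closed unfolding carrier_GL by (metis UN_I UNIV_I)
next
  show "\<one>\<^bsub>GL\<^esub> \<in> carrier (GL :: (nat \<Rightarrow> nat \<Rightarrow> 'a) monoid)"
    using idm_GLs by (auto simp: carrier_GL one_GL)
next
  fix x y z :: "nat \<Rightarrow> nat \<Rightarrow> 'a" assume "x \<in> carrier GL" "y \<in> carrier GL"
  then obtain n m where "x \<in> GLs n" "y \<in> GLs m" by (auto simp: carrier_GL)
  from GLs_common[OF this] show "x \<otimes>\<^bsub>GL\<^esub> y \<otimes>\<^bsub>GL\<^esub> z = x \<otimes>\<^bsub>GL\<^esub> (y \<otimes>\<^bsub>GL\<^esub> z)"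
    by (elim conjE) (rule GL_assoc)
next
  fix x :: "nat \<Rightarrow> nat \<Rightarrow> 'a" assume "x \<in> carrier GL"
  then show "\<one>\<^bsub>GL\<^esub> \<otimes>\<^bsub>GL\<^esub> x = x"
    by (auto simp: one_GL GL_mult[OF idm_GLs[of 0]])
next
  fix x :: "nat \<Rightarrow> nat \<Rightarrow> 'a" assume "x \<in> carrier GL"
  then obtain n where "x \<in> GLs n" by (auto simp: carrier_GL)
  from GLs_inverse[OF this] obtain y where "y \<in> GLs n" "y \<otimes>\<^bsub>GL\<^esub> x = idm"
    by (elim bexE conjE)
  then show "\<exists>y\<in>carrier GL. y \<otimes>\<^bsub>GL\<^esub> x = \<one>\<^bsub>GL\<^esub>"
    by (intro bexI[of _ y]) (auto simp: carrier_GL one_GL)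
qed

section \<open>Gaussian elimination\<close>

lemma row_add_GLs:
  assumes "v \<in> GLs n" "i < n" "k < n" "i \<noteq> k"
  shows "row_add i k t v \<in> GLs n"
  using row_basis_row_add[OF GLs_row_basis[OF assms(1)] assms(2-4)] GLs_outside[OF assms(1)] assms(2-4)
  by (auto simp: GLs_def row_add_def)

lemma row_scale_GLs:
  assumes "v \<in> GLs n" "i < n" "t \<noteq> (0::'a::division_ring)"
  shows "row_scale i t v \<in> GLs n"
  using row_basis_row_scale[OF GLs_row_basis[OF assms(1)] assms(2-3)] GLs_outside[OF assms(1)] assms(2-3)
  by (auto simp: GLs_def row_scale_def)

lemma sdiag_GLs: "n \<ge> 1 \<Longrightarrow> d \<noteq> (0::'a::division_ring) \<Longrightarrow> sdiag d \<in> GLs n"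
  unfolding sdiag_def by (intro row_scale_GLs idm_GLs) auto

text \<open>One round of elimination, phrased as an induction rule for properties that can be pulled
  back along row additions. Because of \<open>1 \<le> m\<close> there is a second row, and row
  additions suffice to give the last row and column the form they have in the identity.\<close>

lemma row_reduce_step:
  fixes P :: "(nat \<Rightarrow> nat \<Rightarrow> 'a::division_ring) \<Rightarrow> bool"
  assumes m: "1 \<le> m"
    and step: "\<And>v i k t. v \<in> GLs (Suc m) \<Longrightarrow> i \<le> m \<Longrightarrow> k \<le> m \<Longrightarrow> i \<noteq> k \<Longrightarrow> P (row_add i k t v) \<Longrightarrow> P v"
    and small: "\<And>v. v \<in> GLs m \<Longrightarrow> P v" and v: "v \<in> GLs (Suc m)"
  shows "P v"
proof -
  let ?e = "\<lambda>j. if j = m then 1 else 0 :: 'a"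
  \<comment> \<open>Multiples of the last row, a coordinate vector, clear the last column.\<close>
  have clear_column: "P v" if v: "v \<in> GLs (Suc m)" and row: "\<And>j. v m j = ?e j" for v
  proof -
    define w where "w q = (\<lambda>i j. if i < q then v i j - v i m * ?e j else v i j)" for q
    have "w q \<in> GLs (Suc m) \<and> (P (w q) \<longrightarrow> P v)" if "q \<le> m" for q
      using that
    proof (induction q)
      case 0
      then show ?case using v by (simp add: w_def)
    next
      case (Suc q)
      have "w (Suc q) = row_add q m (- v q m) (w q)"
        using Suc.prems row by (auto simp: w_def row_add_def fun_eq_iff)
      then show ?case using Suc step[of "w q" q m "- v q m"] row_add_GLs[of "w q" "Suc m" q m] by auto
    qed
    from this[of m] have wm: "w m \<in> GLs (Suc m)" "P (w m) \<longrightarrow> P v" by auto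
    have "comb (Suc m) ?e (w m) j = w m m j" for j by (simp add: comb_def)
    then have "pivot m (w m) ?e m" using row by (simp add: pivot_def w_def)
    from row_basis_minor[OF GLs_row_basis[OF wm(1)] this] have "row_basis m (w m)" by simp
    moreover have "w m i j = (if i = j then 1 else 0)" if "m \<le> i \<or> m \<le> j" for i j
      using that row GLs_outside[OF v, of i j] by (cases "i = m"; cases "j = m") (auto simp: w_def not_le)
    ultimately have "w m \<in> GLs m" by (simp add: GLs_def)
    then show ?thesis using small wm(2) by blast
  qed
  \<comment> \<open>If the last coefficient is 1, adding the other multiples to the last row makes
    it the coordinate vector.\<close>
  have unit_coeff: "P v" if v: "v \<in> GLs (Suc m)" and l: "\<forall>j\<le>m. comb (Suc m) l v j = ?e j" "l m = 1" for v l
  proof -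
    define u where "u q = v(m := \<lambda>j. v m j + (\<Sum>r<q. l r * v r j))" for q
    have "u q \<in> GLs (Suc m) \<and> (P (u q) \<longrightarrow> P v)" if "q \<le> m" for q
      using that
    proof (induction q)
      case 0
      then show ?case using v by (simp add: u_def)
    next
      case (Suc q)
      have "u (Suc q) = row_add m q (l q) (u q)"
        using Suc.prems by (auto simp: u_def row_add_def fun_eq_iff add.assoc)
      then show ?case using Suc step[of "u q" m q "l q"] row_add_GLs[of "u q" "Suc m" m q] by auto
    qed
    from this[of m] have um: "u m \<in> GLs (Suc m)" "P (u m) \<longrightarrow> P v" by auto
    have "u m m j = ?e j" for j
    proof (cases "j \<le> m")
      case True
      have "u m m j = comb (Suc m) l v j" by (simp add: u_def comb_def l(2) add.commute)
      then show ?thesis using l(1) True by simp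
    next
      case False
      then show ?thesis using GLs_outside[OF um(1), of m j] by auto
    qed
    then show ?thesis using clear_column[OF um(1)] um(2) by blast
  qed
  \<comment> \<open>With a nonzero coefficient at some \<open>i < m\<close>, adding a multiple of
    row \<open>m\<close> to row \<open>i\<close> adjusts \<open>l m\<close> to 1.\<close>
  have upper_coeff: "P v" if v: "v \<in> GLs (Suc m)" and l: "\<forall>j\<le>m. comb (Suc m) l v j = ?e j" and i: "i < m" "l i \<noteq> 0" for v l i
  proof -
    define t where "t = inverse (l i) * (l m - 1)"
    have lt: "l i * t = l m - 1" using i(2) by (simp add: t_def flip: mult.assoc)
    show ?thesis
    proof (rule step[of v i m t])
      show "P (row_add i m t v)"
      proof (rule unit_coeff)
        show "row_add i m t v \<in> GLs (Suc m)" using v i by (intro row_add_GLs) auto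
        show "\<forall>j\<le>m. comb (Suc m) (l(m := l m - l i * t)) (row_add i m t v) j = ?e j"
          using l i comb_row_add[of i "Suc m" m l t v] by simp
        show "(l(m := l m - l i * t)) m = 1" by (simp add: lt)
      qed
    qed (use v i in auto)
  qed
  obtain l k where p: "pivot m v l k" using pivot_exists[OF GLs_row_basis[OF v]] by (elim exE)
  then have l: "\<forall>j\<le>m. comb (Suc m) l v j = ?e j" and k: "k \<le> m" "l k \<noteq> 0" by (auto simp: pivot_def)
  show ?thesis
  proof (cases "k < m")
    case True
    then show ?thesis using upper_coeff[OF v l] k by blast
  next
    case km: False
    show ?thesis
    proof (cases "l 0 = 0")
      case False
      then show ?thesis using upper_coeff[OF v l, of 0] m by simp
    next
      case True
      \<comment> \<open>Adding row 0 to row \<open>m\<close> changes the coefficient of row 0 from 0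
        to \<open>- l m\<close>, which reduces to the previous case.\<close>
      show ?thesis
      proof (rule step[of v m 0 1])
        show "P (row_add m 0 1 v)"
        proof (rule upper_coeff)
          show "row_add m 0 1 v \<in> GLs (Suc m)" using v m by (intro row_add_GLs) auto
          show "\<forall>j\<le>m. comb (Suc m) (l(0 := l 0 - l m * 1)) (row_add m 0 1 v) j = ?e j"
            using l m comb_row_add[of m "Suc m" 0 l 1 v] by simp
          show "0 < m" "(l(0 := l 0 - l m * 1)) 0 \<noteq> 0" using m k km True by auto
        qed
      qed (use v m in auto)
    qed
  qed
qed

text \<open>Row additions lead from any element to some \<open>sdiag d\<close>; size 1, which admits
  no row additions, already has this form.\<close>

lemma row_reduce_induct:
  fixes P :: "(nat \<Rightarrow> nat \<Rightarrow> 'a::division_ring) \<Rightarrow> bool"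
  assumes n: "1 \<le> n" and v: "v \<in> GLs n"
    and step: "\<And>v i k t. v \<in> GLs n \<Longrightarrow> i < n \<Longrightarrow> k < n \<Longrightarrow> i \<noteq> k \<Longrightarrow> P (row_add i k t v) \<Longrightarrow> P v"
    and base: "\<And>d. d \<noteq> 0 \<Longrightarrow> P (sdiag d)"
  shows "P v"
proof -
  have "P v" if "m \<ge> 1" "m \<le> n" "v \<in> GLs m" for m v
    using that
  proof (induction m arbitrary: v rule: dec_induct)
    case base1: base
    have "\<exists>l. \<forall>j<1. comb 1 l v j = (\<lambda>_. 1) j" by (rule row_basis_span[OF GLs_row_basis[OF base1(2)]])
    then have "v 0 0 \<noteq> 0" by (auto simp: comb_def)
    moreover have "v = sdiag (v 0 0)"
      using GLs_outside[OF base1(2)] by (auto simp: sdiag_def row_scale_def idm_def fun_eq_iff)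
    ultimately show ?case using base by metis
  next
    case (step m)
    show ?case
    proof (rule row_reduce_step[of m P v])
      fix v i k and t :: 'a
      assume "v \<in> GLs (Suc m)" "i \<le> m" "k \<le> m" "i \<noteq> k" "P (row_add i k t v)"
      then show "P v" using assms(3)[of v i k t] GLs_mono[OF step.prems(1)] step.prems(1) by auto
    qed (use step in auto)
  qed
  then show ?thesis using n v by blast
qed


section \<open>Abelian quotients of the general linear group\<close>

text \<open>Row operations are multiplications from the left and so commute with those from the
  right.\<close>

lemma GL_mult_row_add:
  assumes "v \<in> GLs n" "i < n" "k < n" "i \<noteq> k"
  shows "row_add i k t v \<otimes>\<^bsub>GL\<^esub> w = row_add i k t (v \<otimes>\<^bsub>GL\<^esub> w)"
proof -
  have "comb n (\<lambda>j. v i j + t * v k j) w j = comb n (v i) w j + t * comb n (v k) w j" for j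
    by (simp add: comb_def distrib_right sum.distrib sum_distrib_left mult.assoc)
  then show ?thesis
    unfolding GL_mult[OF row_add_GLs[OF assms]] GL_mult[OF assms(1)]
    using assms(2-4) by (auto simp: row_add_def fun_eq_iff)
qed

lemma GL_mult_row_scale:
  assumes "v \<in> GLs n" "i < n" "t \<noteq> (0::'a::division_ring)"
  shows "row_scale i t v \<otimes>\<^bsub>GL\<^esub> w = row_scale i t (v \<otimes>\<^bsub>GL\<^esub> w)"
proof -
  have "comb n (\<lambda>j. t * v i j) w j = t * comb n (v i) w j" for j by (rule comb_mult)
  then show ?thesis
    unfolding GL_mult[OF row_scale_GLs[OF assms]] GL_mult[OF assms(1)]
    using assms(2) by (auto simp: row_scale_def fun_eq_iff)
qed

lemma idm_mult: "idm \<otimes>\<^bsub>GL\<^esub> w = w"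
  by (auto simp: GL_mult[OF idm_GLs[of 0]])

lemma sdiag_mult:
  assumes "d \<noteq> (0::'a::division_ring)"
  shows "sdiag d \<otimes>\<^bsub>GL\<^esub> w = row_scale 0 d w"
  unfolding sdiag_def using GL_mult_row_scale[OF idm_GLs, of 0 1 d w] assms by (simp add: idm_mult)

context abelian_character
begin

lemma D_idm: "D n idm = \<one>"
proof (induction n)
  case (Suc n)
  then show ?case using D_Suc_unit_row[OF row_basis_idm, of n] by (auto simp: idm_def)
qed simp

lemma D_sdiag: "1 \<le> n \<Longrightarrow> d \<noteq> 0 \<Longrightarrow> D n (sdiag d) = \<chi> d"
  unfolding sdiag_def using D_row_scale[OF row_basis_idm, of 0 n d] by (simp add: D_idm)

text \<open>A row addition in \<open>v\<close> changes neither side; what remains is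
  \<open>sdiag d\<close>, which scales the first row of \<open>w\<close>.\<close>

lemma D_mult:
  assumes n: "1 \<le> n" and v: "v \<in> GLs n" and w: "w \<in> GLs n"
  shows "D n (v \<otimes>\<^bsub>GL\<^esub> w) = D n v \<otimes> D n w"
  using n v
proof (rule row_reduce_induct)
  fix v i k t assume v: "v \<in> GLs n" "i < n" "k < n" "i \<noteq> k"
    and eq: "D n (row_add i k t v \<otimes>\<^bsub>GL\<^esub> w) = D n (row_add i k t v) \<otimes> D n w"
  then show "D n (v \<otimes>\<^bsub>GL\<^esub> w) = D n v \<otimes> D n w"
    using D_row_add[OF GLs_row_basis[OF GLs_mult_closed[OF v(1) w]] v(2-4), of t]
      D_row_add[OF GLs_row_basis[OF v(1)] v(2-4), of t] by (simp add: GL_mult_row_add)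
next
  fix d :: 'a assume "d \<noteq> 0"
  then show "D n (sdiag d \<otimes>\<^bsub>GL\<^esub> w) = D n (sdiag d) \<otimes> D n w"
    using n D_row_scale[OF GLs_row_basis[OF w], of 0 d] by (simp add: sdiag_mult D_sdiag)
qed

lemma D_stable:
  assumes "v \<in> GLs n" "n \<le> m"
  shows "D m v = D n v"
  using assms(2)
proof (induction m rule: dec_induct)
  case (step m)
  have "v \<in> GLs (Suc m)" using subsetD[OF GLs_mono assms(1)] step(1) by simp
  then show ?case
    using D_Suc_unit_row[OF GLs_row_basis, of v m] GLs_outside[OF assms(1), of m] step by auto
qed simp

text \<open>Any admissible size gives the same value by \<open>D_stable\<close>; the least one
  merely fixes the definition.\<close>

definition GL_det :: "(nat \<Rightarrow> nat \<Rightarrow> 'a) \<Rightarrow> 'b" where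
  "GL_det v = D (LEAST n. v \<in> GLs n) v"

lemma GL_det_eq: "v \<in> GLs n \<Longrightarrow> GL_det v = D n v"
  unfolding GL_det_def using D_stable[of v "LEAST n. v \<in> GLs n" n] LeastI[of "\<lambda>n. v \<in> GLs n" n]
    Least_le[of "\<lambda>n. v \<in> GLs n" n] by simp

lemma GL_det_hom: "GL_det \<in> hom GL G"
proof (rule homI)
  fix v :: "nat \<Rightarrow> nat \<Rightarrow> 'a" assume "v \<in> carrier GL"
  then obtain n where "v \<in> GLs n" by (auto simp: carrier_GL)
  then show "GL_det v \<in> carrier G" by (simp add: GL_det_eq GLs_row_basis)
next
  fix v w :: "nat \<Rightarrow> nat \<Rightarrow> 'a" assume "v \<in> carrier GL" "w \<in> carrier GL"
  then obtain n m where "v \<in> GLs n" "w \<in> GLs m" by (auto simp: carrier_GL)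
  from GLs_common[OF this] obtain k where k: "1 \<le> k" "v \<in> GLs k" "w \<in> GLs k"
    by (metis max.cobounded1)
  then show "GL_det (v \<otimes>\<^bsub>GL\<^esub> w) = GL_det v \<otimes> GL_det w"
    using GL_det_eq[OF GLs_mult_closed[OF k(2,3)]] by (simp add: GL_det_eq D_mult)
qed

end

section \<open>Homomorphisms from \<open>GLs n\<close> to commutative groups\<close>

context infinite_division_ring
begin

lemma exists_scalar_not_0_1: "\<exists>a::'a. a \<noteq> 0 \<and> a \<noteq> 1"
  using ex_new_if_finite[OF infinite_scalars, of "{0, 1}"] by auto

text \<open>Transvections are commutators: conjugation by a diagonal matrix rescales the parameter of a
  transvection by an arbitrary \<open>a \<noteq> 0, 1\<close>.\<close>

lemma GLs_hom_row_add:
  fixes \<omega> :: "(nat \<Rightarrow> nat \<Rightarrow> 'a) \<Rightarrow> 'b"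
  assumes "comm_group H" and closed: "\<And>v. v \<in> GLs n \<Longrightarrow> \<omega> v \<in> carrier H"
    and mult: "\<And>v w. v \<in> GLs n \<Longrightarrow> w \<in> GLs n \<Longrightarrow> \<omega> (v \<otimes>\<^bsub>GL\<^esub> w) = \<omega> v \<otimes>\<^bsub>H\<^esub> \<omega> w"
    and v: "v \<in> GLs n" and ik: "i < n" "k < n" "i \<noteq> k"
  shows "\<omega> (row_add i k t v) = \<omega> v"
proof -
  interpret comm_group H by fact
  obtain a :: 'a where a: "a \<noteq> 0" "a \<noteq> 1" using exists_scalar_not_0_1 by (elim exE conjE)
  define E where "E s = row_add i k s (idm :: nat \<Rightarrow> nat \<Rightarrow> 'a)" for s
  define d where "d = row_scale i a (idm :: nat \<Rightarrow> nat \<Rightarrow> 'a)"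
  have E: "E s \<in> GLs n" for s unfolding E_def by (intro row_add_GLs idm_GLs ik)
  have d: "d \<in> GLs n" unfolding d_def by (intro row_scale_GLs idm_GLs ik a)
  have E_mult: "E s \<otimes>\<^bsub>GL\<^esub> w = row_add i k s w" for s w
    unfolding E_def by (simp add: GL_mult_row_add[OF idm_GLs ik] idm_mult)
  \<comment> \<open>Chosen such that \<open>a * s - s = t\<close>.\<close>
  define s where "s = inverse (a - 1) * t"
  have as: "a * s = t + s"
  proof -
    have "(a - 1) * s = t" using a by (simp add: s_def flip: mult.assoc)
    then show ?thesis by (simp add: algebra_simps)
  qed
  \<comment> \<open>Conjugation by \<open>d\<close> sends \<open>E s\<close> to
    \<open>E (a * s)\<close>, so the commutator of \<open>d\<close> and \<open>E s\<close> is
    \<open>E t\<close>.\<close>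
  have "d \<otimes>\<^bsub>GL\<^esub> E s = E (a * s) \<otimes>\<^bsub>GL\<^esub> d"
  proof -
    have "d \<otimes>\<^bsub>GL\<^esub> E s = row_scale i a (E s)"
      unfolding d_def by (simp add: GL_mult_row_scale[OF idm_GLs ik(1) a(1)] idm_mult)
    also have "\<dots> = row_add i k (a * s) d"
      using ik by (auto simp: E_def d_def row_scale_def row_add_def fun_eq_iff algebra_simps)
    finally show ?thesis by (simp add: E_mult)
  qed
  then have "\<omega> d \<otimes>\<^bsub>H\<^esub> \<omega> (E s) = \<omega> (E (a * s)) \<otimes>\<^bsub>H\<^esub> \<omega> d"
    using mult[OF d E] mult[OF E d] by metis
  then have "\<omega> (E s) = \<omega> (E (a * s))"
    using closed[OF d] closed[OF E] by (simp add: m_comm[of "\<omega> (E (a * s))"])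
  moreover have "E (a * s) = E t \<otimes>\<^bsub>GL\<^esub> E s"
    unfolding E_mult as using ik by (auto simp: E_def row_add_def fun_eq_iff algebra_simps)
  ultimately have "\<omega> (E t) \<otimes>\<^bsub>H\<^esub> \<omega> (E s) = \<one>\<^bsub>H\<^esub> \<otimes>\<^bsub>H\<^esub> \<omega> (E s)"
    using mult[OF E E] closed[OF E] by simp
  then have "\<omega> (E t) = \<one>\<^bsub>H\<^esub>" using closed[OF E] by simp
  then show ?thesis using mult[OF E v] closed[OF v] by (simp add: E_mult)
qed

text \<open>Invariance under row additions leaves only the character on the \<open>sdiag d\<close>.
  Expressing \<open>\<omega>\<close> through this character and \<open>ddet\<close> is what allows
  an extension from size \<open>n\<close>, even from \<open>n = 1\<close>, to all sizes.\<close>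

lemma GLs_hom_sdiag:
  fixes \<omega> :: "(nat \<Rightarrow> nat \<Rightarrow> 'a) \<Rightarrow> 'b"
  assumes H: "comm_group H" and closed: "\<And>v. v \<in> GLs n \<Longrightarrow> \<omega> v \<in> carrier H"
    and mult: "\<And>v w. v \<in> GLs n \<Longrightarrow> w \<in> GLs n \<Longrightarrow> \<omega> (v \<otimes>\<^bsub>GL\<^esub> w) = \<omega> v \<otimes>\<^bsub>H\<^esub> \<omega> w"
    and n: "1 \<le> n"
  shows "abelian_character H (\<lambda>d. \<omega> (sdiag d))"
    and "v \<in> GLs n \<Longrightarrow> \<omega> v = \<omega> (sdiag (ddet n v))"
proof -
  interpret comm_group H by fact
  show char: "abelian_character H (\<lambda>d. \<omega> (sdiag d))"
  proof
    fix x y :: 'a assume xy: "x \<noteq> 0" "y \<noteq> 0"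
    have "sdiag (x * y) = sdiag x \<otimes>\<^bsub>GL\<^esub> sdiag y"
      unfolding sdiag_mult[OF xy(1)] by (auto simp: sdiag_def row_scale_def mult.assoc)
    then show "\<omega> (sdiag (x * y)) = \<omega> (sdiag x) \<otimes>\<^bsub>H\<^esub> \<omega> (sdiag y)"
      using mult[OF sdiag_GLs[OF n xy(1)] sdiag_GLs[OF n xy(2)]] by simp
  qed (rule closed[OF sdiag_GLs[OF n]])
  interpret abelian_character H "\<lambda>d. \<omega> (sdiag d)" by (rule char)
  show "\<omega> v = \<omega> (sdiag (ddet n v))" if "v \<in> GLs n"
    using n that
  proof (rule row_reduce_induct)
    fix v i k t assume v: "v \<in> GLs n" "i < n" "k < n" "i \<noteq> k"
      and eq: "\<omega> (row_add i k t v) = \<omega> (sdiag (ddet n (row_add i k t v)))"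
    then show "\<omega> v = \<omega> (sdiag (ddet n v))"
      using D_row_add[OF GLs_row_basis[OF v(1)] v(2-4), of t]
        GLs_hom_row_add[where \<omega> = \<omega> and n = n, OF H closed mult v, of t] by simp
  next
    fix d :: 'a assume "d \<noteq> 0"
    then show "\<omega> (sdiag d) = \<omega> (sdiag (ddet n (sdiag d)))" using D_sdiag[OF n] by simp
  qed
qed

end


section \<open>The groups \<open>K\<^sub>1\<close>\<close>

lemma comm_group_K1_alg: "comm_group K1_alg"
  unfolding K1_alg_def by (rule group.derived_quot_is_comm_group[OF group_GL])

definition GL_class :: "(nat \<Rightarrow> nat \<Rightarrow> 'a::ring_1) \<Rightarrow> (nat \<Rightarrow> nat \<Rightarrow> 'a) set" where
  "GL_class v = derived GL (carrier GL) #>\<^bsub>GL\<^esub> v"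

lemma K1_alg_class_eq: "K1_alg_class A = GL_class (stab A)"
  by (simp add: K1_alg_class_def GL_class_def)

lemma carrier_K1_alg: "carrier K1_alg = GL_class ` carrier GL"
  by (simp add: K1_alg_def carrier_FactGroup GL_class_def[abs_def])

lemma GL_class_hom: "GL_class \<in> hom GL K1_alg"
  unfolding K1_alg_def GL_class_def[abs_def]
  by (rule normal.r_coset_hom_Mod[OF group.derived_self_is_normal[OF group_GL]])

lemma GLs_carrier: "v \<in> GLs n \<Longrightarrow> v \<in> carrier GL"
  by (auto simp: carrier_GL)

lemma GL_class_closed: "v \<in> GLs n \<Longrightarrow> GL_class v \<in> carrier K1_alg"
  by (rule hom_in_carrier[OF GL_class_hom GLs_carrier])

lemma GL_class_mult: "v \<in> GLs n \<Longrightarrow> w \<in> GLs n \<Longrightarrow> GL_class (v \<otimes>\<^bsub>GL\<^esub> w) = GL_class v \<otimes>\<^bsub>K1_alg\<^esub> GL_class w"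
  by (rule hom_mult[OF GL_class_hom GLs_carrier GLs_carrier])

definition map_rel :: "'b set \<Rightarrow> ('b \<Rightarrow> 'c) \<Rightarrow> ('b \<times> 'c) set" where
  "map_rel E f = (\<lambda>x. (x, f x)) ` E"

lemma definable_carrier:
  assumes "definable D"
  obtains n where "D \<subseteq> carrier_vec n"
  using assms by (auto simp: definable_def)

lemma K1_gens_iff: "(E, f) \<in> K1_gens \<longleftrightarrow> f \<in> Bij E \<and> definable_map E E f"
  by (auto simp: K1_gens_def Aut_def definable_map_def)

lemma push_apply:
  assumes "inj_on h E" "h \<in> E \<rightarrow> G"
  shows "x \<in> E \<Longrightarrow> push E G h f (h x) = h (f x)"
    and "y \<in> G \<Longrightarrow> y \<notin> h ` E \<Longrightarrow> push E G h f y = y"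
  using assms by (auto simp: push_def)

lemma push_Bij:
  assumes f: "f \<in> Bij E" and inj: "inj_on h E" and h: "h \<in> E \<rightarrow> G"
  shows "push E G h f \<in> Bij G"
proof -
  have f': "bij_betw f E E" using f by (simp add: Bij_def)
  have bij: "bij_betw h E (h ` E)" using inj by (simp add: bij_betw_def)
  have "bij_betw (h \<circ> (f \<circ> inv_into E h)) (h ` E) (h ` E)"
    by (intro bij_betw_trans[OF bij_betw_trans[OF bij_betw_inv_into[OF bij] f'] bij])
  moreover have "(h \<circ> (f \<circ> inv_into E h)) y = push E G h f y" if "y \<in> h ` E" for y
    using that h by (auto simp: push_def)
  ultimately have 1: "bij_betw (push E G h f) (h ` E) (h ` E)"
    using bij_betw_cong[of "h ` E" "h \<circ> (f \<circ> inv_into E h)" "push E G h f"] by blast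
  have "bij_betw (push E G h f) (G - h ` E) (G - h ` E)"
    using bij_betw_cong[of "G - h ` E" "push E G h f" id "G - h ` E"] by (auto simp: push_def)
  then have "bij_betw (push E G h f) (h ` E \<union> (G - h ` E)) (h ` E \<union> (G - h ` E))"
    by (intro bij_betw_combine 1) auto
  moreover have "h ` E \<union> (G - h ` E) = G" using h by auto
  ultimately show ?thesis by (simp add: Bij_def push_def)
qed

section \<open>Definability of products and pushforwards; the presentation of
  \<open>K1_mod\<close>\<close>

context infinite_division_ring
begin

lemma definable_map_rel:
  fixes E F :: "'a vec set"
  assumes "definable_map E F f" "E \<subseteq> carrier_vec n" "F \<subseteq> carrier_vec m"
  shows "definable_rel n m (map_rel E f)"
proof (rule definable_rel_append)
  show "definable ((\<lambda>(x, y). x @\<^sub>v y) ` map_rel E f)"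
    using assms(1) by (simp add: definable_map_def map_rel_def image_image)
  show "map_rel E f \<subseteq> carrier_vec n \<times> carrier_vec m"
    using assms by (auto simp: definable_map_def map_rel_def PiE_iff)
qed

lemma definable_mapI:
  fixes E F :: "'a vec set"
  assumes "definable E" "definable F" "f \<in> E \<rightarrow>\<^sub>E F" "definable_rel n m (map_rel E f)"
  shows "definable_map E F f"
  using assms definable_rel_imp_definable[OF assms(4)]
  by (simp add: definable_map_def map_rel_def image_image)

lemma K1_gens_mult:
  fixes E :: "'a vec set"
  assumes f: "(E, f) \<in> K1_gens" and g: "(E, g) \<in> K1_gens"
  shows "(E, g \<otimes>\<^bsub>Aut E\<^esub> f) \<in> K1_gens" "g \<otimes>\<^bsub>Aut E\<^esub> f = compose E g f"
proof -
  have Bij: "f \<in> Bij E" "g \<in> Bij E" and def: "definable_map E E f" "definable_map E E g"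
    using f g by (auto simp: K1_gens_iff)
  show eq: "g \<otimes>\<^bsub>Aut E\<^esub> f = compose E g f" using Bij by (simp add: Aut_def BijGroup_def)
  have E: "definable E" using def by (simp add: definable_map_def)
  from definable_carrier[OF this] obtain n where n: "E \<subseteq> carrier_vec n" .
  have fE: "f \<in> E \<rightarrow> E" "g \<in> E \<rightarrow> E" using def by (auto simp: definable_map_def PiE_iff)
  have "map_rel E (compose E g f) = map_rel E f O map_rel E g"
    using fE by (auto simp: map_rel_def compose_def)
  then have "definable_rel n n (map_rel E (compose E g f))"
    using definable_rel_relcomp[OF definable_map_rel[OF def(1) n n] definable_map_rel[OF def(2) n n]] by simp
  then have "definable_map E E (compose E g f)"
    by (intro definable_mapI[OF E E]) (use fE in \<open>auto simp: compose_def\<close>)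
  then show "(E, g \<otimes>\<^bsub>Aut E\<^esub> f) \<in> K1_gens"
    using compose_Bij[OF Bij(2,1)] by (simp add: eq K1_gens_iff)
qed

text \<open>The pushed automorphism is the conjugate of \<open>f\<close> by \<open>h\<close>
  together with the identity off the image of \<open>h\<close>. On graphs this uses only converse,
  composition, difference and union, which all preserve definability.\<close>

lemma map_rel_push:
  assumes inj: "inj_on h E" and h: "h \<in> E \<rightarrow> G" and f: "f \<in> E \<rightarrow> E"
  shows "map_rel G (push E G h f) = (map_rel E h)\<inverse> O map_rel E f O map_rel E h \<union> (Id_on G - (map_rel E h)\<inverse> O map_rel E h)"
    and "map_rel (h ` E) (push E G h f) = (map_rel E h)\<inverse> O map_rel E f O map_rel E h"
    and "map_rel (G - h ` E) (push E G h f) = Id_on G - (map_rel E h)\<inverse> O map_rel E h"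
proof -
  have conj: "(map_rel E h)\<inverse> O map_rel E f O map_rel E h = (\<lambda>x. (h x, h (f x))) ` E"
    using f by (auto simp: map_rel_def relcomp_unfold image_iff)
  have ident: "(map_rel E h)\<inverse> O map_rel E h = Id_on (h ` E)"
    by (auto simp: map_rel_def relcomp_unfold)
  show 2: "map_rel (h ` E) (push E G h f) = (map_rel E h)\<inverse> O map_rel E f O map_rel E h"
    unfolding conj using push_apply(1)[OF inj h] by (simp add: map_rel_def image_image cong: image_cong)
  show 3: "map_rel (G - h ` E) (push E G h f) = Id_on G - (map_rel E h)\<inverse> O map_rel E h"
    unfolding ident using push_apply(2)[OF inj h] by (auto simp: map_rel_def image_iff)
  have "map_rel G (push E G h f) = map_rel (h ` E) (push E G h f) \<union> map_rel (G - h ` E) (push E G h f)"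
    using h by (auto simp: map_rel_def)
  then show "map_rel G (push E G h f) = (map_rel E h)\<inverse> O map_rel E f O map_rel E h \<union> (Id_on G - (map_rel E h)\<inverse> O map_rel E h)"
    by (simp only: 2 3)
qed

lemma definable_rel_push:
  fixes E G :: "'a vec set"
  assumes f: "(E, f) \<in> K1_gens" and h: "definable_map E G h"
    and n: "E \<subseteq> carrier_vec n" and m: "G \<subseteq> carrier_vec m"
  shows "definable_rel m m ((map_rel E h)\<inverse> O map_rel E f O map_rel E h)"
    and "definable_rel m m (Id_on G - (map_rel E h)\<inverse> O map_rel E h)"
proof -
  have f': "definable_rel n n (map_rel E f)" using f n by (intro definable_map_rel) (auto simp: K1_gens_iff)
  have h': "definable_rel n m (map_rel E h)" by (rule definable_map_rel[OF h n m])
  show "definable_rel m m ((map_rel E h)\<inverse> O map_rel E f O map_rel E h)"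
    by (intro definable_rel_relcomp[OF definable_rel_converse[OF h'] definable_rel_relcomp[OF f' h']])
  have "definable G" using h by (simp add: definable_map_def)
  then show "definable_rel m m (Id_on G - (map_rel E h)\<inverse> O map_rel E h)"
    by (intro definable_rel_Diff definable_rel_Id_on m
        definable_rel_relcomp[OF definable_rel_converse[OF h'] h'])
qed

lemma K1_gens_push:
  fixes E G :: "'a vec set"
  assumes f: "(E, f) \<in> K1_gens" and h: "definable_map E G h" and inj: "inj_on h E"
  shows "(G, push E G h f) \<in> K1_gens"
proof -
  have E: "definable E" and G: "definable G" and hE: "h \<in> E \<rightarrow> G"
    using h by (auto simp: definable_map_def PiE_iff)
  have fB: "f \<in> Bij E" and fE: "f \<in> E \<rightarrow> E" using f by (auto simp: K1_gens_iff definable_map_def PiE_iff)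
  from definable_carrier[OF E] obtain n where n: "E \<subseteq> carrier_vec n" .
  from definable_carrier[OF G] obtain m where m: "G \<subseteq> carrier_vec m" .
  have "definable_rel m m (map_rel G (push E G h f))"
    unfolding map_rel_push(1)[OF inj hE fE]
    by (rule definable_rel_Un[OF definable_rel_push[OF f h n m]])
  moreover have B: "push E G h f \<in> Bij G" by (rule push_Bij[OF fB inj hE])
  then have "push E G h f \<in> G \<rightarrow>\<^sub>E G" using Bij_imp_funcset Bij_imp_extensional by (auto simp: PiE_def)
  ultimately show ?thesis using B definable_mapI[OF G G] by (auto simp: K1_gens_iff)
qed

text \<open>That \<open>generate\<close> yields a subgroup presupposes relations inside the free
  group on the generators.\<close>

lemma K1_rels_carrier: "(K1_rels :: ('a vec set \<times> ('a vec \<Rightarrow> 'a vec) \<Rightarrow>\<^sub>0 int) set) \<subseteq> carrier (free_Abelian_group K1_gens)"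
proof -
  let ?c = "carrier (free_Abelian_group (K1_gens :: ('a vec set \<times> ('a vec \<Rightarrow> 'a vec)) set))"
  have diff: "x - y \<in> ?c" if "x \<in> ?c" "y \<in> ?c" for x y
    using that keys_diff[of x y] by auto
  have add: "x + y \<in> ?c" if "x \<in> ?c" "y \<in> ?c" for x y
    using that keys_add[of x y] by auto
  have gen: "frag_of x \<in> ?c" if "x \<in> K1_gens" for x using that by simp
  show ?thesis
    unfolding K1_rels_def by (auto intro!: diff add gen K1_gens_mult(1) K1_gens_push simp del: carrier_free_Abelian_group_iff)
qed

lemma subgroup_K1_rel: "subgroup K1_rel_subgroup (free_Abelian_group (K1_gens :: ('a vec set \<times> ('a vec \<Rightarrow> 'a vec)) set))"
  by (rule group.generate_is_subgroup[OF group_free_Abelian_group K1_rels_carrier])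

lemma normal_K1_rel: "K1_rel_subgroup \<lhd> free_Abelian_group (K1_gens :: ('a vec set \<times> ('a vec \<Rightarrow> 'a vec)) set)"
  by (rule comm_group.subgroup_imp_normal[OF abelian_free_Abelian_group subgroup_K1_rel])

lemma comm_group_K1_mod: "comm_group (K1_mod :: ('a vec set \<times> ('a vec \<Rightarrow> 'a vec) \<Rightarrow>\<^sub>0 int) set monoid)"
  unfolding K1_mod_def by (rule comm_group.abelian_FactGroup[OF abelian_free_Abelian_group subgroup_K1_rel])

lemma K1_mod_class_closed:
  fixes E :: "'a vec set"
  assumes "(E, f) \<in> K1_gens"
  shows "K1_mod_class E f \<in> carrier K1_mod"
  unfolding K1_mod_def K1_mod_class_def
  by (rule hom_in_carrier[OF normal.r_coset_hom_Mod[OF normal_K1_rel]]) (use assms in simp)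

lemma K1_mod_class_mult:
  fixes E :: "'a vec set"
  assumes f: "(E, f) \<in> K1_gens" and g: "(E, g) \<in> K1_gens"
  shows "K1_mod_class E (g \<otimes>\<^bsub>Aut E\<^esub> f) = K1_mod_class E g \<otimes>\<^bsub>K1_mod\<^esub> K1_mod_class E f"
proof -
  let ?F = "free_Abelian_group (K1_gens :: ('a vec set \<times> ('a vec \<Rightarrow> 'a vec)) set)"
  let ?x = "frag_of (E, g) + frag_of (E, f)" and ?y = "frag_of (E, g \<otimes>\<^bsub>Aut E\<^esub> f)"
  have car: "frag_of (E, f) \<in> carrier ?F" "frag_of (E, g) \<in> carrier ?F" using f g by simp_all
  have x: "?x \<in> carrier ?F" using monoid.m_closed[OF group.is_monoid[OF group_free_Abelian_group] car(2,1)] by simp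
  have "?y - ?x \<in> K1_rel_subgroup"
    by (rule generate.incl) (use f g in \<open>unfold K1_rels_def, blast\<close>)
  then have "(?y - ?x) \<otimes>\<^bsub>?F\<^esub> ?x \<in> K1_rel_subgroup #>\<^bsub>?F\<^esub> ?x"
    unfolding r_coset_def by blast
  then have "?y \<in> K1_rel_subgroup #>\<^bsub>?F\<^esub> ?x" by simp
  from group.repr_independence[OF group_free_Abelian_group this x subgroup_K1_rel]
  have "K1_mod_class E (g \<otimes>\<^bsub>Aut E\<^esub> f) = K1_rel_subgroup #>\<^bsub>?F\<^esub> (frag_of (E, g) \<otimes>\<^bsub>?F\<^esub> frag_of (E, f))"
    by (simp add: K1_mod_class_def)
  also have "\<dots> = K1_mod_class E g \<otimes>\<^bsub>K1_mod\<^esub> K1_mod_class E f"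
    unfolding K1_mod_def K1_mod_class_def
    by (rule hom_mult[OF normal.r_coset_hom_Mod[OF normal_K1_rel] car(2,1)])
  finally show ?thesis .
qed

end


section \<open>Affine parametrisations\<close>

definition coord_space :: "nat \<Rightarrow> (nat \<Rightarrow> 'a::ring_1) set" where
  "coord_space n = {x. \<forall>i\<ge>n. x i = 0}"

definition param :: "nat \<Rightarrow> ('i \<Rightarrow> 'a::ring_1) set \<Rightarrow> ((nat \<Rightarrow> 'a) \<Rightarrow> 'i \<Rightarrow> 'a) \<Rightarrow> bool" where
  "param n S \<phi> \<longleftrightarrow> affine_on (coord_space n) \<phi> \<and> inj_on \<phi> (coord_space n) \<and> \<phi> ` coord_space n = S"

text \<open>Row \<open>i\<close> is the increment of \<open>\<gamma>\<close> in direction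
  \<open>i\<close>. Rows from \<open>n\<close> on are those of the identity, so that the matrix can
  be used in the stable group directly.\<close>

definition linear_part :: "nat \<Rightarrow> ((nat \<Rightarrow> 'a::ring_1) \<Rightarrow> nat \<Rightarrow> 'a) \<Rightarrow> nat \<Rightarrow> nat \<Rightarrow> 'a" where
  "linear_part n \<gamma> = (\<lambda>i j. if i < n then \<gamma> (idm i) j - \<gamma> (\<lambda>_. 0) j else idm i j)"

lemma coord_space_affine: "coord_space n \<in> affine_sets"
proof -
  have "(\<lambda>_. 0) \<in> coord_space n" by (simp add: coord_space_def)
  then have "coord_space n \<noteq> {}" by blast
  then show ?thesis by (auto simp: affine_sets_def coord_space_def aff_def)
qed

lemma zero_coord_space: "(\<lambda>_. 0) \<in> coord_space n"
  by (simp add: coord_space_def)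

lemma idm_coord_space: "i < n \<Longrightarrow> idm i \<in> coord_space n"
  by (auto simp: coord_space_def idm_def)

text \<open>The point \<open>x\<close> is reached from 0 by switching on one coordinate at a time,
  each time by an affine combination.\<close>

lemma affine_expansion:
  assumes \<phi>: "affine_on (coord_space n) \<phi>" and x: "x \<in> coord_space n"
  shows "\<phi> x j = \<phi> (\<lambda>_. 0) j + (\<Sum>i<n. x i * (\<phi> (idm i) j - \<phi> (\<lambda>_. 0) j))"
proof -
  define y where "y m = (\<lambda>i. if i < m then x i else 0)" for m
  have y: "y m \<in> coord_space n" if "m \<le> n" for m using that by (auto simp: y_def coord_space_def)
  have "\<phi> (y m) j = \<phi> (\<lambda>_. 0) j + (\<Sum>i<m. x i * (\<phi> (idm i) j - \<phi> (\<lambda>_. 0) j))" if "m \<le> n" for m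
    using that
  proof (induction m)
    case 0
    then show ?case by (simp add: y_def)
  next
    case (Suc m)
    have "y (Suc m) = aff (x m) (y m) (idm m) (\<lambda>_. 0)"
      by (auto simp: y_def aff_def idm_def fun_eq_iff less_Suc_eq)
    then have "\<phi> (y (Suc m)) = aff (x m) (\<phi> (y m)) (\<phi> (idm m)) (\<phi> (\<lambda>_. 0))"
      using affine_onD[OF \<phi> y idm_coord_space zero_coord_space] Suc.prems by simp
    then show ?case using Suc by (simp add: aff_def add.assoc)
  qed
  moreover have "y n = x" using x by (auto simp: y_def coord_space_def fun_eq_iff)
  ultimately show ?thesis by (metis order_refl)
qed

lemma comb_linear_part:
  assumes \<gamma>: "affine_on (coord_space n) \<gamma>" and x: "x \<in> coord_space n"
  shows "comb n x (linear_part n \<gamma>) j = \<gamma> x j - \<gamma> (\<lambda>_. 0) j"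
  using affine_expansion[OF assms] by (simp add: comb_def linear_part_def)

text \<open>Matrices act on row vectors from the right, so the order of composition is
  reversed.\<close>

lemma comb_linear_part_comp:
  assumes \<gamma>: "affine_on (coord_space n) \<gamma>" and \<gamma>': "\<gamma>' ` coord_space n \<subseteq> coord_space n" and i: "i < n"
  shows "comb n (linear_part n \<gamma>' i) (linear_part n \<gamma>) j = linear_part n (\<lambda>x. \<gamma> (\<gamma>' x)) i j"
proof -
  have "\<gamma>' (idm i) \<in> coord_space n" "\<gamma>' (\<lambda>_. 0) \<in> coord_space n"
    using \<gamma>' i idm_coord_space zero_coord_space by blast+
  moreover have "comb n (linear_part n \<gamma>' i) (linear_part n \<gamma>) j =
      comb n (\<gamma>' (idm i)) (linear_part n \<gamma>) j - comb n (\<gamma>' (\<lambda>_. 0)) (linear_part n \<gamma>) j"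
    unfolding comb_diff[symmetric] using i by (intro comb_cong) (simp_all add: linear_part_def)
  ultimately show ?thesis using i by (simp add: comb_linear_part[OF \<gamma>]) (simp add: linear_part_def)
qed

lemma linear_part_cong:
  "(\<And>x. x \<in> coord_space n \<Longrightarrow> \<gamma> x = \<gamma>' x) \<Longrightarrow> linear_part n \<gamma> = linear_part n \<gamma>'"
  by (auto simp: linear_part_def idm_coord_space zero_coord_space fun_eq_iff)

lemma linear_part_id: "linear_part n (\<lambda>x. x) = idm"
  by (simp add: linear_part_def fun_eq_iff)

lemma param_affine_set: "param n S \<phi> \<Longrightarrow> S \<in> affine_sets"
  using affine_sets_image[OF coord_space_affine] by (auto simp: param_def)

lemma param_comp:
  assumes "param n S \<phi>" "affine_on S p" "inj_on p S"
  shows "param n (p ` S) (\<lambda>x. p (\<phi> x))"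
  using assms unfolding param_def
  by (auto intro: affine_on_comp simp: image_image intro!: comp_inj_on[of \<phi> _ p, unfolded comp_def])

lemma param_inv:
  assumes "param n S \<phi>" "param n S \<psi>"
  shows "param n (coord_space n) (\<lambda>x. inv_into (coord_space n) \<phi> (\<psi> x))"
proof -
  have "affine_on S (inv_into (coord_space n) \<phi>)"
    using affine_on_inv_into[OF coord_space_affine, of n \<phi>] assms(1) by (auto simp: param_def)
  moreover have "bij_betw \<phi> (coord_space n) S" using assms(1) by (auto simp: param_def bij_betw_def)
  from bij_betw_inv_into[OF this]
  have "inj_on (inv_into (coord_space n) \<phi>) S" "inv_into (coord_space n) \<phi> ` S = coord_space n"
    by (auto simp: bij_betw_def)
  ultimately show ?thesis using param_comp[OF assms(2)] by metis
qed

text \<open>The inverse map is affine as well, and its linear part is the inverse matrix.\<close>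

lemma linear_part_GLs:
  assumes \<gamma>: "param n (coord_space n) \<gamma>"
  shows "linear_part n \<gamma> \<in> GLs n"
proof -
  define \<gamma>' where "\<gamma>' = (\<lambda>x. inv_into (coord_space n) \<gamma> x)"
  have "param n (coord_space n) (\<lambda>x. x)" by (auto simp: param_def affine_on_def)
  from param_inv[OF \<gamma> this] have \<gamma>': "param n (coord_space n) \<gamma>'" by (simp add: \<gamma>'_def)
  have img: "\<gamma> ` coord_space n \<subseteq> coord_space n" "\<gamma>' ` coord_space n \<subseteq> coord_space n"
    and aff: "affine_on (coord_space n) \<gamma>" "affine_on (coord_space n) \<gamma>'"
    using \<gamma> \<gamma>' by (auto simp: param_def)
  have "linear_part n (\<lambda>x. \<gamma> (\<gamma>' x)) = linear_part n (\<lambda>x. x)"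
    by (rule linear_part_cong) (use \<gamma> in \<open>auto simp: \<gamma>'_def param_def f_inv_into_f\<close>)
  moreover have "linear_part n (\<lambda>x. \<gamma>' (\<gamma> x)) = linear_part n (\<lambda>x. x)"
    by (rule linear_part_cong) (use \<gamma> in \<open>auto simp: \<gamma>'_def param_def\<close>)
  ultimately have "(\<forall>i<n. \<forall>j<n. comb n (linear_part n \<gamma>' i) (linear_part n \<gamma>) j = idm i j) \<and>
      (\<forall>i<n. \<forall>j<n. comb n (linear_part n \<gamma> i) (linear_part n \<gamma>') j = idm i j)"
    by (simp add: comb_linear_part_comp[OF aff(1) img(2)] comb_linear_part_comp[OF aff(2) img(1)] linear_part_id)
  then have "row_basis n (linear_part n \<gamma>)" unfolding row_basis_iff_inverse by (intro exI)
  moreover have "linear_part n \<gamma> i j = 0" if "i < n" "n \<le> j" for i j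
  proof -
    have "\<gamma> (idm i) \<in> coord_space n" "\<gamma> (\<lambda>_. 0) \<in> coord_space n"
      using img(1) that(1) idm_coord_space zero_coord_space by blast+
    then show ?thesis using that by (simp add: linear_part_def coord_space_def)
  qed
  ultimately show ?thesis by (auto simp: GLs_def linear_part_def idm_def)
qed

definition affine_class :: "nat \<Rightarrow> ((nat \<Rightarrow> 'a::ring_1) \<Rightarrow> nat \<Rightarrow> 'a) \<Rightarrow> (nat \<Rightarrow> nat \<Rightarrow> 'a) set" where
  "affine_class n \<gamma> = GL_class (linear_part n \<gamma>)"

lemma affine_class_closed: "param n (coord_space n) \<gamma> \<Longrightarrow> affine_class n \<gamma> \<in> carrier K1_alg"
  unfolding affine_class_def by (rule GL_class_closed[OF linear_part_GLs])

lemma affine_class_comp: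
  assumes "param n (coord_space n) \<gamma>" "param n (coord_space n) \<gamma>'"
  shows "affine_class n (\<lambda>x. \<gamma> (\<gamma>' x)) = affine_class n \<gamma> \<otimes>\<^bsub>K1_alg\<^esub> affine_class n \<gamma>'"
proof -
  have "linear_part n (\<lambda>x. \<gamma> (\<gamma>' x)) = linear_part n \<gamma>' \<otimes>\<^bsub>GL\<^esub> linear_part n \<gamma>"
  proof (intro ext)
    fix i j
    have "linear_part n \<gamma> i j = idm i j" if "\<not> i < n" using that by (simp add: linear_part_def)
    moreover have "linear_part n (\<lambda>x. \<gamma> (\<gamma>' x)) i j = idm i j" if "\<not> i < n" using that by (simp add: linear_part_def)
    moreover have "affine_on (coord_space n) \<gamma>" "\<gamma>' ` coord_space n \<subseteq> coord_space n"
      using assms by (auto simp: param_def)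
    ultimately show "linear_part n (\<lambda>x. \<gamma> (\<gamma>' x)) i j = (linear_part n \<gamma>' \<otimes>\<^bsub>GL\<^esub> linear_part n \<gamma>) i j"
      unfolding GL_mult[OF linear_part_GLs[OF assms(2)]] by (simp add: comb_linear_part_comp)
  qed
  then have "affine_class n (\<lambda>x. \<gamma> (\<gamma>' x)) = affine_class n \<gamma>' \<otimes>\<^bsub>K1_alg\<^esub> affine_class n \<gamma>"
    unfolding affine_class_def by (simp add: GL_class_mult[OF linear_part_GLs linear_part_GLs] assms)
  then show ?thesis
    using comm_group.axioms(1)[OF comm_group_K1_alg, THEN comm_monoid.m_comm] affine_class_closed assms by metis
qed


section \<open>The determinant of an affine correspondence\<close>

text \<open>One choice for each set, so that a set has the same coordinates as target of one map and
  as source of the next.\<close>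

definition ref_param :: "nat \<Rightarrow> ('i \<Rightarrow> 'a::ring_1) set \<Rightarrow> (nat \<Rightarrow> 'a) \<Rightarrow> 'i \<Rightarrow> 'a" where
  "ref_param n S = (SOME \<phi>. param n S \<phi>)"

text \<open>The determinant of the coordinate change between \<open>\<psi>\<close> and the reference
  coordinates of its image.\<close>

definition param_class :: "nat \<Rightarrow> ((nat \<Rightarrow> 'a::ring_1) \<Rightarrow> 'i \<Rightarrow> 'a) \<Rightarrow> (nat \<Rightarrow> nat \<Rightarrow> 'a) set" where
  "param_class n \<psi> = affine_class n (\<lambda>x. inv_into (coord_space n) (ref_param n (\<psi> ` coord_space n)) (\<psi> x))"

lemma param_ref: "param n S \<phi> \<Longrightarrow> param n S (ref_param n S)"
  unfolding ref_param_def by (rule someI[of "param n S"])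

lemma param_ref_inv:
  assumes "param n S \<psi>"
  shows "param n (coord_space n) (\<lambda>x. inv_into (coord_space n) (ref_param n (\<psi> ` coord_space n)) (\<psi> x))"
proof -
  have "\<psi> ` coord_space n = S" using assms by (simp add: param_def)
  then show ?thesis using param_inv[OF param_ref[OF assms] assms] by simp
qed

lemma param_class_closed: "param n S \<psi> \<Longrightarrow> param_class n \<psi> \<in> carrier K1_alg"
  unfolding param_class_def by (rule affine_class_closed[OF param_ref_inv])

lemma param_class_cong:
  assumes "\<And>x. x \<in> coord_space n \<Longrightarrow> \<psi> x = \<psi>' x"
  shows "param_class n \<psi> = param_class n \<psi>'"
proof -
  have "\<psi> ` coord_space n = \<psi>' ` coord_space n" using assms by (rule image_cong[OF refl])
  then show ?thesis
    unfolding param_class_def affine_class_def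
    by (intro arg_cong[of _ _ GL_class] linear_part_cong) (simp add: assms)
qed

lemma param_class_comp:
  assumes \<psi>: "param n S \<psi>" and \<gamma>: "param n (coord_space n) \<gamma>"
  shows "param_class n (\<lambda>x. \<psi> (\<gamma> x)) = param_class n \<psi> \<otimes>\<^bsub>K1_alg\<^esub> affine_class n \<gamma>"
proof -
  have "(\<lambda>x. \<psi> (\<gamma> x)) ` coord_space n = \<psi> ` coord_space n"
    using \<gamma> by (simp add: param_def flip: image_image[of \<psi> \<gamma>])
  then show ?thesis
    unfolding param_class_def
    using affine_class_comp[OF param_ref_inv[OF \<psi>] \<gamma>] by simp
qed

definition fst_part :: "('i + 'j \<Rightarrow> 'a) \<Rightarrow> 'i \<Rightarrow> 'a" where "fst_part x = x \<circ> Inl"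

definition snd_part :: "('i + 'j \<Rightarrow> 'a) \<Rightarrow> 'j \<Rightarrow> 'a" where "snd_part x = x \<circ> Inr"

lemma affine_on_parts: "affine_on S fst_part" "affine_on S snd_part"
  unfolding fst_part_def[abs_def] snd_part_def[abs_def] by (rule affine_on_reindex)+

text \<open>\<open>S\<close> is read as the graph of an affine isomorphism between its two
  projections, and its determinant is taken in their reference coordinates. Sets that have no
  parametrisation by \<open>coord_space n\<close> count as 1.\<close>

definition corr_det :: "nat \<Rightarrow> ('i + 'j \<Rightarrow> 'a::ring_1) set \<Rightarrow> (nat \<Rightarrow> nat \<Rightarrow> 'a) set" where
  "corr_det n S = (if (\<exists>\<phi>. param n S \<phi>) \<and> inj_on fst_part S \<and> inj_on snd_part S
     then param_class n (\<lambda>x. snd_part (ref_param n S x)) \<otimes>\<^bsub>K1_alg\<^esub>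
       inv\<^bsub>K1_alg\<^esub> param_class n (\<lambda>x. fst_part (ref_param n S x))
     else \<one>\<^bsub>K1_alg\<^esub>)"

text \<open>Another parametrisation of \<open>S\<close> multiplies the classes of both projections
  by the same \<open>affine_class n \<gamma>\<close>.\<close>

lemma corr_det_param:
  assumes \<phi>: "param n S \<phi>" and inj: "inj_on fst_part S" "inj_on snd_part S"
  shows "corr_det n S \<otimes>\<^bsub>K1_alg\<^esub> param_class n (\<lambda>x. fst_part (\<phi> x)) = param_class n (\<lambda>x. snd_part (\<phi> x))"
proof -
  interpret K: comm_group K1_alg by (rule comm_group_K1_alg)
  define r where "r = ref_param n S"
  have r: "param n S r" unfolding r_def by (rule param_ref[OF \<phi>])
  define \<gamma> where "\<gamma> = (\<lambda>x. inv_into (coord_space n) r (\<phi> x))"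
  have \<gamma>: "param n (coord_space n) \<gamma>" unfolding \<gamma>_def by (rule param_inv[OF r \<phi>])
  have r\<gamma>: "r (\<gamma> x) = \<phi> x" if "x \<in> coord_space n" for x
  proof -
    have "\<phi> x \<in> r ` coord_space n" using r \<phi> that by (auto simp: param_def)
    then show ?thesis by (simp add: \<gamma>_def f_inv_into_f)
  qed
  note p = param_comp[OF r affine_on_parts(1) inj(1)] param_comp[OF r affine_on_parts(2) inj(2)]
  have "param_class n (\<lambda>x. fst_part (\<phi> x)) = param_class n (\<lambda>x. fst_part (r (\<gamma> x)))"
    by (rule param_class_cong) (simp add: r\<gamma>)
  also have "\<dots> = param_class n (\<lambda>x. fst_part (r x)) \<otimes>\<^bsub>K1_alg\<^esub> affine_class n \<gamma>"
    by (rule param_class_comp[OF p(1) \<gamma>])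
  finally have 1: "param_class n (\<lambda>x. fst_part (\<phi> x)) = param_class n (\<lambda>x. fst_part (r x)) \<otimes>\<^bsub>K1_alg\<^esub> affine_class n \<gamma>" .
  have "param_class n (\<lambda>x. snd_part (\<phi> x)) = param_class n (\<lambda>x. snd_part (r (\<gamma> x)))"
    by (rule param_class_cong) (simp add: r\<gamma>)
  also have "\<dots> = param_class n (\<lambda>x. snd_part (r x)) \<otimes>\<^bsub>K1_alg\<^esub> affine_class n \<gamma>"
    by (rule param_class_comp[OF p(2) \<gamma>])
  finally have 2: "param_class n (\<lambda>x. snd_part (\<phi> x)) = param_class n (\<lambda>x. snd_part (r x)) \<otimes>\<^bsub>K1_alg\<^esub> affine_class n \<gamma>" .
  have "\<exists>\<phi>. param n S \<phi>" using \<phi> by (intro exI)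
  then have 3: "corr_det n S = param_class n (\<lambda>x. snd_part (r x)) \<otimes>\<^bsub>K1_alg\<^esub> inv\<^bsub>K1_alg\<^esub> param_class n (\<lambda>x. fst_part (r x))"
    using inj by (simp add: corr_det_def r_def)
  have car: "param_class n (\<lambda>x. fst_part (r x)) \<in> carrier K1_alg" "param_class n (\<lambda>x. snd_part (r x)) \<in> carrier K1_alg"
    "affine_class n \<gamma> \<in> carrier K1_alg"
    by (rule param_class_closed[OF p(1)] param_class_closed[OF p(2)] affine_class_closed[OF \<gamma>])+
  show ?thesis unfolding 1 2 3 using car by (simp add: K.m_assoc K.inv_solve_left' flip: K.m_assoc[of "inv\<^bsub>K1_alg\<^esub> _"])
qed

lemma corr_det_closed: "corr_det n S \<in> carrier K1_alg"
proof -
  interpret K: comm_group K1_alg by (rule comm_group_K1_alg)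
  show ?thesis
  proof (cases "(\<exists>\<phi>. param n S \<phi>) \<and> inj_on fst_part S \<and> inj_on snd_part S")
    case True
    then obtain \<phi> where "param n S \<phi>" by (elim exE conjE)
    then have r: "param n S (ref_param n S)" by (rule param_ref)
    show ?thesis
      using True param_class_closed[OF param_comp[OF r affine_on_parts(1)]]
        param_class_closed[OF param_comp[OF r affine_on_parts(2)]] by (simp add: corr_det_def)
  next
    case False
    then show ?thesis unfolding corr_det_def by (simp only: if_False) simp
  qed
qed

section \<open>The cocycle identity for affine sets of triples\<close>

definition part12 :: "('i + 'j + 'k \<Rightarrow> 'a) \<Rightarrow> 'i + 'j \<Rightarrow> 'a" where "part12 t = t \<circ> case_sum Inl (Inr \<circ> Inl)"

definition part13 :: "('i + 'j + 'k \<Rightarrow> 'a) \<Rightarrow> 'i + 'k \<Rightarrow> 'a" where "part13 t = t \<circ> case_sum Inl (Inr \<circ> Inr)"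

lemma affine_on_pairs: "affine_on S part12" "affine_on S part13"
  unfolding part12_def[abs_def] part13_def[abs_def] by (rule affine_on_reindex)+

lemma part_simps [simp]:
  "fst_part (part12 t) = fst_part t"
  "snd_part (part12 t) = fst_part (snd_part t)"
  "fst_part (part13 t) = fst_part t" "snd_part (part13 t) = snd_part (snd_part t)"
  by (auto simp: fst_part_def snd_part_def part12_def part13_def)

text \<open>Makes the default value 1 occur for all projections of a set simultaneously.\<close>

lemma param_image_iff:
  assumes "S \<in> affine_sets" "affine_on S p" "inj_on p S"
  shows "(\<exists>\<phi>. param n (p ` S) \<phi>) \<longleftrightarrow> (\<exists>\<phi>. param n S \<phi>)"
proof
  assume "\<exists>\<phi>. param n S \<phi>"
  then obtain \<phi> where "param n S \<phi>" by (elim exE)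
  from param_comp[OF this assms(2,3)] show "\<exists>\<phi>. param n (p ` S) \<phi>" by (intro exI)
next
  assume "\<exists>\<phi>. param n (p ` S) \<phi>"
  then obtain \<phi> where \<phi>: "param n (p ` S) \<phi>" by (elim exE)
  have b: "bij_betw p S (p ` S)" using assms(3) by (simp add: bij_betw_def)
  from param_comp[OF \<phi> affine_on_inv_into[OF assms]] bij_betw_inv_into[OF b]
  have "param n S (\<lambda>x. inv_into S p (\<phi> x))" by (simp add: bij_betw_def)
  then show "\<exists>\<phi>. param n S \<phi>" by (intro exI)
qed

text \<open>A parametrisation of \<open>S\<close> yields classes \<open>a\<close>, \<open>b\<close>,
  \<open>c\<close> of its three coordinate projections, and the determinants of the three pairs are
  \<open>b / a\<close>, \<open>c / b\<close> and \<open>c / a\<close>.\<close>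

lemma corr_det_triple:
  assumes S: "S \<in> affine_sets"
    and inj: "inj_on fst_part S" "inj_on (\<lambda>t. fst_part (snd_part t)) S" "inj_on (\<lambda>t. snd_part (snd_part t)) S"
  shows "corr_det n (part13 ` S) = corr_det n (part12 ` S) \<otimes>\<^bsub>K1_alg\<^esub> corr_det n (snd_part ` S)"
proof -
  interpret K: comm_group K1_alg by (rule comm_group_K1_alg)
  have i12: "inj_on part12 S" "inj_on fst_part (part12 ` S)" "inj_on snd_part (part12 ` S)"
    and i13: "inj_on part13 S" "inj_on fst_part (part13 ` S)" "inj_on snd_part (part13 ` S)"
    and i23: "inj_on snd_part S" "inj_on fst_part (snd_part ` S)" "inj_on snd_part (snd_part ` S)"
  proof -
    have inj': "inj_on (fst_part \<circ> part12) S" "inj_on (snd_part \<circ> part12) S" "inj_on (fst_part \<circ> part13) S"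
      "inj_on (snd_part \<circ> part13) S" "inj_on (fst_part \<circ> snd_part) S" "inj_on (snd_part \<circ> snd_part) S"
      using inj by (simp_all only: comp_def part_simps)
    show "inj_on part12 S" "inj_on part13 S" "inj_on snd_part S"
      by (rule inj_on_imageI2[OF inj'(1)] inj_on_imageI2[OF inj'(3)] inj_on_imageI2[OF inj'(5)])+
    show "inj_on fst_part (part12 ` S)" "inj_on snd_part (part12 ` S)" "inj_on fst_part (part13 ` S)"
      "inj_on snd_part (part13 ` S)" "inj_on fst_part (snd_part ` S)" "inj_on snd_part (snd_part ` S)"
      by (rule inj_on_imageI inj')+
  qed
  show ?thesis
  proof (cases "\<exists>\<phi>. param n S \<phi>")
    case True
    then obtain \<phi> where \<phi>: "param n S \<phi>" by (elim exE)
    note p12 = param_comp[OF \<phi> affine_on_pairs(1) i12(1)]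
      and p13 = param_comp[OF \<phi> affine_on_pairs(2) i13(1)]
      and p23 = param_comp[OF \<phi> affine_on_parts(2) i23(1)]
    note d12 = corr_det_param[OF p12 i12(2,3)] and d13 = corr_det_param[OF p13 i13(2,3)]
      and d23 = corr_det_param[OF p23 i23(2,3)]
    have a: "param_class n (\<lambda>x. fst_part (\<phi> x)) \<in> carrier K1_alg"
      by (rule param_class_closed[OF param_comp[OF \<phi> affine_on_parts(1) inj(1)]])
    have "corr_det n (part13 ` S) \<otimes>\<^bsub>K1_alg\<^esub> param_class n (\<lambda>x. fst_part (\<phi> x)) =
        corr_det n (snd_part ` S) \<otimes>\<^bsub>K1_alg\<^esub> (corr_det n (part12 ` S) \<otimes>\<^bsub>K1_alg\<^esub> param_class n (\<lambda>x. fst_part (\<phi> x)))"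
      using d12 d13 d23 by simp
    also have "\<dots> = corr_det n (part12 ` S) \<otimes>\<^bsub>K1_alg\<^esub> corr_det n (snd_part ` S) \<otimes>\<^bsub>K1_alg\<^esub> param_class n (\<lambda>x. fst_part (\<phi> x))"
      using a by (simp add: K.m_ac corr_det_closed)
    finally show ?thesis using a by (simp add: corr_det_closed)
  next
    case False
    then have "corr_det n (part12 ` S) = \<one>\<^bsub>K1_alg\<^esub>" "corr_det n (part13 ` S) = \<one>\<^bsub>K1_alg\<^esub>" "corr_det n (snd_part ` S) = \<one>\<^bsub>K1_alg\<^esub>"
      using param_image_iff[OF S affine_on_pairs(1) i12(1)] param_image_iff[OF S affine_on_pairs(2) i13(1)]
        param_image_iff[OF S affine_on_parts(2) i23(1)] by (simp_all add: corr_det_def)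
    then show ?thesis by simp
  qed
qed


section \<open>The invariant of a definable bijection\<close>

lemma (in comm_group) free_Abelian_group_hom_exists:
  assumes "f ` S \<subseteq> carrier G"
  shows "\<exists>h\<in>hom (free_Abelian_group S) G. \<forall>x\<in>S. h (frag_of x) = f x"
proof (rule free_Abelian_group_universal[OF assms])
  fix h assume "h \<in> hom (free_Abelian_group S) G" "\<And>x. x \<in> S \<Longrightarrow> h (frag_of x) = f x"
  then show ?thesis by (intro bexI ballI)
qed

text \<open>As a homomorphism on the free group this product needs no explicit integer
  exponents.\<close>

definition chain_det :: "nat \<Rightarrow> ((nat + nat \<Rightarrow> 'a::ring_1) set \<Rightarrow>\<^sub>0 int) \<Rightarrow> (nat \<Rightarrow> nat \<Rightarrow> 'a) set" where
  "chain_det n = (SOME h. h \<in> hom (free_Abelian_group UNIV) K1_alg \<and> (\<forall>S. h (frag_of S) = corr_det n S))"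

lemma chain_det_spec:
  "(chain_det n :: ((nat + nat \<Rightarrow> 'a::ring_1) set \<Rightarrow>\<^sub>0 int) \<Rightarrow> _) \<in> hom (free_Abelian_group UNIV) K1_alg \<and>
    (\<forall>S :: (nat + nat \<Rightarrow> 'a) set. chain_det n (frag_of S) = corr_det n S)"
proof -
  have "range (corr_det n :: (nat + nat \<Rightarrow> 'a) set \<Rightarrow> _) \<subseteq> carrier K1_alg"
    using corr_det_closed by (intro image_subsetI)
  from comm_group.free_Abelian_group_hom_exists[OF comm_group_K1_alg this]
  obtain h where "h \<in> hom (free_Abelian_group UNIV) K1_alg"
    "\<forall>S \<in> (UNIV :: (nat + nat \<Rightarrow> 'a) set set). h (frag_of S) = corr_det n S"
    by (elim bexE)
  then have "h \<in> hom (free_Abelian_group UNIV) K1_alg \<and>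
    (\<forall>S :: (nat + nat \<Rightarrow> 'a) set. h (frag_of S) = corr_det n S)" by simp
  then show ?thesis
    unfolding chain_det_def
    by (rule someI[of "\<lambda>h. h \<in> hom (free_Abelian_group UNIV) K1_alg \<and> (\<forall>S. h (frag_of S) = corr_det n S)"])
qed

lemmas chain_det_hom = chain_det_spec[THEN conjunct1]
  and chain_det_frag_of = chain_det_spec[THEN conjunct2, rule_format]

lemma chain_det_closed: "chain_det n c \<in> carrier K1_alg"
  by (rule hom_in_carrier[OF chain_det_hom]) simp

lemma chain_det_add: "chain_det n (c + d) = chain_det n c \<otimes>\<^bsub>K1_alg\<^esub> chain_det n d"
  using hom_mult[OF chain_det_hom, of c d n] by simp

lemma chain_det_0: "chain_det n 0 = (\<one>\<^bsub>K1_alg\<^esub> :: (nat \<Rightarrow> nat \<Rightarrow> 'a::ring_1) set)"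
proof -
  interpret K: comm_group "K1_alg :: (nat \<Rightarrow> nat \<Rightarrow> 'a) set monoid" by (rule comm_group_K1_alg)
  have "chain_det n 0 \<otimes>\<^bsub>K1_alg\<^esub> chain_det n 0 = (chain_det n 0 :: (nat \<Rightarrow> nat \<Rightarrow> 'a) set)"
    by (simp flip: chain_det_add)
  then show ?thesis by (simp add: chain_det_closed)
qed

text \<open>Meaningful for sets with a chain, which over an infinite division ring is unique by
  \<open>chain_of_unique\<close>.\<close>

definition set_det :: "nat \<Rightarrow> (nat + nat \<Rightarrow> 'a::ring_1) set \<Rightarrow> (nat \<Rightarrow> nat \<Rightarrow> 'a) set" where
  "set_det n T = chain_det n (THE c. chain_of T c)"

definition map_det :: "nat \<Rightarrow> 'a::ring_1 vec set \<Rightarrow> ('a vec \<Rightarrow> 'a vec) \<Rightarrow> (nat \<Rightarrow> nat \<Rightarrow> 'a) set" where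
  "map_det n E f = set_det n (rel_points (map_rel E f))"

lemma set_det_closed: "set_det n T \<in> carrier K1_alg"
  unfolding set_det_def by (rule chain_det_closed)

lemma map_det_closed: "map_det n E f \<in> carrier K1_alg"
  unfolding map_det_def by (rule set_det_closed)

lemma map_det_cong: "(\<And>x. x \<in> E \<Longrightarrow> f x = g x) \<Longrightarrow> map_det n E f = map_det n E g"
  by (simp add: map_det_def map_rel_def cong: image_cong)

lemma rel_points_map_rel: "rel_points (map_rel E f) = (\<lambda>x. case_sum (vec_fun x) (vec_fun (f x))) ` E"
  by (simp add: rel_points_def map_rel_def image_image)

lemma part_case_sum [simp]:
  "fst_part (case_sum x y) = x" "snd_part (case_sum x y) = y"
  "part12 (case_sum x (case_sum y z)) = case_sum x y" "part13 (case_sum x (case_sum y z)) = case_sum x z"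
  by (auto simp: fst_part_def snd_part_def part12_def part13_def fun_eq_iff split: sum.split)

lemma case_sum_parts: "case_sum (fst_part t) (snd_part t) = t"
  by (auto simp: fst_part_def snd_part_def fun_eq_iff split: sum.split)

lemma vec_fun_eqD: "vec_fun x = vec_fun y \<Longrightarrow> x \<in> carrier_vec n \<Longrightarrow> y \<in> carrier_vec n \<Longrightarrow> x = y"
  by (rule vec_fun_inj) auto

section \<open>Functoriality, additivity, and the value on linear bijections\<close>

context infinite_division_ring
begin

lemma set_det_eq:
  fixes T :: "(nat + nat \<Rightarrow> 'a) set"
  assumes "chain_of T c"
  shows "set_det n T = chain_det n c"
proof -
  have "(THE c. chain_of T c) = c"
  proof (rule the_equality)
    show "chain_of T c" by fact
    show "d = c" if "chain_of T d" for d by (rule chain_of_unique[OF that assms])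
  qed
  then show ?thesis by (simp add: set_det_def)
qed

text \<open>One chain of \<open>T\<close> is projected to all three sets. By
  \<open>chain_of_inj_on\<close> the three coordinates are injective on each of its members, even on
  those not contained in \<open>T\<close>, so \<open>corr_det_triple\<close> applies term by
  term.\<close>

lemma set_det_triple:
  fixes T :: "(nat + nat + nat \<Rightarrow> 'a) set"
  assumes c: "chain_of T c"
    and inj: "inj_on fst_part T" "inj_on (\<lambda>t. fst_part (snd_part t)) T" "inj_on (\<lambda>t. snd_part (snd_part t)) T"
  shows "set_det n (part13 ` T) = set_det n (part12 ` T) \<otimes>\<^bsub>K1_alg\<^esub> set_det n (snd_part ` T)"
proof -
  interpret K: comm_group "K1_alg :: (nat \<Rightarrow> nat \<Rightarrow> 'a) set monoid" by (rule comm_group_K1_alg)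
  let ?ext = "\<lambda>p. frag_extend (\<lambda>S. frag_of (p ` S))"
  have inj': "inj_on (fst_part \<circ> part12) T" "inj_on (fst_part \<circ> part13) T" "inj_on (fst_part \<circ> snd_part) T"
    using inj by (simp_all only: comp_def part_simps)
  note ch = set_det_eq[OF chain_of_image[OF c affine_on_pairs(1) inj_on_imageI2[OF inj'(1)]]]
    set_det_eq[OF chain_of_image[OF c affine_on_pairs(2) inj_on_imageI2[OF inj'(2)]]]
    set_det_eq[OF chain_of_image[OF c affine_on_parts(2) inj_on_imageI2[OF inj'(3)]]]
  define good where "good = {S :: (nat + nat + nat \<Rightarrow> 'a) set. S \<in> affine_sets \<and> inj_on fst_part S \<and>
    inj_on (\<lambda>t. fst_part (snd_part t)) S \<and> inj_on (\<lambda>t. snd_part (snd_part t)) S}"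
  have aff: "affine_on UNIV (\<lambda>t :: nat + nat + nat \<Rightarrow> 'a. fst_part (snd_part t))"
    "affine_on UNIV (\<lambda>t :: nat + nat + nat \<Rightarrow> 'a. snd_part (snd_part t))"
    using affine_on_reindex[of UNIV "Inr \<circ> Inl"] affine_on_reindex[of UNIV "Inr \<circ> Inr"]
    by (simp_all add: fst_part_def snd_part_def comp_assoc)
  have "Poly_Mapping.keys c \<subseteq> good"
  proof
    fix S assume S: "S \<in> Poly_Mapping.keys c"
    then have "S \<in> affine_sets" using c by (auto simp: chain_of_def)
    then show "S \<in> good"
      using chain_of_inj_on[OF c affine_on_parts(1) inj(1) S] chain_of_inj_on[OF c aff(1) inj(2) S]
        chain_of_inj_on[OF c aff(2) inj(3) S] by (simp add: good_def)
  qed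
  then have "chain_det n (?ext part13 c) = chain_det n (?ext part12 c) \<otimes>\<^bsub>K1_alg\<^esub> chain_det n (?ext snd_part c)"
  proof (induction c rule: frag_induction)
    case zero
    show ?case by (simp add: chain_det_0)
  next
    case (one S)
    then show ?case by (simp add: chain_det_frag_of good_def corr_det_triple)
  next
    case (diff a b)
    \<comment> \<open>Writing \<open>a\<close> as \<open>(a - b) + b\<close> avoids inverses; the
      factors belonging to \<open>b\<close> are cancelled afterwards.\<close>
    have sub: "chain_det n (?ext p a) = chain_det n (?ext p (a - b)) \<otimes>\<^bsub>K1_alg\<^esub> chain_det n (?ext p b)"
      for p :: "(nat + nat + nat \<Rightarrow> 'a) \<Rightarrow> nat + nat \<Rightarrow> 'a"
      by (simp flip: chain_det_add frag_extend_add)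
    have "chain_det n (?ext part13 (a - b)) \<otimes>\<^bsub>K1_alg\<^esub> chain_det n (?ext part13 b) =
        chain_det n (?ext part12 (a - b)) \<otimes>\<^bsub>K1_alg\<^esub> chain_det n (?ext snd_part (a - b)) \<otimes>\<^bsub>K1_alg\<^esub> chain_det n (?ext part13 b)"
      using diff sub[of part13] sub[of part12] sub[of snd_part] by (simp add: K.m_ac chain_det_closed)
    then show ?case by (simp add: chain_det_closed)
  qed
  then show ?thesis by (simp only: ch)
qed

lemma map_det_comp:
  fixes E F G :: "'a vec set"
  assumes f: "bij_betw f E F" and g: "bij_betw g F G"
    and car: "E \<subseteq> carrier_vec a" "F \<subseteq> carrier_vec b" "G \<subseteq> carrier_vec c"
    and def: "definable_rel a b (map_rel E f)" "definable_rel b c (map_rel F g)"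
  shows "map_det n E (\<lambda>x. g (f x)) = map_det n E f \<otimes>\<^bsub>K1_alg\<^esub> map_det n F g"
proof -
  define T where "T = (\<lambda>x. case_sum (vec_fun x) (case_sum (vec_fun (f x)) (vec_fun (g (f x))))) ` E"
  have fE: "f x \<in> F" "f x \<in> carrier_vec b" "g (f x) \<in> carrier_vec c" "x \<in> carrier_vec a" if "x \<in> E" for x
    using that f g car by (auto simp: bij_betw_def)
  have p12: "part12 ` T = rel_points (map_rel E f)"
    and p13: "part13 ` T = rel_points (map_rel E (\<lambda>x. g (f x)))"
    by (simp_all add: T_def rel_points_map_rel image_image)
  have "snd_part ` T = (\<lambda>y. case_sum (vec_fun y) (vec_fun (g y))) ` (f ` E)"
    by (simp add: T_def image_image)
  then have p23: "snd_part ` T = rel_points (map_rel F g)"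
    using f by (simp add: rel_points_map_rel bij_betw_def)
  \<comment> \<open>As a fibre product of the two graphs, \<open>T\<close> gets its chain from
    theirs, without a notion of definability for triples.\<close>
  have "T = part12 -` rel_points (map_rel E f) \<inter> snd_part -` rel_points (map_rel F g)"
  proof (intro Set.set_eqI iffI)
    fix t assume "t \<in> T"
    then show "t \<in> part12 -` rel_points (map_rel E f) \<inter> snd_part -` rel_points (map_rel F g)"
      unfolding p12[symmetric] p23[symmetric] by blast
  next
    fix t assume "t \<in> part12 -` rel_points (map_rel E f) \<inter> snd_part -` rel_points (map_rel F g)"
    then obtain x y where x: "x \<in> E" "part12 t = case_sum (vec_fun x) (vec_fun (f x))"
      and y: "y \<in> F" "snd_part t = case_sum (vec_fun y) (vec_fun (g y))"
      by (auto simp: rel_points_map_rel)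
    have "vec_fun (f x) = fst_part (snd_part t)" using arg_cong[OF x(2), of snd_part] by simp
    then have "vec_fun (f x) = vec_fun y" by (simp add: y(2))
    then have "f x = y" using fE[OF x(1)] y(1) car(2) by (blast dest: vec_fun_eqD)
    moreover have "fst_part t = vec_fun x" using arg_cong[OF x(2), of fst_part] by simp
    ultimately have "t = case_sum (vec_fun x) (case_sum (vec_fun (f x)) (vec_fun (g (f x))))"
      using y(2) case_sum_parts[of t] by simp
    then show "t \<in> T" using x(1) by (simp add: T_def)
  qed
  moreover have "\<exists>c. chain_of (part12 -` rel_points (map_rel E f) \<inter> snd_part -` rel_points (map_rel F g) :: (nat + nat + nat \<Rightarrow> 'a) set) c"
  proof -
    from definable_rel_chain[OF def(1)] obtain c where "chain_of (rel_points (map_rel E f)) c" by (elim exE)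
    from chain_of_vimage[OF this affine_on_pairs(1)]
    obtain d where d: "chain_of (part12 -` rel_points (map_rel E f) :: (nat + nat + nat \<Rightarrow> 'a) set) d" by (elim exE)
    from definable_rel_chain[OF def(2)] obtain c' where "chain_of (rel_points (map_rel F g)) c'" by (elim exE)
    from chain_of_vimage[OF this affine_on_parts(2)]
    obtain d' where "chain_of (snd_part -` rel_points (map_rel F g) :: (nat + nat + nat \<Rightarrow> 'a) set) d'" by (elim exE)
    from chain_of_Int[OF d this] show ?thesis .
  qed
  ultimately obtain d where d: "chain_of T d" by (elim exE) simp
  have inj: "inj_on fst_part T" "inj_on (\<lambda>t. fst_part (snd_part t)) T" "inj_on (\<lambda>t. snd_part (snd_part t)) T"
  proof -
    have eq: "x = y" if xy: "x \<in> E" "y \<in> E"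
      and "vec_fun x = vec_fun y \<or> vec_fun (f x) = vec_fun (f y) \<or> vec_fun (g (f x)) = vec_fun (g (f y))" for x y
    proof -
      have "x = y \<or> f x = f y \<or> g (f x) = g (f y)"
        using that fE[OF xy(1)] fE[OF xy(2)] by (blast dest: vec_fun_eqD)
      then show ?thesis using f g xy fE by (auto simp: bij_betw_def dest: inj_onD)
    qed
    show "inj_on fst_part T" "inj_on (\<lambda>t. fst_part (snd_part t)) T" "inj_on (\<lambda>t. snd_part (snd_part t)) T"
      unfolding T_def by (rule inj_onI; auto dest: eq[OF _ _ disjI1] eq[OF _ _ disjI2[OF disjI1]] eq[OF _ _ disjI2[OF disjI2]])+
  qed
  show ?thesis
    unfolding map_det_def p12[symmetric] p13[symmetric] p23[symmetric] by (rule set_det_triple[OF d inj])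
qed

text \<open>The identity is its own square, and an idempotent of a group is trivial.\<close>

lemma map_det_Id:
  fixes E :: "'a vec set"
  assumes "definable_rel m m (Id_on E)" "E \<subseteq> carrier_vec m"
  shows "map_det n E (\<lambda>x. x) = \<one>\<^bsub>K1_alg\<^esub>"
proof -
  interpret K: comm_group "K1_alg :: (nat \<Rightarrow> nat \<Rightarrow> 'a) set monoid" by (rule comm_group_K1_alg)
  have "map_rel E (\<lambda>x. x) = Id_on E" by (auto simp: map_rel_def)
  moreover have "bij_betw (\<lambda>x. x) E E" by (simp add: bij_betw_def)
  ultimately have "map_det n E (\<lambda>x. x) = map_det n E (\<lambda>x. x) \<otimes>\<^bsub>K1_alg\<^esub> map_det n E (\<lambda>x. x)"
    using map_det_comp[of "\<lambda>x. x" E E "\<lambda>x. x" E m m m n] assms by simp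
  then show ?thesis using map_det_closed[of n E "\<lambda>x. x"] K.l_cancel_one' by metis
qed

text \<open>The graphs are disjoint, so their indicators, and with them their chains, add
  up.\<close>

lemma map_det_Un:
  fixes E F :: "'a vec set"
  assumes "E \<inter> F = {}" "E \<subseteq> carrier_vec m" "F \<subseteq> carrier_vec m"
    and def: "definable_rel m k (map_rel E f)" "definable_rel m k (map_rel F f)"
  shows "map_det n (E \<union> F) f = map_det n E f \<otimes>\<^bsub>K1_alg\<^esub> map_det n F f"
proof -
  obtain c d where c: "chain_of (rel_points (map_rel E f)) c" and d: "chain_of (rel_points (map_rel F f)) d"
    using definable_rel_chain[OF def(1)] definable_rel_chain[OF def(2)] by (elim exE)
  have "rel_points (map_rel E f) \<inter> rel_points (map_rel F f) = {}"
  proof (intro equals0I)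
    fix t assume "t \<in> rel_points (map_rel E f) \<inter> rel_points (map_rel F f)"
    then obtain x y where x: "x \<in> E" "t = case_sum (vec_fun x) (vec_fun (f x))"
      and y: "y \<in> F" "t = case_sum (vec_fun y) (vec_fun (f y))" by (auto simp: rel_points_map_rel)
    have "vec_fun x = vec_fun y" using arg_cong[OF x(2), of fst_part] y(2) by simp
    then have "x = y" using x y assms(2,3) by (blast dest: vec_fun_eqD)
    then show False using x y assms(1) by blast
  qed
  from chain_of_Un[OF c d this]
  have "chain_of (rel_points (map_rel (E \<union> F) f)) (c + d)" by (simp add: rel_points_map_rel image_Un)
  then show ?thesis
    unfolding map_det_def by (simp add: set_det_eq[OF c] set_det_eq[OF d] set_det_eq chain_det_add)
qed

lemma map_det_mult:
  fixes E :: "'a vec set"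
  assumes f: "(E, f) \<in> K1_gens" and g: "(E, g) \<in> K1_gens"
  shows "map_det n E (g \<otimes>\<^bsub>Aut E\<^esub> f) = map_det n E g \<otimes>\<^bsub>K1_alg\<^esub> map_det n E f"
proof -
  interpret K: comm_group "K1_alg :: (nat \<Rightarrow> nat \<Rightarrow> 'a) set monoid" by (rule comm_group_K1_alg)
  have def: "definable_map E E f" "definable_map E E g" and bij: "bij_betw f E E" "bij_betw g E E"
    using f g by (auto simp: K1_gens_iff Bij_def)
  then have "definable E" by (simp add: definable_map_def)
  from definable_carrier[OF this] obtain m where m: "E \<subseteq> carrier_vec m" .
  have "map_det n E (g \<otimes>\<^bsub>Aut E\<^esub> f) = map_det n E (\<lambda>x. g (f x))"
    by (rule map_det_cong) (simp add: K1_gens_mult(2)[OF f g] compose_def)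
  also have "\<dots> = map_det n E f \<otimes>\<^bsub>K1_alg\<^esub> map_det n E g"
    by (rule map_det_comp[OF bij m m m]) (rule definable_map_rel[OF def(1) m m] definable_map_rel[OF def(2) m m])+
  finally show ?thesis by (simp add: K.m_comm map_det_closed)
qed

text \<open>On \<open>E\<close>, \<open>push E G h f\<close> after \<open>h\<close> equals
  \<open>h\<close> after \<open>f\<close>; functoriality then has the factor of \<open>h\<close> on
  both sides, where it cancels. The complement of the image carries the identity.\<close>

lemma map_det_push:
  fixes E G :: "'a vec set"
  assumes f: "(E, f) \<in> K1_gens" and h: "definable_map E G h" and inj: "inj_on h E"
  shows "map_det n G (push E G h f) = map_det n E f"
proof -
  interpret K: comm_group "K1_alg :: (nat \<Rightarrow> nat \<Rightarrow> 'a) set monoid" by (rule comm_group_K1_alg)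
  let ?k = "push E G h f"
  have E: "definable E" and G: "definable G" and hE: "h \<in> E \<rightarrow> G"
    using h by (auto simp: definable_map_def PiE_iff)
  have fE: "f \<in> E \<rightarrow> E" and deff: "definable_map E E f" and fB: "bij_betw f E E"
    using f by (auto simp: K1_gens_iff definable_map_def PiE_iff Bij_def)
  from definable_carrier[OF E] obtain a where a: "E \<subseteq> carrier_vec a" .
  from definable_carrier[OF G] obtain b where b: "G \<subseteq> carrier_vec b" .
  have hb: "h ` E \<subseteq> carrier_vec b" "G - h ` E \<subseteq> carrier_vec b" using hE b by auto
  have hB: "bij_betw h E (h ` E)" using inj by (simp add: bij_betw_def)
  note rel = definable_rel_push[OF f h a b]
  have relf: "definable_rel a a (map_rel E f)" by (rule definable_map_rel[OF deff a a])
  have relh: "definable_rel a b (map_rel E h)" by (rule definable_map_rel[OF h a b])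
  have relk: "definable_rel b b (map_rel (h ` E) ?k)" using rel(1) by (simp only: map_rel_push(2)[OF inj hE fE])
  have relc: "definable_rel b b (map_rel (G - h ` E) ?k)" using rel(2) by (simp only: map_rel_push(3)[OF inj hE fE])
  have kB: "bij_betw ?k (h ` E) (h ` E)"
  proof -
    have "?k ` h ` E = h ` f ` E" using push_apply(1)[OF inj hE] by (auto simp: image_iff)
    also have "\<dots> = h ` E" using fB by (simp add: bij_betw_def)
    finally have "?k ` h ` E = h ` E" .
    moreover have "inj_on ?k (h ` E)"
      using push_Bij[of f E h G] f inj hE
      by (auto simp: K1_gens_iff Bij_def bij_betw_def intro: inj_on_subset)
    ultimately show ?thesis by (simp add: bij_betw_def)
  qed
  have "map_det n E h \<otimes>\<^bsub>K1_alg\<^esub> map_det n (h ` E) ?k = map_det n E (\<lambda>x. ?k (h x))"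
    by (rule map_det_comp[OF hB kB a hb(1) hb(1) relh relk, symmetric])
  also have "\<dots> = map_det n E (\<lambda>x. h (f x))"
    by (rule map_det_cong) (simp add: push_apply(1)[OF inj hE])
  also have "\<dots> = map_det n E f \<otimes>\<^bsub>K1_alg\<^esub> map_det n E h"
    by (rule map_det_comp[OF fB hB a a hb(1) relf relh])
  finally have "map_det n E h \<otimes>\<^bsub>K1_alg\<^esub> map_det n (h ` E) ?k = map_det n E h \<otimes>\<^bsub>K1_alg\<^esub> map_det n E f"
    by (simp add: K.m_comm map_det_closed)
  then have k: "map_det n (h ` E) ?k = map_det n E f" by (simp add: map_det_closed)
  have "map_det n (G - h ` E) ?k = map_det n (G - h ` E) (\<lambda>x. x)"
    by (rule map_det_cong) (simp add: push_apply(2)[OF inj hE])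
  also have "\<dots> = \<one>\<^bsub>K1_alg\<^esub>"
  proof (rule map_det_Id[OF _ hb(2)])
    have "map_rel (G - h ` E) ?k = Id_on (G - h ` E)"
      using push_apply(2)[OF inj hE] by (auto simp: map_rel_def image_iff)
    then show "definable_rel b b (Id_on (G - h ` E))" using relc by simp
  qed
  finally have "map_det n (h ` E \<union> (G - h ` E)) ?k = map_det n E f"
    using map_det_Un[OF _ hb relk relc, of n] k by (simp add: map_det_closed)
  moreover have "h ` E \<union> (G - h ` E) = G" using hE by auto
  ultimately show ?thesis by simp
qed

text \<open>The graph is a single affine set, so its chain has one term. Parametrised by the source,
  its projections are the identity and \<open>\<gamma>\<close>, whose matrix is \<open>A\<close>;
  the reference class of \<open>R^n\<close> enters on both sides and cancels.\<close>

lemma map_det_lin: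
  fixes A :: "'a mat"
  assumes A: "A \<in> carrier (GLn n)"
  shows "map_det n (carrier_vec n) (lin A) = K1_alg_class A"
proof -
  interpret K: comm_group "K1_alg :: (nat \<Rightarrow> nat \<Rightarrow> 'a) set monoid" by (rule comm_group_K1_alg)
  have Am: "A \<in> carrier_mat n n" by (rule GLn_carrier_mat[OF A])
  define \<gamma> where "\<gamma> x = (\<lambda>j. if j < n then comb n x (stab A) j else 0)" for x :: "nat \<Rightarrow> 'a"
  define \<phi> where "\<phi> x = case_sum x (\<gamma> x)" for x :: "nat \<Rightarrow> 'a"
  have vf: "vec_fun ` carrier_vec n = (coord_space n :: (nat \<Rightarrow> 'a) set)"
  proof (intro Set.set_eqI iffI)
    fix x :: "nat \<Rightarrow> 'a" assume "x \<in> coord_space n"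
    then have "vec_fun (vec n x) = x" by (auto simp: vec_fun_def coord_space_def fun_eq_iff)
    then show "x \<in> vec_fun ` carrier_vec n" by (metis image_eqI vec_carrier)
  qed (auto simp: vec_fun_def coord_space_def)
  have lin: "vec_fun (lin A v) = \<gamma> (vec_fun v)" if "v \<in> carrier_vec n" for v
    using that Am by (auto simp: \<gamma>_def vec_fun_def lin_def comb_def stab_def fun_eq_iff intro!: sum.cong)
  have aff: "\<gamma> (aff t x y z) = aff t (\<gamma> x) (\<gamma> y) (\<gamma> z)" for t x y z
  proof
    fix j
    have "comb n (\<lambda>i. x i + t * (y i - z i)) v j = comb n x v j + t * (comb n y v j - comb n z v j)" for v
      by (simp add: comb_def algebra_simps sum.distrib sum_distrib_left sum_subtractf)
    then show "\<gamma> (aff t x y z) j = aff t (\<gamma> x) (\<gamma> y) (\<gamma> z) j" by (simp add: \<gamma>_def aff_def)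
  qed
  have bij: "bij_betw (lin A) (carrier_vec n) (carrier_vec n)"
    using lin_in_Aut[OF A] by (simp add: Aut_def Bij_def)
  have \<gamma>_img: "\<gamma> ` coord_space n = coord_space n"
  proof -
    have "\<gamma> ` coord_space n = vec_fun ` lin A ` carrier_vec n"
      unfolding vf[symmetric] image_image by (rule image_cong) (simp_all add: lin)
    then show ?thesis using bij by (simp add: bij_betw_def vf)
  qed
  have \<gamma>_inj: "inj_on \<gamma> (coord_space n)"
  proof (rule inj_onI)
    fix x y assume "x \<in> coord_space n" "y \<in> coord_space n" and eq: "\<gamma> x = \<gamma> y"
    then obtain v w where v: "v \<in> carrier_vec n" "x = vec_fun v" and w: "w \<in> carrier_vec n" "y = vec_fun w"
      unfolding vf[symmetric] by blast
    have "vec_fun (lin A v) = vec_fun (lin A w)" using eq v w by (simp add: lin)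
    moreover have "lin A v \<in> carrier_vec n" "lin A w \<in> carrier_vec n" using bij v w by (auto simp: bij_betw_def)
    ultimately have "lin A v = lin A w" by (rule vec_fun_eqD)
    then show "x = y" using bij v w by (auto simp: bij_betw_def dest: inj_onD)
  qed
  have \<gamma>: "param n (coord_space n) \<gamma>"
    using \<gamma>_img \<gamma>_inj by (simp add: param_def affine_on_def aff)
  have ident: "param n (coord_space n :: (nat \<Rightarrow> 'a) set) (\<lambda>x. x)" by (auto simp: param_def affine_on_def)
  define S where "S = rel_points (map_rel (carrier_vec n) (lin A))"
  have "S = (\<lambda>v. \<phi> (vec_fun v)) ` carrier_vec n"
    unfolding S_def rel_points_map_rel \<phi>_def by (rule image_cong) (simp_all add: lin)
  then have S: "S = \<phi> ` coord_space n" unfolding vf[symmetric] image_image .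
  have aff\<phi>: "\<phi> (aff t x y z) = aff t (\<phi> x) (\<phi> y) (\<phi> z)" for t x y z
    unfolding \<phi>_def aff by (auto simp: aff_def fun_eq_iff split: sum.split)
  have fst\<phi>: "fst_part (\<phi> x) = x" and snd\<phi>: "snd_part (\<phi> x) = \<gamma> x" for x by (simp_all add: \<phi>_def)
  have "inj_on \<phi> (coord_space n)" by (rule inj_on_inverseI[of _ fst_part]) (simp add: fst\<phi>)
  then have \<phi>: "param n S \<phi>" by (simp add: param_def affine_on_def aff\<phi> S)
  have inj: "inj_on fst_part S" "inj_on snd_part S"
    unfolding S using \<gamma>_inj by (auto intro!: inj_onI simp: fst\<phi> snd\<phi> dest: inj_onD)
  have "map_det n (carrier_vec n) (lin A) = corr_det n S"
    unfolding map_det_def S_def[symmetric]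
    by (simp add: set_det_eq[OF chain_of_affine[OF param_affine_set[OF \<phi>]]] chain_det_frag_of)
  moreover have "corr_det n S \<otimes>\<^bsub>K1_alg\<^esub> param_class n (\<lambda>x :: nat \<Rightarrow> 'a. x) =
      affine_class n \<gamma> \<otimes>\<^bsub>K1_alg\<^esub> param_class n (\<lambda>x :: nat \<Rightarrow> 'a. x)"
    using corr_det_param[OF \<phi> inj] param_class_comp[OF ident \<gamma>]
    by (simp add: fst\<phi> snd\<phi> K.m_comm param_class_closed[OF ident] affine_class_closed[OF \<gamma>])
  then have "corr_det n S = affine_class n \<gamma>"
    using param_class_closed[OF ident] affine_class_closed[OF \<gamma>] corr_det_closed[of n S] by simp
  moreover have "linear_part n \<gamma> = stab A"
  proof (intro ext)
    fix i j
    have "comb n (\<lambda>_. 0) (stab A) j = 0" by (simp add: comb_def)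
    moreover have "stab A i j = 0" if "i < n" "\<not> j < n" using Am that by (auto simp: stab_def)
    moreover have "stab A i j = idm i j" if "\<not> i < n" using Am that by (auto simp: stab_def idm_def)
    ultimately show "linear_part n \<gamma> i j = stab A i j"
      by (simp add: linear_part_def \<gamma>_def comb_unit)
  qed
  ultimately show ?thesis by (simp add: affine_class_def K1_alg_class_eq)
qed

lemma lin_K1_gens: "A \<in> carrier (GLn n) \<Longrightarrow> (carrier_vec n, lin A) \<in> K1_gens"
  by (simp add: K1_gens_def lin_in_Aut definable_carrier_vec)

text \<open>\<open>map_det\<close> respects both families of relations and therefore descends to
  \<open>K1_mod\<close>. Only the values on classes of linear maps are recorded, since injectivity
  needs just a left inverse.\<close>

lemma K1_mod_retraction:
  "\<exists>\<Psi>. \<forall>A :: 'a mat. A \<in> carrier (GLn n) \<longrightarrow> \<Psi> (K1_mod_class (carrier_vec n) (lin A)) = K1_alg_class A"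
proof -
  interpret K: comm_group "K1_alg :: (nat \<Rightarrow> nat \<Rightarrow> 'a) set monoid" by (rule comm_group_K1_alg)
  let ?F = "free_Abelian_group (K1_gens :: ('a vec set \<times> ('a vec \<Rightarrow> 'a vec)) set)"
  have "(\<lambda>(E, f). map_det n E f) ` K1_gens \<subseteq> carrier K1_alg" by (auto simp: map_det_closed)
  from K.free_Abelian_group_hom_exists[OF this] obtain h where hom: "h \<in> hom ?F K1_alg"
    and "\<forall>x\<in>K1_gens. h (frag_of x) = (\<lambda>(E, f). map_det n E f) x"
    by (elim bexE)
  then have h: "h (frag_of (E, f)) = map_det n E f" if "(E, f) \<in> K1_gens" for E f using that by fastforce
  interpret H: group_hom ?F K1_alg h by (intro group_hom.intro group_hom_axioms.intro group_free_Abelian_group K.is_group hom)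
  have kernelI: "x - y \<in> kernel ?F K1_alg h" if "x \<in> carrier ?F" "y \<in> carrier ?F" "h x = h y" for x y
  proof -
    have xy: "x - y \<in> carrier ?F" using that keys_diff[of x y] by auto
    then have "h x = h (x - y) \<otimes>\<^bsub>K1_alg\<^esub> h y" using H.hom_mult[OF xy that(2)] by simp
    then have "h (x - y) = \<one>\<^bsub>K1_alg\<^esub>" using that(3) H.hom_closed[OF that(2)] H.hom_closed[OF xy] by simp
    with xy show ?thesis by (simp add: kernel_def)
  qed
  have "K1_rels \<subseteq> kernel ?F K1_alg h"
  proof
    fix r :: "('a vec set \<times> ('a vec \<Rightarrow> 'a vec)) \<Rightarrow>\<^sub>0 int" assume "r \<in> K1_rels"
    then consider
      (mult) E f g where "r = frag_of (E, g \<otimes>\<^bsub>Aut E\<^esub> f) - (frag_of (E, g) + frag_of (E, f))"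
        "(E, f) \<in> K1_gens" "(E, g) \<in> K1_gens"
    | (push) E G h' f where "r = frag_of (G, push E G h' f) - frag_of (E, f)"
        "(E, f) \<in> K1_gens" "definable_map E G h'" "inj_on h' E"
      unfolding K1_rels_def by blast
    then show "r \<in> kernel ?F K1_alg h"
    proof cases
      case mult
      have c: "frag_of (E, g) \<in> carrier ?F" "frag_of (E, f) \<in> carrier ?F" using mult by simp_all
      have "frag_of (E, g) + frag_of (E, f) \<in> carrier ?F" using H.G.m_closed[OF c] by simp
      moreover have "h (frag_of (E, g) + frag_of (E, f)) = map_det n E g \<otimes>\<^bsub>K1_alg\<^esub> map_det n E f"
        using H.hom_mult[OF c] h mult by simp
      ultimately show ?thesis
        unfolding mult(1) using mult K1_gens_mult(1)[OF mult(2,3)]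
        by (intro kernelI) (simp_all add: h map_det_mult)
    next
      case push
      then show ?thesis
        unfolding push(1) using K1_gens_push[OF push(2-4)]
        by (intro kernelI) (simp_all add: h map_det_push)
    qed
  qed
  then have "K1_rel_subgroup \<subseteq> kernel ?F K1_alg h"
    by (rule group.generate_subgroup_incl[OF group_free_Abelian_group _ H.subgroup_kernel])
  then show ?thesis
  proof (rule H.FactGroup_universal_kernel[OF normal_K1_rel])
    fix \<Psi> assume \<Psi>: "\<And>x. x \<in> carrier ?F \<Longrightarrow> \<Psi> (K1_rel_subgroup #>\<^bsub>?F\<^esub> x) = h x"
    have "\<Psi> (K1_mod_class (carrier_vec n) (lin A)) = K1_alg_class A" if "A \<in> carrier (GLn n)" for A
      using \<Psi>[of "frag_of (carrier_vec n, lin A)"] lin_K1_gens[OF that]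
      by (simp add: K1_mod_class_def h map_det_lin that)
    then show ?thesis by (intro exI allI impI)
  qed
qed

end


section \<open>The comparison homomorphism\<close>

lemma lin_mult_compose:
  assumes "A \<in> carrier_mat n n" "B \<in> carrier_mat n n"
  shows "lin (A * B) = compose (carrier_vec n) (lin B) (lin A)"
proof
  fix x
  show "lin (A * B) x = compose (carrier_vec n) (lin B) (lin A) x"
  proof (cases "x \<in> carrier_vec n")
    case True
    then show ?thesis using lin_mult[OF assms True] by (simp add: compose_eq)
  next
    case False
    then show ?thesis using assms by (simp add: lin_def compose_def)
  qed
qed

lemma derived_subset_kernel:
  assumes "group G" "comm_group H" "h \<in> hom G H"
  shows "derived G (carrier G) \<subseteq> kernel G H h"
proof -
  interpret H: comm_group H by fact
  interpret h: group_hom G H h by (intro group_hom.intro group_hom_axioms.intro assms H.is_group)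
  have "h ` derived G (carrier G) = derived H (h ` carrier G)" using h.derived_img[of "carrier G"] by simp
  also have "\<dots> = {\<one>\<^bsub>H\<^esub>}" by (rule H.derived_eq_singleton) auto
  finally show ?thesis
    using h.G.derived_in_carrier[of "carrier G"] by (auto simp: kernel_def)
qed

section \<open>Existence, uniqueness and injectivity of the comparison map at a fixed level\<close>

context infinite_division_ring
begin

text \<open>Surjective stability: each class is that of some \<open>sdiag d\<close>, which is
  present at every level from 1 on.\<close>

lemma K1_alg_class_surj:
  assumes n: "1 \<le> n" and X: "X \<in> carrier (K1_alg :: (nat \<Rightarrow> nat \<Rightarrow> 'a) set monoid)"
  shows "\<exists>A\<in>carrier (GLn n). X = K1_alg_class A"
proof -
  obtain v m where v: "v \<in> GLs m" and Xv: "X = GL_class v"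
    using X by (auto simp: carrier_K1_alg carrier_GL)
  define k where "k = max 1 m"
  have k: "1 \<le> k" "v \<in> GLs k" using GLs_common[OF v v] by (auto simp: k_def)
  let ?d = "ddet k v"
  have d: "?d \<noteq> 0" by (rule ddet_nonzero[OF GLs_row_basis[OF k(2)]])
  have "X = GL_class (sdiag ?d)"
    unfolding Xv
    by (rule GLs_hom_sdiag(2)[where \<omega> = GL_class and n = k, OF comm_group_K1_alg GL_class_closed GL_class_mult k])
  also have "\<dots> = K1_alg_class (corner n (sdiag ?d))"
    by (simp add: K1_alg_class_eq stab_corner[OF sdiag_GLs[OF n d]])
  finally show ?thesis using corner_GLs[OF sdiag_GLs[OF n d]] by (intro bexI)
qed

text \<open>The homomorphism \<open>\<omega>\<close> on \<open>GLs n\<close> is extended to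
  \<open>GL\<close> as the determinant belonging to its character on the \<open>sdiag d\<close>. The
  values lie in a commutative group, so the extension factors through the quotient by the derived
  subgroup.\<close>

lemma induced_hom_exists:
  assumes n: "1 \<le> n"
  shows "\<exists>\<Phi> :: (nat \<Rightarrow> nat \<Rightarrow> 'a) set \<Rightarrow> _. induced_hom n \<Phi>"
proof -
  let ?M = "K1_mod :: ('a vec set \<times> ('a vec \<Rightarrow> 'a vec) \<Rightarrow>\<^sub>0 int) set monoid"
  interpret M: comm_group ?M by (rule comm_group_K1_mod)
  define \<omega> where "\<omega> v = K1_mod_class (carrier_vec n) (lin (corner n v))" for v :: "nat \<Rightarrow> nat \<Rightarrow> 'a"
  have closed: "\<omega> v \<in> carrier ?M" if "v \<in> GLs n" for v
    unfolding \<omega>_def by (rule K1_mod_class_closed[OF lin_K1_gens[OF corner_GLs[OF that]]])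
  have mult: "\<omega> (v \<otimes>\<^bsub>GL\<^esub> w) = \<omega> v \<otimes>\<^bsub>?M\<^esub> \<omega> w" if vw: "v \<in> GLs n" "w \<in> GLs n" for v w
  proof -
    note gens = lin_K1_gens[OF corner_GLs[OF vw(1)]] lin_K1_gens[OF corner_GLs[OF vw(2)]]
    have "corner n (v \<otimes>\<^bsub>GL\<^esub> w) = corner n v * corner n w"
      unfolding corner_mult by (rule corner_eqI) (simp add: GL_mult[OF vw(1)])
    \<comment> \<open>The order of the factors is reversed here and restored by commutativity of
      \<open>K1_mod\<close>.\<close>
    then have "lin (corner n (v \<otimes>\<^bsub>GL\<^esub> w)) = lin (corner n w) \<otimes>\<^bsub>Aut (carrier_vec n)\<^esub> lin (corner n v)"
      by (simp add: lin_mult_compose K1_gens_mult(2)[OF gens])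
    then have "\<omega> (v \<otimes>\<^bsub>GL\<^esub> w) = \<omega> w \<otimes>\<^bsub>?M\<^esub> \<omega> v"
      by (simp add: \<omega>_def K1_mod_class_mult[OF gens])
    then show ?thesis using M.m_comm[OF closed[OF vw(1)] closed[OF vw(2)]] by simp
  qed
  have \<omega>: "\<omega> v = \<omega> (sdiag (ddet n v))" if "v \<in> GLs n" for v
    by (rule GLs_hom_sdiag(2)[where \<omega> = \<omega> and n = n, OF comm_group_K1_mod closed mult n that])
  interpret \<chi>: abelian_character ?M "\<lambda>d. \<omega> (sdiag d)"
    by (rule GLs_hom_sdiag(1)[where \<omega> = \<omega> and n = n, OF comm_group_K1_mod closed mult n])
  interpret h: group_hom GL ?M \<chi>.GL_det
    by (intro group_hom.intro group_hom_axioms.intro group_GL M.is_group \<chi>.GL_det_hom)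
  show ?thesis
  proof (rule h.FactGroup_universal_kernel[OF group.derived_self_is_normal[OF group_GL]
        derived_subset_kernel[OF group_GL comm_group_K1_mod \<chi>.GL_det_hom]])
    fix g assume g_hom: "g \<in> hom (GL Mod derived GL (carrier GL)) ?M"
      and g: "\<And>v. v \<in> carrier GL \<Longrightarrow> g (derived GL (carrier GL) #>\<^bsub>GL\<^esub> v) = \<chi>.GL_det v"
    interpret K: comm_group "K1_alg :: (nat \<Rightarrow> nat \<Rightarrow> 'a) set monoid" by (rule comm_group_K1_alg)
    have g': "g \<in> hom K1_alg ?M" using g_hom by (simp add: K1_alg_def)
    have "restrict g (carrier K1_alg) \<in> hom K1_alg ?M"
      by (rule homI) (simp_all add: hom_in_carrier[OF g'] hom_mult[OF g'])
    moreover have "restrict g (carrier K1_alg) (K1_alg_class A) = K1_mod_class (carrier_vec n) (lin A)"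
      if A: "A \<in> carrier (GLn n)" for A
    proof -
      note v = stab_in_GLs[OF A]
      have "restrict g (carrier K1_alg) (K1_alg_class A) = \<chi>.GL_det (stab A)"
        using g[OF GLs_carrier[OF v]] GL_class_closed[OF v] by (simp add: K1_alg_class_eq GL_class_def)
      \<comment> \<open>At size \<open>n\<close> the extension gives back \<open>\<omega>\<close>;
        this is where injective stability enters.\<close>
      also have "\<dots> = \<omega> (stab A)" using \<chi>.GL_det_eq[OF v] \<omega>[OF v] by simp
      finally show ?thesis by (simp add: \<omega>_def corner_stab[OF GLn_carrier_mat[OF A]])
    qed
    ultimately have "induced_hom n (restrict g (carrier K1_alg))" by (simp add: induced_hom_def)
    then show ?thesis by (intro exI)
  qed
qed

text \<open>The values prescribed at level \<open>n\<close> exhaust \<open>K1_alg\<close> by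
  \<open>K1_alg_class_surj\<close>.\<close>

lemma induced_hom_unique:
  fixes \<Phi> \<Phi>' :: "(nat \<Rightarrow> nat \<Rightarrow> 'a) set \<Rightarrow> _"
  assumes n: "1 \<le> n" and \<Phi>: "induced_hom n \<Phi>" and \<Phi>': "induced_hom n \<Phi>'"
  shows "\<Phi> = \<Phi>'"
proof (rule extensionalityI)
  show "\<Phi> \<in> extensional (carrier K1_alg)" "\<Phi>' \<in> extensional (carrier K1_alg)"
    using \<Phi> \<Phi>' by (simp_all add: induced_hom_def)
  fix X :: "(nat \<Rightarrow> nat \<Rightarrow> 'a) set" assume "X \<in> carrier K1_alg"
  from K1_alg_class_surj[OF n this] obtain A where "A \<in> carrier (GLn n)" "X = K1_alg_class A" by (elim bexE)
  then show "\<Phi> X = \<Phi>' X" using \<Phi> \<Phi>' by (simp add: induced_hom_def)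
qed

text \<open>The retraction inverts \<open>\<Phi>\<close> on the classes of matrices of size
  \<open>n\<close>, and these are all classes.\<close>

lemma induced_hom_inj:
  fixes \<Phi> :: "(nat \<Rightarrow> nat \<Rightarrow> 'a) set \<Rightarrow> _"
  assumes n: "1 \<le> n" and \<Phi>: "induced_hom n \<Phi>"
  shows "inj_on \<Phi> (carrier K1_alg)"
proof -
  from K1_mod_retraction[of n] obtain \<Psi> where
    \<Psi>: "\<forall>A :: 'a mat. A \<in> carrier (GLn n) \<longrightarrow> \<Psi> (K1_mod_class (carrier_vec n) (lin A)) = K1_alg_class A"
    by (elim exE)
  show ?thesis
  proof (rule inj_on_inverseI[of _ \<Psi>])
    fix X :: "(nat \<Rightarrow> nat \<Rightarrow> 'a) set" assume "X \<in> carrier K1_alg"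
    from K1_alg_class_surj[OF n this] obtain A where "A \<in> carrier (GLn n)" "X = K1_alg_class A" by (elim bexE)
    then show "\<Psi> (\<Phi> X) = X" using \<Phi> \<Psi> by (simp add: induced_hom_def)
  qed
qed

end

theorem theorem4p5:
  fixes n :: nat
  assumes "infinite (UNIV :: 'a::division_ring set)"
    and "n \<ge> 1"
  shows "(\<exists>!\<Phi> :: (nat \<Rightarrow> nat \<Rightarrow> 'a) set \<Rightarrow> _. induced_hom n \<Phi>) \<and>
    (\<forall>\<Phi> :: (nat \<Rightarrow> nat \<Rightarrow> 'a) set \<Rightarrow> _. induced_hom n \<Phi> \<longrightarrow> inj_on \<Phi> (carrier K1_alg))"
proof -
  interpret infinite_division_ring "TYPE('a)" by standard (rule assms(1))
  from induced_hom_exists[OF assms(2)] obtain \<Phi> :: "(nat \<Rightarrow> nat \<Rightarrow> 'a) set \<Rightarrow> _" where \<Phi>: "induced_hom n \<Phi>"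
    by (elim exE)
  show ?thesis
  proof (intro conjI ex1I allI impI)
    show "induced_hom n \<Phi>" by (rule \<Phi>)
    show "\<Phi>' = \<Phi>" if "induced_hom n \<Phi>'" for \<Phi>' :: "(nat \<Rightarrow> nat \<Rightarrow> 'a) set \<Rightarrow> _"
      by (rule induced_hom_unique[OF assms(2) that \<Phi>])
    show "inj_on \<Phi>' (carrier K1_alg)" if "induced_hom n \<Phi>'" for \<Phi>' :: "(nat \<Rightarrow> nat \<Rightarrow> 'a) set \<Rightarrow> _"
      by (rule induced_hom_inj[OF assms(2) that])
  qed
qed

end
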